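(* Let $\mathcal{A}$ be a multiarrangement of linear hyperplanes in $\mathbb{C}^n$, let $r$ be its rank and let $m=|\mathcal{A}|$ (counted with multiplicity). Let $\mathcal{E}_{\mathcal{A}}=\Omega_n/I_{\mathcal{A}}$. Then: 1. $\operatorname{Hilb}(\mathcal{E}_{\mathcal{A}};q,0)=\operatorname{Hilb}(\mathbb{C}[x_1,\dots,x_n]/J_{\mathcal{A},1};q)$. 2. $[t^r]\operatorname{Hilb}(\mathcal{E}_{\mathcal{A}};q,t)=\operatorname{Hilb}(\mathbb{C}[x_1,\dots,x_n]/J_{\mathcal{A},0};q)$, where $[t^r](-)$ extracts the coefficient of $t^r$. 3. Let $\operatorname{top}(\mathcal{A})$ denote the homogeneous summand of maximal total degree in $\operatorname{Hilb}(\mathcal{E}_{\mathcal{A}};q,t)\in\mathbb{N}[q,t]$. Then $$\operatorname{top}(\mathcal{A})=(-1)^r q^{m-r}t^r\,\chi_{\mathcal{A}}\!\left(-\frac{q}{t}\right),$$ where $\chi_{\mathcal{A}}$ is the characteristic polynomial of $\mathcal{A}$.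
   Context: Superspace: $\Omega_n=\mathbb{C}[x_1,\dots,x_n]\otimes\wedge\{\theta_1,\dots,\theta_n\}$, where the $x_i$ commute and the $\theta_i$ anticommute; bigraded with $x_i$ in degree $(1,0)$ and $\theta_i$ in degree $(0,1)$. The Euler operator is $df=\sum_{i=1}^n(\partial f/\partial x_i)\cdot\theta_i$ (with $\theta$-variables treated as constants). A multiarrangement is a finite collection $\mathcal{A}=\{H_1,\dots,H_m\}$ of linear hyperplanes (codimension one subspaces) of $\mathbb{C}^n$, repeats allowed. The rank $\mathsf{rk}(A)$ of a subcollection $A\subseteq\mathcal{A}$ is the dimension of the span of the normal linear forms of its hyperplanes; $r=\mathsf{rk}(\mathcal{A})$. For a line $L=\mathbb{C}\cdot(\ell_1,\dots,\ell_n)$ put $\lambda_L=\ell_1x_1+\cdots+\ell_nx_n$ and $\rho_{\mathcal{A}}(L)=\#\{1\le i\le m:L\not\subseteq H_i\}$. For $k\ge-1$, $J_{\mathcal{A},k}=(\lambda_L^{\rho_{\mathcal{A}}(L)+k}: L\subseteq\mathbb{C}^n\text{ a line})\subseteq\mathbb{C}[x_1,\dots,x_n]$, and $$I_{\mathcal{A}}=\left(\lambda_L^{\rho_{\mathcal{A}}(L)+1},\ d\big(\lambda_L^{\rho_{\mathcal{A}}(L)+1}\big)\ :\ L\subseteq\mathbb{C}^n\text{ a line}\right)\subseteq\Omega_n .$$ Hilbert series: $\operatorname{Hilb}(V;q)=\sum_i\dim(V_i)q^i$ for graded $V$; $\operatorname{Hilb}(V;q,t)=\sum_{i,j}\dim(V_{i,j})q^it^j$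 for bigraded $V$, with $q$ tracking bosonic and $t$ tracking fermionic degree. The characteristic polynomial is that of the matroid of $\mathcal{A}$: $\chi_{\mathcal{A}}(s)=\sum_{A\subseteq\mathcal{A}}(-1)^{|A|}s^{r-\mathsf{rk}(A)}$.
   Formalization: Part 2 is stated only for arrangements of full rank r = n; if r < n some line lies in every hyperplane, so J_{A,0} is the unit ideal and its quotient is zero, while the coefficient of t^r is nonzero, so the claim fails. *)

theory Defs
  imports
    "HOL-Analysis.Analysis"
    "HOL-Library.Poly_Mapping"
    "HOL-Computational_Algebra.Computational_Algebra"
begin

section \<open>Polynomials in the commuting variables\<close>

text \<open>The variables are indexed by a finite linearly ordered type \<open>'n\<close>, so that \<open>n = CARD('n)\<close>; the
  order fixes the order in which products of anticommuting variables are written.\<close>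

type_synonym 'n cpoly = "('n \<Rightarrow>\<^sub>0 nat) \<Rightarrow>\<^sub>0 complex"

definition cpoly_const :: "complex \<Rightarrow> 'n cpoly" where
  "cpoly_const c = Poly_Mapping.single 0 c"

definition cpoly_var :: "'n \<Rightarrow> 'n cpoly" where
  "cpoly_var i = Poly_Mapping.single (Poly_Mapping.single i 1) 1"

text \<open>When \<open>x\<^sub>i\<close> does not occur in the monomial \<open>a\<close>, the truncated exponent below is harmless because
  the coefficient vanishes.\<close>

definition cpoly_deriv :: "'n \<Rightarrow> 'n cpoly \<Rightarrow> 'n cpoly" where
  "cpoly_deriv i p =
     (\<Sum>a\<in>Poly_Mapping.keys p.
        Poly_Mapping.single (a - Poly_Mapping.single i 1)
          (of_nat (Poly_Mapping.lookup a i) * Poly_Mapping.lookup p a))"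

definition cpoly_homogeneous :: "nat \<Rightarrow> ('n::finite) cpoly set" where
  "cpoly_homogeneous d =
     {p. \<forall>a\<in>Poly_Mapping.keys p. (\<Sum>i\<in>UNIV. Poly_Mapping.lookup a i) = d}"


section \<open>Superspace\<close>

text \<open>An element of superspace is the family of coefficients \<open>f\<^sub>S\<close> in its unique expansion
  \<open>f = (\<Sum>S. f\<^sub>S * \<theta>\<^sub>S)\<close>, where \<open>\<theta>\<^sub>S\<close> is the product of the \<open>\<theta>\<^sub>i\<close> for \<open>i \<in> S\<close> in increasing order.\<close>

typedef 'n superspace = "UNIV :: ('n set \<Rightarrow> 'n cpoly) set"
  morphisms theta_coeff Superspace
  by simp

setup_lifting type_definition_superspace

text \<open>For disjoint \<open>S\<close> and \<open>T\<close>, sorting the word \<open>\<theta>\<^sub>S * \<theta>\<^sub>T\<close> takes one transposition for every pair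
  \<open>(s, t)\<close> with \<open>t < s\<close>; hence \<open>\<theta>\<^sub>S * \<theta>\<^sub>T = theta_sign S T * \<theta>\<^bsub>S \<union> T\<^esub>\<close>. If \<open>S\<close> and \<open>T\<close>
  meet, the product is zero.\<close>

definition theta_sign :: "'n::linorder set \<Rightarrow> 'n set \<Rightarrow> 'n cpoly" where
  "theta_sign S T = (- 1) ^ card {(s, t). s \<in> S \<and> t \<in> T \<and> t < s}"

lemma theta_sign_empty [simp]: "theta_sign {} T = 1" "theta_sign S {} = 1"
  by (simp_all add: theta_sign_def)

lemma theta_sign_Un_left:
  fixes S T V :: "'n::{finite,linorder} set"
  assumes "S \<inter> T = {}"
  shows "theta_sign (S \<union> T) V = theta_sign S V * theta_sign T V"
proof -
  have "{(s, t). s \<in> S \<union> T \<and> t \<in> V \<and> t < s} =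
        {(s, t). s \<in> S \<and> t \<in> V \<and> t < s} \<union> {(s, t). s \<in> T \<and> t \<in> V \<and> t < s}"
    by auto
  moreover have "{(s, t). s \<in> S \<and> t \<in> V \<and> t < s} \<inter> {(s, t). s \<in> T \<and> t \<in> V \<and> t < s} = {}"
    using assms by auto
  ultimately show ?thesis
    by (simp add: theta_sign_def card_Un_disjoint power_add)
qed

lemma theta_sign_Un_right:
  fixes S T V :: "'n::{finite,linorder} set"
  assumes "T \<inter> V = {}"
  shows "theta_sign S (T \<union> V) = theta_sign S T * theta_sign S V"
proof -
  have "{(s, t). s \<in> S \<and> t \<in> T \<union> V \<and> t < s} =
        {(s, t). s \<in> S \<and> t \<in> T \<and> t < s} \<union> {(s, t). s \<in> S \<and> t \<in> V \<and> t < s}"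
    by auto
  moreover have "{(s, t). s \<in> S \<and> t \<in> T \<and> t < s} \<inter> {(s, t). s \<in> S \<and> t \<in> V \<and> t < s} = {}"
    using assms by auto
  ultimately show ?thesis
    by (simp add: theta_sign_def card_Un_disjoint power_add)
qed

instantiation superspace :: ("{finite,linorder}") ring_1
begin

lift_definition zero_superspace :: "'a superspace" is "\<lambda>_. 0" .

lift_definition one_superspace :: "'a superspace" is "\<lambda>S. if S = {} then 1 else 0" .

lift_definition plus_superspace :: "'a superspace \<Rightarrow> 'a superspace \<Rightarrow> 'a superspace"
  is "\<lambda>f g S. f S + g S" .

lift_definition uminus_superspace :: "'a superspace \<Rightarrow> 'a superspace" is "\<lambda>f S. - f S" .

lift_definition minus_superspace :: "'a superspace \<Rightarrow> 'a superspace \<Rightarrow> 'a superspace"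
  is "\<lambda>f g S. f S - g S" .

lift_definition times_superspace :: "'a superspace \<Rightarrow> 'a superspace \<Rightarrow> 'a superspace"
  is "\<lambda>f g U. \<Sum>S\<in>Pow U. theta_sign S (U - S) * f S * g (U - S)" .

instance
proof
  fix f g h :: "'a superspace"
  show "f + g + h = f + (g + h)" by transfer (simp add: add.assoc)
  show "f + g = g + f" by transfer (simp add: add.commute)
  show "0 + f = f" by transfer simp
  show "- f + f = 0" by transfer simp
  show "f - g = f + - g" by transfer simp
  show "(f + g) * h = f * h + g * h"
    by transfer (simp add: algebra_simps sum.distrib)
  show "f * (g + h) = f * g + f * h"
    by transfer (simp add: algebra_simps sum.distrib)
  show "(0 :: 'a superspace) \<noteq> 1" by transfer (auto simp: fun_eq_iff)
  show "1 * f = f"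
  proof (transfer, rule ext)
    fix f :: "'a set \<Rightarrow> 'a cpoly" and U
    have "(\<Sum>S\<in>Pow U. theta_sign S (U - S) * (if S = {} then 1 else 0) * f (U - S)) =
          (\<Sum>S\<in>Pow U. if S = {} then f U else 0)"
      by (rule sum.cong) auto
    then show "(\<Sum>S\<in>Pow U. theta_sign S (U - S) * (if S = {} then 1 else 0) * f (U - S)) = f U"
      by simp
  qed
  show "f * 1 = f"
  proof (transfer, rule ext)
    fix f :: "'a set \<Rightarrow> 'a cpoly" and U
    have "(\<Sum>S\<in>Pow U. theta_sign S (U - S) * f S * (if U - S = {} then 1 else 0)) =
          (\<Sum>S\<in>Pow U. if S = U then f U else 0)"
      by (rule sum.cong) auto
    then show "(\<Sum>S\<in>Pow U. theta_sign S (U - S) * f S * (if U - S = {} then 1 else 0)) = f U"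
      by simp
  qed
  show "f * g * h = f * (g * h)"
  proof (transfer, rule ext)
    fix f g h :: "'a set \<Rightarrow> 'a cpoly" and U :: "'a set"
    have "(\<Sum>X\<in>Pow U. theta_sign X (U - X) *
            (\<Sum>S\<in>Pow X. theta_sign S (X - S) * f S * g (X - S)) * h (U - X)) =
          (\<Sum>(X, S)\<in>(SIGMA X:Pow U. Pow X).
            theta_sign X (U - X) * (theta_sign S (X - S) * f S * g (X - S)) * h (U - X))"
      by (simp add: sum_distrib_left sum_distrib_right sum.Sigma)
    also have "\<dots> = (\<Sum>(S, T)\<in>(SIGMA S:Pow U. Pow (U - S)).
            theta_sign S (U - S) * f S * (theta_sign T (U - S - T) * g T * h (U - S - T)))"
    proof (rule sum.reindex_bij_witness[where i = "\<lambda>(S, T). (S \<union> T, S)"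
            and j = "\<lambda>(X, S). (S, X - S)"])
      fix a :: "'a set \<times> 'a set"
      assume "a \<in> (SIGMA X:Pow U. Pow X)"
      then obtain X S where a: "a = (X, S)" and sub: "S \<subseteq> X" "X \<subseteq> U" by auto
      have 1: "theta_sign X (U - X) = theta_sign S (U - X) * theta_sign (X - S) (U - X)"
        using theta_sign_Un_left[of S "X - S" "U - X"] sub by (simp add: Un_absorb1)
      have 2: "theta_sign S (U - S) = theta_sign S (X - S) * theta_sign S (U - X)"
      proof -
        have "U - S = (X - S) \<union> (U - X)" using sub by auto
        then show ?thesis using theta_sign_Un_right[of "X - S" "U - X" S] by auto
      qed
      have 3: "U - S - (X - S) = U - X" using sub by auto
      show "(case case a of (X, S) \<Rightarrow> (S, X - S) of (S, T) \<Rightarrow>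
              theta_sign S (U - S) * f S * (theta_sign T (U - S - T) * g T * h (U - S - T))) =
            (case a of (X, S) \<Rightarrow>
              theta_sign X (U - X) * (theta_sign S (X - S) * f S * g (X - S)) * h (U - X))"
        by (simp add: a 1 2 3 mult_ac)
    qed auto
    also have "\<dots> = (\<Sum>S\<in>Pow U. theta_sign S (U - S) * f S *
            (\<Sum>T\<in>Pow (U - S). theta_sign T (U - S - T) * g T * h (U - S - T)))"
      by (simp add: sum_distrib_left sum.Sigma)
    finally show "(\<Sum>X\<in>Pow U. theta_sign X (U - X) *
            (\<Sum>S\<in>Pow X. theta_sign S (X - S) * f S * g (X - S)) * h (U - X)) =
          (\<Sum>S\<in>Pow U. theta_sign S (U - S) * f S *
            (\<Sum>T\<in>Pow (U - S). theta_sign T (U - S - T) * g T * h (U - S - T)))" .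
  qed
qed

end

definition bosonic :: "'n cpoly \<Rightarrow> 'n superspace" where
  "bosonic p = Superspace (\<lambda>S. if S = {} then p else 0)"

definition theta :: "'n \<Rightarrow> 'n superspace" where
  "theta i = Superspace (\<lambda>S. if S = {i} then 1 else 0)"

lemma theta_times_theta:
  "theta_coeff (theta i * theta j) U =
     (if i \<noteq> j \<and> U = {i, j} then theta_sign {i} {j} else 0)"
proof -
  have "theta_coeff (theta i * theta j) U =
      (\<Sum>S\<in>Pow U. theta_sign S (U - S) * (if S = {i} then 1 else 0) *
        (if U - S = {j} then 1 else 0))"
    by (simp add: times_superspace.rep_eq theta_def Superspace_inverse)
  also have "\<dots> = (\<Sum>S\<in>Pow U. if S = {i} then
      (if i \<noteq> j \<and> U = {i, j} then theta_sign {i} {j} else 0) else 0)"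
  proof (rule sum.cong)
    fix S assume "S \<in> Pow U"
    then have "S = {i} \<Longrightarrow> (U - S = {j}) = (i \<noteq> j \<and> U = {i, j})" by auto
    then show "theta_sign S (U - S) * (if S = {i} then 1 else 0) *
        (if U - S = {j} then 1 else 0) = (if S = {i} then
        (if i \<noteq> j \<and> U = {i, j} then theta_sign {i} {j} else 0) else 0)"
      by auto
  qed simp
  finally show ?thesis by auto
qed

lemma theta_anticommute: "theta i * theta j = - (theta j * theta i)"
proof -
  have "{(s, t). s \<in> {i} \<and> t \<in> {j} \<and> t < s} = (if j < i then {(i, j)} else {})" for i j :: 'a
    by auto
  then have "theta_sign {i} {j} = - theta_sign {j} {i}" if "i \<noteq> j"
    using that by (auto simp: theta_sign_def)
  then have "theta_coeff (theta i * theta j) U = theta_coeff (- (theta j * theta i)) U" for U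
    by (simp add: theta_times_theta uminus_superspace.rep_eq insert_commute)
  then show ?thesis by (simp add: theta_coeff_inject[symmetric] fun_eq_iff)
qed

definition superspace_const :: "complex \<Rightarrow> 'n superspace" where
  "superspace_const c = bosonic (cpoly_const c)"

definition superspace_deriv :: "'n \<Rightarrow> 'n superspace \<Rightarrow> 'n superspace" where
  "superspace_deriv i f = Superspace (\<lambda>S. cpoly_deriv i (theta_coeff f S))"

definition euler :: "'n::{finite,linorder} superspace \<Rightarrow> 'n superspace" where
  "euler f = (\<Sum>i\<in>UNIV. superspace_deriv i f * theta i)"

definition superspace_homogeneous :: "nat \<Rightarrow> nat \<Rightarrow> ('n::finite) superspace set" where
  "superspace_homogeneous i j =
     {f. \<forall>S. theta_coeff f S \<in> cpoly_homogeneous i \<and> (card S \<noteq> j \<longrightarrow> theta_coeff f S = 0)}"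


section \<open>Ideals and Hilbert series of quotients\<close>

definition two_sided_ideal :: "'a::ring_1 set \<Rightarrow> bool" where
  "two_sided_ideal I \<longleftrightarrow>
     0 \<in> I \<and> (\<forall>x\<in>I. \<forall>y\<in>I. x + y \<in> I) \<and> (\<forall>a. \<forall>x\<in>I. a * x \<in> I \<and> x * a \<in> I)"

definition ideal_generated :: "'a::ring_1 set \<Rightarrow> 'a set" where
  "ideal_generated G = \<Inter>{I. two_sided_ideal I \<and> G \<subseteq> I}"

text \<open>For a ring with structure map \<open>\<kappa>\<close> from the complex numbers, this is the dimension of the image
  of the subspace \<open>W\<close> in the quotient by \<open>I\<close>: the largest number of elements of \<open>W\<close> whose cosets are
  linearly independent. All \<open>W\<close> used below are finite-dimensional, so the supremum is a maximum.\<close>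

definition quotient_dim :: "(complex \<Rightarrow> 'a::ring_1) \<Rightarrow> 'a set \<Rightarrow> 'a set \<Rightarrow> nat" where
  "quotient_dim \<kappa> I W =
     Sup {card B | B. finite B \<and> B \<subseteq> W \<and>
            (\<forall>c. (\<Sum>b\<in>B. \<kappa> (c b) * b) \<in> I \<longrightarrow> (\<forall>b\<in>B. c b = 0))}"

definition hilb_cpoly_quotient :: "('n::finite) cpoly set \<Rightarrow> int fps" where
  "hilb_cpoly_quotient J =
     Abs_fps (\<lambda>i. int (quotient_dim cpoly_const J (cpoly_homogeneous i)))"

text \<open>In bivariate series and polynomials the outer variable is the fermionic \<open>t\<close> and the inner one the
  bosonic \<open>q\<close>.\<close>

definition hilb_superspace_quotient ::
    "('n::{finite,linorder}) superspace set \<Rightarrow> int fps fps" where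
  "hilb_superspace_quotient I =
     Abs_fps (\<lambda>j. Abs_fps (\<lambda>i.
       int (quotient_dim superspace_const I (superspace_homogeneous i j))))"

definition fps_fps_of_poly_poly :: "int poly poly \<Rightarrow> int fps fps" where
  "fps_fps_of_poly_poly P = fps_of_poly (map_poly fps_of_poly P)"

definition total_degree :: "int poly poly \<Rightarrow> nat" where
  "total_degree P = Max {i + j | i j. coeff (coeff P j) i \<noteq> 0}"

definition homogeneous_summand :: "nat \<Rightarrow> int poly poly \<Rightarrow> int poly poly" where
  "homogeneous_summand d P =
     (\<Sum>j\<le>d. monom (monom (coeff (coeff P j) (d - j)) (d - j)) j)"

definition top_summand :: "int poly poly \<Rightarrow> int poly poly" where
  "top_summand P = homogeneous_summand (total_degree P) P"

definition fract_q :: "int poly poly fract" where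
  "fract_q = to_fract [:[:0, 1:]:]"

definition fract_t :: "int poly poly fract" where
  "fract_t = to_fract [:0, 1:]"


section \<open>Multiarrangements\<close>

text \<open>On \<^typ>\<open>complex ^ 'n\<close> the type-class notions \<^const>\<open>subspace\<close> and \<^const>\<open>dim\<close> refer to real scalars;
  the versions prefixed with \<open>vec\<close> are the complex ones.\<close>

definition linear_hyperplane :: "(complex ^ 'n) set \<Rightarrow> bool" where
  "linear_hyperplane H \<longleftrightarrow> vec.subspace H \<and> vec.dim H + 1 = CARD('n)"

text \<open>A list keeps track of multiplicities; subcollections are sets of positions in the list.\<close>

definition multiarrangement :: "(complex ^ 'n) set list \<Rightarrow> bool" where
  "multiarrangement \<A> \<longleftrightarrow> (\<forall>H\<in>set \<A>. linear_hyperplane H)"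

definition normal_forms :: "(complex ^ 'n) set \<Rightarrow> (complex ^ 'n) set" where
  "normal_forms H = {a. H = {v. (\<Sum>i\<in>UNIV. a $ i * v $ i) = 0}}"

definition arr_rank :: "(complex ^ 'n) set list \<Rightarrow> nat set \<Rightarrow> nat" where
  "arr_rank \<A> S = vec.dim (vec.span (\<Union>i\<in>S. normal_forms (\<A> ! i)))"

definition char_poly_arr :: "(complex ^ 'n) set list \<Rightarrow> int poly" where
  "char_poly_arr \<A> =
     (\<Sum>S\<in>Pow {..<length \<A>}.
        monom ((- 1) ^ card S) (arr_rank \<A> {..<length \<A>} - arr_rank \<A> S))"

definition rho :: "(complex ^ 'n) set list \<Rightarrow> (complex ^ 'n) set \<Rightarrow> nat" where
  "rho \<A> L = card {i. i < length \<A> \<and> \<not> L \<subseteq> \<A> ! i}"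

text \<open>A line is given by a nonzero vector \<open>l\<close> spanning it. Other choices of \<open>l\<close> rescale the form and
  do not affect the ideals below.\<close>

definition line_form :: "complex ^ 'n \<Rightarrow> 'n cpoly" where
  "line_form l = (\<Sum>i\<in>UNIV. cpoly_const (l $ i) * cpoly_var i)"

text \<open>If the rank of \<open>\<A>\<close> is less than \<open>n\<close>, some line lies in all hyperplanes, its form enters
  \<open>ideal_J \<A> 0\<close> with exponent \<open>0\<close>, and \<open>ideal_J \<A> 0\<close> is the unit ideal.\<close>

definition ideal_J :: "(complex ^ 'n) set list \<Rightarrow> nat \<Rightarrow> 'n cpoly set" where
  "ideal_J \<A> k =
     ideal_generated {line_form l ^ (rho \<A> (vec.span {l}) + k) | l. l \<noteq> 0}"

definition ideal_I :: "(complex ^ 'n::{finite,linorder}) set list \<Rightarrow> 'n superspace set" where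
  "ideal_I \<A> =
     ideal_generated
       ({bosonic (line_form l) ^ (rho \<A> (vec.span {l}) + 1) | l. l \<noteq> 0} \<union>
        {euler (bosonic (line_form l) ^ (rho \<A> (vec.span {l}) + 1)) | l. l \<noteq> 0})"

end

theory Submission
  imports Defs
begin

text \<open>Write \<open>x\<close> for the form of a line and \<open>dx\<close> for its differential. Up to a scalar
  \<open>d (x ^ (k + 1))\<close> is \<open>x ^ k * dx\<close>, so the coefficient of \<open>1\<close> in an element of the ideal
  runs through \<open>J\<close> with \<open>k = 1\<close>, and the coefficient of the product of all \<open>\<theta>\<^sub>i\<close> through
  \<open>J\<close> with \<open>k = 0\<close>.

  For the part of maximal total degree, remove one linear form \<open>a\<close>, with kernel \<open>H\<close>, and pick a
  vector \<open>u\<close> with \<open>a u = 1\<close>. The derivative along \<open>a\<close> maps the ideal of \<open>a # A\<close> onto the ideal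
  of \<open>A\<close>, and its kernel in superspace consists of the elements \<open>b + du * c\<close> with \<open>b\<close> and \<open>c\<close>
  supported on \<open>H\<close>. By induction the quotient vanishes in total degree above \<open>m\<close>. In total
  degree \<open>m\<close> the elements \<open>b\<close> therefore disappear, and the quotients form a deletion-restriction
  sequence \<open>0 \<rightarrow> E (A restricted to H) \<rightarrow> E (a # A) \<rightarrow> E A \<rightarrow> 0\<close>. It is exact on the left
  because contracting with \<open>a\<close> recovers \<open>c\<close> from \<open>du * c\<close>. The coefficients of the
  characteristic polynomial obey the same recursion, up to sign.\<close>

text \<open>Left exactness is the delicate point. If \<open>dform u * c\<close> lies in the ideal of
  \<open>a # A\<close> over \<open>W\<close>, contraction puts \<open>c\<close> only into the ideal
  of \<open>A\<close> over \<open>W\<close>, while the sequence needs it in the ideal over the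
  smaller space \<open>H\<close>, which has fewer generators and fewer coefficients. The bridge is
  \<open>apolar\<close>: in total degree \<open>length A\<close> the ideal over every subspace is
  cut out by the same functionals, whose definition does not mention the subspace. Hence an element
  of \<open>subalgebra H\<close> that is annihilated because it lies in the ideal over
  \<open>W\<close> also lies in the ideal over \<open>H\<close>.

  Restriction never changes variables: all restricted arrangements live in the one superspace on the
  ambient space, with the subspace as a parameter. A form that vanishes on the subspace stays in the
  list. The top degree is measured by \<open>length A\<close>, so such a loop makes the quotient
  vanish there, just as the characteristic polynomial of a matroid with a loop is zero.\<close>

section \<open>Polynomials: coefficients, derivatives and graded pieces\<close>

lemma lookup_single_times:
  fixes p :: "'n cpoly"
  shows "Poly_Mapping.lookup (Poly_Mapping.single b c * p) (b + a) = c * Poly_Mapping.lookup p a"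
  by (simp add: lookup_mult lookup_single when_mult)

lemma lookup_single_times_eq_0:
  fixes p :: "'n cpoly"
  assumes "\<And>d. a \<noteq> b + d"
  shows "Poly_Mapping.lookup (Poly_Mapping.single b c * p) a = 0"
  using assms by (simp add: lookup_mult lookup_single when_mult)

lemma lookup_cpoly_const_times [simp]:
  "Poly_Mapping.lookup (cpoly_const c * p) a = c * Poly_Mapping.lookup p a"
  using lookup_single_times[of 0 c p a] by (simp add: cpoly_const_def)

lemma monomial_split:
  fixes a :: "'n \<Rightarrow>\<^sub>0 nat"
  assumes "Poly_Mapping.lookup a i \<noteq> 0"
  shows "Poly_Mapping.single i 1 + (a - Poly_Mapping.single i 1) = a"
  using assms
    by (intro poly_mapping_eqI) (auto simp: lookup_add lookup_minus lookup_single when_def)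

lemma lookup_cpoly_var_times:
  "Poly_Mapping.lookup (cpoly_var i * p) a =
     (if Poly_Mapping.lookup a i =
        0 then 0 else Poly_Mapping.lookup p (a - Poly_Mapping.single i 1))"
proof (cases "Poly_Mapping.lookup a i = 0")
  case True
  then have "a \<noteq> Poly_Mapping.single i 1 + d" for d
    by (auto simp: lookup_add)
  then show ?thesis
    using True by (simp add: cpoly_var_def lookup_single_times_eq_0)
next
  case False
  then show ?thesis
    using lookup_single_times[of "Poly_Mapping.single i 1" 1 p "a - Poly_Mapping.single i 1"]
    by (simp only: cpoly_var_def monomial_split[OF False] if_False) simp
qed

lemma cpoly_const_add: "cpoly_const (c + d) = cpoly_const c + cpoly_const d"
  by (simp add: cpoly_const_def single_add)

lemma cpoly_const_mult: "cpoly_const (c * d) = cpoly_const c * cpoly_const d"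
  by (simp add: cpoly_const_def mult_single)

lemma cpoly_const_0 [simp]: "cpoly_const 0 = 0"
  by (simp add: cpoly_const_def)

lemma cpoly_const_1 [simp]: "cpoly_const 1 = 1"
  by (simp add: cpoly_const_def)

text \<open>Of all monomials in the defining sum only \<open>a + Poly_Mapping.single i 1\<close>
  reaches the coefficient at \<open>a\<close>. Linearity and the product rule thereby become
  identities of coefficients.\<close>

lemma lookup_cpoly_deriv:
  "Poly_Mapping.lookup (cpoly_deriv i p) a =
     of_nat (Poly_Mapping.lookup a i + 1) * Poly_Mapping.lookup p (a + Poly_Mapping.single i 1)"
proof -
  let ?e = "Poly_Mapping.single i (1::nat)"
  have *: "Poly_Mapping.lookup (Poly_Mapping.single (b - ?e)
             (of_nat (Poly_Mapping.lookup b i) * Poly_Mapping.lookup p b)) a =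
        (if b =
           a + ?e then of_nat (Poly_Mapping.lookup b i) * Poly_Mapping.lookup p b else 0)" for b
  proof (cases "Poly_Mapping.lookup b i = 0")
    case True
    then have "b \<noteq> a + ?e" by (auto simp: lookup_add)
    then show ?thesis using True by simp
  next
    case False
    then have "b - ?e = a \<longleftrightarrow> b = a + ?e"
      using monomial_split[of b i] by (auto simp: add.commute)
    then show ?thesis by (auto simp: lookup_single when_def)
  qed
  show ?thesis
    unfolding cpoly_deriv_def lookup_sum *
    by (auto simp: sum.delta lookup_add in_keys_iff)
qed

lemma cpoly_deriv_add: "cpoly_deriv i (p + q) = cpoly_deriv i p + cpoly_deriv i q"
  by (intro poly_mapping_eqI) (simp add: lookup_cpoly_deriv lookup_add algebra_simps)

lemma cpoly_deriv_const_times: "cpoly_deriv i (cpoly_const c * p) = cpoly_const c * cpoly_deriv i p"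
  by (intro poly_mapping_eqI) (simp add: lookup_cpoly_deriv)

lemma cpoly_deriv_zero [simp]: "cpoly_deriv i 0 = 0"
  by (simp add: cpoly_deriv_def)

lemma cpoly_deriv_one [simp]: "cpoly_deriv i 1 = 0"
  by (simp add: cpoly_deriv_def)

lemma cpoly_deriv_var_times:
  "cpoly_deriv i (cpoly_var j * p) = (if i = j then p else 0) + cpoly_var j * cpoly_deriv i p"
proof (intro poly_mapping_eqI)
  fix a :: "'a \<Rightarrow>\<^sub>0 nat"
  have "a - Poly_Mapping.single j 1 + Poly_Mapping.single i 1 =
        a + Poly_Mapping.single i 1 - Poly_Mapping.single j 1"
    if "Poly_Mapping.lookup a j \<noteq> 0"
    using that
      by (intro poly_mapping_eqI) (auto simp: lookup_add lookup_minus lookup_single when_def)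
  then show "Poly_Mapping.lookup (cpoly_deriv i (cpoly_var j * p)) a =
        Poly_Mapping.lookup ((if i = j then p else 0) + cpoly_var j * cpoly_deriv i p) a"
    by (auto simp: lookup_cpoly_deriv lookup_cpoly_var_times lookup_add lookup_minus lookup_single
        when_def distrib_right left_diff_distrib)
qed

definition monomial_degree :: "('n::finite \<Rightarrow>\<^sub>0 nat) \<Rightarrow> nat" where
  "monomial_degree a = (\<Sum>i\<in>UNIV. Poly_Mapping.lookup a i)"

lemma monomial_degree_add: "monomial_degree (a + b) = monomial_degree a + monomial_degree b"
  by (simp add: monomial_degree_def lookup_add sum.distrib)

lemma monomial_degree_single [simp]: "monomial_degree (Poly_Mapping.single i d) = d"
  by (simp add: monomial_degree_def lookup_single when_def)

text \<open>Degrees are integers, so that the component in degree \<open>d - 1\<close> makes sense for \<open>d =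
   0\<close>, where it
  vanishes.\<close>

lift_definition cpoly_component :: "int \<Rightarrow> ('n::finite) cpoly \<Rightarrow> 'n cpoly"
  is "\<lambda>d p a. if int (monomial_degree a) = d then p a else 0"
proof -
  fix d and p :: "('n \<Rightarrow>\<^sub>0 nat) \<Rightarrow> complex"
  assume "finite {a. p a \<noteq> 0}"
  then show "finite {a. (if int (monomial_degree a) = d then p a else 0) \<noteq> 0}"
    by (rule rev_finite_subset) auto
qed

lemma cpoly_component_add: "cpoly_component d (p + q) = cpoly_component d p + cpoly_component d q"
  by (intro poly_mapping_eqI) (simp add: cpoly_component.rep_eq lookup_add)

lemma cpoly_component_const_times:
  "cpoly_component d (cpoly_const c * p) = cpoly_const c * cpoly_component d p"
  by (intro poly_mapping_eqI) (simp add: cpoly_component.rep_eq)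

lemma cpoly_component_zero [simp]: "cpoly_component d 0 = 0"
  by (intro poly_mapping_eqI) (simp add: cpoly_component.rep_eq)

lemma cpoly_component_var_times:
  "cpoly_component d (cpoly_var i * p) = cpoly_var i * cpoly_component (d - 1) p"
proof (intro poly_mapping_eqI)
  fix a :: "'a \<Rightarrow>\<^sub>0 nat"
  have "monomial_degree a = 1 + monomial_degree (a - Poly_Mapping.single i 1)"
    if "Poly_Mapping.lookup a i \<noteq> 0"
    using monomial_degree_add[of "Poly_Mapping.single i 1" "a - Poly_Mapping.single i 1"]
    by (simp add: monomial_split[OF that, simplified])
  then show "Poly_Mapping.lookup (cpoly_component d (cpoly_var i * p)) a =
        Poly_Mapping.lookup (cpoly_var i * cpoly_component (d - 1) p) a"
    by (auto simp: cpoly_component.rep_eq lookup_cpoly_var_times)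
qed

lemma cpoly_component_one: "cpoly_component d 1 = (if d = 0 then 1 else 0)"
  by (intro poly_mapping_eqI)
    (auto simp: cpoly_component.rep_eq lookup_one when_def monomial_degree_def)

lemma cpoly_component_eq_iff:
  "cpoly_component (int d) p = p \<longleftrightarrow> p \<in> cpoly_homogeneous d"
  unfolding cpoly_homogeneous_def monomial_degree_def[symmetric]
  by (auto simp: poly_mapping_eq_iff fun_eq_iff cpoly_component.rep_eq in_keys_iff)

lemma cpoly_component_idem [simp]: "cpoly_component d (cpoly_component d p) = cpoly_component d p"
  by (intro poly_mapping_eqI) (simp add: cpoly_component.rep_eq)

lemma cpoly_component_neg: "d < 0 \<Longrightarrow> cpoly_component d p = 0"
  by (intro poly_mapping_eqI) (simp add: cpoly_component.rep_eq)

lemma cpoly_component_sign: "cpoly_component d ((-1) ^ k * p) = (-1) ^ k * cpoly_component d p"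
  using cpoly_component_const_times[of d "(-1) ^ k" p]
  by (cases "even k") (auto simp: cpoly_const_def single_uminus)

text \<open>Removing one variable lowers the degree of a monomial, and a polynomial is assembled one
  monomial at a time. This is the polynomial half of the proof that the variables generate
  superspace.\<close>

lemma cpoly_induct [case_names add var const]:
  fixes p :: "('n::finite) cpoly"
  assumes add: "\<And>p q. Q p \<Longrightarrow> Q q \<Longrightarrow> Q (p + q)"
    and var: "\<And>i p. Q p \<Longrightarrow> Q (cpoly_var i * p)"
    and const: "\<And>c. Q (cpoly_const c)"
  shows "Q p"
proof -
  have mono: "Q (Poly_Mapping.single a c)" for a c
  proof (induction "monomial_degree a" arbitrary: a)
    case 0
    then have "a = 0" by (intro poly_mapping_eqI) (simp add: monomial_degree_def)
    then show ?case using const[of c] by (simp add: cpoly_const_def)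
  next
    case (Suc d)
    then have "(\<Sum>i\<in>UNIV. Poly_Mapping.lookup a i) \<noteq> 0"
      by (metis Zero_not_Suc monomial_degree_def)
    then obtain i where i: "Poly_Mapping.lookup a i \<noteq> 0"
      by (meson sum.neutral)
    have "monomial_degree a = 1 + monomial_degree (a - Poly_Mapping.single i 1)"
      using monomial_degree_add[of "Poly_Mapping.single i 1" "a - Poly_Mapping.single i 1"]
      by (simp add: monomial_split[OF i, simplified])
    then have "Q (Poly_Mapping.single (a - Poly_Mapping.single i 1) c)"
      using Suc by auto
    from var[OF this, of i] show ?case
      by (simp add: cpoly_var_def mult_single monomial_split[OF i, simplified])
  qed
  show ?thesis
  proof (induction p rule: update_induct)
    case const
    then show ?case using mono[of 0 0] by simp
  next
    case (update f a b)
    have "Poly_Mapping.update a b f = f + Poly_Mapping.single a b"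
      using update.hyps
      by (intro poly_mapping_eqI)
        (auto simp: Poly_Mapping.lookup_update lookup_add lookup_single when_def in_keys_iff)
    then show ?case using add mono update.IH by metis
  qed
qed

section \<open>Scalars and coefficients in superspace\<close>

definition sscale :: "complex \<Rightarrow> ('n::{finite,linorder}) superspace \<Rightarrow> 'n superspace" where
  "sscale c f = superspace_const c * f"

definition bvar :: "'n::{finite,linorder} \<Rightarrow> 'n superspace" where
  "bvar i = bosonic (cpoly_var i)"

lemma superspace_eqI: "(\<And>S. theta_coeff f S = theta_coeff g S) \<Longrightarrow> f = g"
  by (simp add: theta_coeff_inject[symmetric] fun_eq_iff)

lemma theta_coeff_Superspace [simp]: "theta_coeff (Superspace f) = f"
  by (simp add: Superspace_inverse)

lemmas theta_coeff_simps [simp] = zero_superspace.rep_eq one_superspace.rep_eq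
  plus_superspace.rep_eq uminus_superspace.rep_eq minus_superspace.rep_eq

lemma theta_coeff_sum: "theta_coeff (\<Sum>i\<in>A. f i) S = (\<Sum>i\<in>A. theta_coeff (f i) S)"
  by (induction A rule: infinite_finite_induct) auto

lemma theta_coeff_bosonic: "theta_coeff (bosonic p) S = (if S = {} then p else 0)"
  by (simp add: bosonic_def)

lemma theta_coeff_bosonic_times [simp]: "theta_coeff (bosonic p * f) S = p * theta_coeff f S"
proof -
  have "theta_coeff (bosonic p * f) S =
      (\<Sum>T\<in>Pow S. if T = {} then p * theta_coeff f S else 0)"
    unfolding times_superspace.rep_eq by (rule sum.cong) (auto simp: theta_coeff_bosonic)
  then show ?thesis by simp
qed

lemma theta_coeff_times_bosonic: "theta_coeff (f * bosonic p) S = p * theta_coeff f S"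
proof -
  have "theta_coeff (f * bosonic p) S =
      (\<Sum>T\<in>Pow S. if T = S then p * theta_coeff f S else 0)"
    unfolding times_superspace.rep_eq by (rule sum.cong) (auto simp: theta_coeff_bosonic)
  then show ?thesis by simp
qed

lemma bosonic_commute: "f * bosonic p = bosonic p * f"
  by (rule superspace_eqI) (simp add: theta_coeff_times_bosonic)

lemma bosonic_add: "bosonic (p + q) = bosonic p + bosonic q"
  by (rule superspace_eqI) (simp add: theta_coeff_bosonic)

lemma bosonic_mult: "bosonic (p * q) = bosonic p * bosonic q"
  by (rule superspace_eqI) (simp add: theta_coeff_bosonic)

lemma bosonic_0 [simp]: "bosonic 0 = 0"
  by (rule superspace_eqI) (simp add: theta_coeff_bosonic)

lemma bosonic_1 [simp]: "bosonic 1 = 1"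
  by (rule superspace_eqI) (simp add: theta_coeff_bosonic)

lemma bosonic_power: "bosonic (p ^ k) = bosonic p ^ k"
  by (induction k) (simp_all add: bosonic_mult)

lemma bosonic_sum: "bosonic (\<Sum>i\<in>A. p i) = (\<Sum>i\<in>A. bosonic (p i))"
  by (induction A rule: infinite_finite_induct) (auto simp: bosonic_add)

lemma theta_coeff_theta_times:
  "theta_coeff (theta i * f) S =
     (if i \<in> S then theta_sign {i} (S - {i}) * theta_coeff f (S - {i}) else 0)"
proof -
  have "theta_coeff (theta i * f) S =
      (\<Sum>T\<in>Pow S. if T = {i} then theta_sign {i} (S - {i}) * theta_coeff f (S - {i}) else 0)"
    unfolding times_superspace.rep_eq by (rule sum.cong) (auto simp: theta_def)
  then show ?thesis by simp
qed

lemma theta_coeff_sscale [simp]: "theta_coeff (sscale c f) S = cpoly_const c * theta_coeff f S"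
  by (simp add: sscale_def superspace_const_def)

lemma theta_coeff_bvar_times [simp]: "theta_coeff (bvar i * f) S = cpoly_var i * theta_coeff f S"
  by (simp add: bvar_def)

lemma sscale_add_right: "sscale c (f + g) = sscale c f + sscale c g"
  by (simp add: sscale_def distrib_left)

lemma sscale_diff_right: "sscale c (f - g) = sscale c f - sscale c g"
  by (simp add: sscale_def right_diff_distrib)

lemma sscale_add_left: "sscale (c + d) f = sscale c f + sscale d f"
  by (rule superspace_eqI) (simp add: cpoly_const_add distrib_right)

lemma sscale_sscale [simp]: "sscale c (sscale d f) = sscale (c * d) f"
  by (rule superspace_eqI) (simp add: cpoly_const_mult mult.assoc)

lemma sscale_one [simp]: "sscale 1 f = f"
  by (rule superspace_eqI) simp

lemma sscale_zero_left [simp]: "sscale 0 f = 0"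
  by (rule superspace_eqI) simp

lemma sscale_zero_right [simp]: "sscale c 0 = 0"
  by (rule superspace_eqI) simp

lemma sscale_minus_one: "sscale (- 1) f = - f"
  using sscale_add_left[of 1 "- 1" f] by (simp add: eq_neg_iff_add_eq_0 add.commute)

lemma sscale_sum: "sscale c (\<Sum>i\<in>A. f i) = (\<Sum>i\<in>A. sscale c (f i))"
  by (simp add: sscale_def sum_distrib_left)

lemma sscale_sum_left: "sscale (\<Sum>i\<in>A. c i) f = (\<Sum>i\<in>A. sscale (c i) f)"
  by (induction A rule: infinite_finite_induct) (auto simp: sscale_add_left)

lemma sscale_mult_left: "sscale c f * g = sscale c (f * g)"
  by (simp add: sscale_def mult.assoc)

lemma sscale_mult_right: "f * sscale c g = sscale c (f * g)"
  using bosonic_commute[of f "cpoly_const c"]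
  by (simp add: sscale_def superspace_const_def mult.assoc[symmetric])

section \<open>Linear forms and their differentials\<close>

text \<open>Bilinear, without conjugation: the first argument is usually a linear form and the
  second a vector.\<close>

definition dot :: "complex ^ 'n::finite \<Rightarrow> complex ^ 'n \<Rightarrow> complex" where
  "dot a v = (\<Sum>i\<in>UNIV. a $ i * v $ i)"

lemma dot_add_right: "dot a (v + w) = dot a v + dot a w"
  by (simp add: dot_def distrib_left sum.distrib)

lemma dot_add_left: "dot (a + b) v = dot a v + dot b v"
  by (simp add: dot_def distrib_right sum.distrib)

lemma dot_diff_right: "dot a (v - w) = dot a v - dot a w"
  by (simp add: dot_def right_diff_distrib sum_subtractf)

lemma dot_diff_left: "dot (a - b) v = dot a v - dot b v"
  by (simp add: dot_def left_diff_distrib sum_subtractf)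

lemma dot_scale_right: "dot a (c *s v) = c * dot a v"
  by (simp add: dot_def sum_distrib_left ac_simps)

lemma dot_scale_left: "dot (c *s a) v = c * dot a v"
  by (simp add: dot_def sum_distrib_left ac_simps)

lemma dot_zero [simp]: "dot a 0 = 0" "dot 0 a = 0"
  by (simp_all add: dot_def)

definition lform :: "complex ^ ('n::{finite,linorder}) \<Rightarrow> 'n superspace" where
  "lform l = (\<Sum>i\<in>UNIV. sscale (l $ i) (bvar i))"

definition dform :: "complex ^ ('n::{finite,linorder}) \<Rightarrow> 'n superspace" where
  "dform l = (\<Sum>i\<in>UNIV. sscale (l $ i) (theta i))"

lemma lform_eq_bosonic: "lform l = bosonic (line_form l)"
  by (simp add: lform_def line_form_def bosonic_sum sscale_def bvar_def superspace_const_def bosonic_mult)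

lemma lform_times: "lform l * f = (\<Sum>i\<in>UNIV. sscale (l $ i) (bvar i * f))"
  by (simp add: lform_def sum_distrib_right sscale_mult_left)

lemma dform_times: "dform l * f = (\<Sum>i\<in>UNIV. sscale (l $ i) (theta i * f))"
  by (simp add: dform_def sum_distrib_right sscale_mult_left)

lemma times_dform: "f * dform l = (\<Sum>i\<in>UNIV. sscale (l $ i) (f * theta i))"
  by (simp add: dform_def sum_distrib_left sscale_mult_right)

lemma lform_commute: "f * lform l = lform l * f"
  by (simp add: lform_eq_bosonic bosonic_commute)

lemma lform_power_commute: "f * lform l ^ k = lform l ^ k * f"
  by (simp add: lform_eq_bosonic bosonic_power[symmetric] bosonic_commute)

lemma lform_linear: "lform (v + c *s w) = lform v + sscale c (lform w)"
  by (simp add: lform_def sscale_add_left sum.distrib sscale_sum)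

lemma dform_linear: "dform (v + c *s w) = dform v + sscale c (dform w)"
  by (simp add: dform_def sscale_add_left sum.distrib sscale_sum)

lemma lform_zero [simp]: "lform 0 = 0" by (simp add: lform_def)

lemma dform_zero [simp]: "dform 0 = 0" by (simp add: dform_def)

lemma lform_axis: "lform (axis i 1) = bvar i"
proof -
  have "lform (axis i 1) = (\<Sum>j\<in>UNIV. if j = i then bvar j else 0)"
    unfolding lform_def by (rule sum.cong) (auto simp: axis_def)
  then show ?thesis by simp
qed

lemma dform_axis: "dform (axis i 1) = theta i"
proof -
  have "dform (axis i 1) = (\<Sum>j\<in>UNIV. if j = i then theta j else 0)"
    unfolding dform_def by (rule sum.cong) (auto simp: axis_def)
  then show ?thesis by simp
qed

lemma dform_anticommute: "dform v * dform w = - (dform w * dform v)"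
proof -
  have "dform v * dform w = (\<Sum>i\<in>UNIV. \<Sum>j\<in>UNIV. sscale (v $ i * w $ j) (theta i * theta j))"
    unfolding dform_times[of v] times_dform[of _ w] sscale_sum sscale_sscale
    by (subst sum.swap) (simp add: mult.commute)
  also have "\<dots> = (\<Sum>i\<in>UNIV. \<Sum>j\<in>UNIV. - sscale (w $ j * v $ i) (theta j * theta i))"
  proof (intro sum.cong refl)
    fix i j
    show "sscale (v $ i * w $ j) (theta i * theta j) = - sscale (w $ j * v $ i) (theta j * theta i)"
      by (subst theta_anticommute) (simp add: sscale_minus_one[symmetric] ac_simps)
  qed
  also have "\<dots> = - (\<Sum>j\<in>UNIV. \<Sum>i\<in>UNIV. sscale (w $ j * v $ i) (theta j * theta i))"
    by (subst sum.swap) (simp add: sum_negf)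
  also have "(\<Sum>j\<in>UNIV. \<Sum>i\<in>UNIV. sscale (w $ j * v $ i) (theta j * theta i)) = dform w * dform v"
    unfolding dform_times[of w] times_dform[of _ v] sscale_sum sscale_sscale
    by (subst sum.swap) (simp add: mult.commute)
  finally show ?thesis .
qed

text \<open>Anticommutation alone gives only that twice the square is zero; the factor 2 is divided
  out over the complex numbers.\<close>

lemma dform_square [simp]: "dform v * dform v = 0"
proof -
  have "dform v * dform v + dform v * dform v = 0"
    using dform_anticommute[of v v] by (simp add: eq_neg_iff_add_eq_0)
  then have "sscale 2 (dform v * dform v) = 0"
    using sscale_add_left[of 1 1 "dform v * dform v"] by simp
  then have "sscale (1/2) (sscale 2 (dform v * dform v)) = 0" by simp
  then show ?thesis by simp
qed

lemma superspace_const_times: "superspace_const c * f = sscale c f"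
  by (simp add: sscale_def)

section \<open>The superspace of a subspace\<close>

text \<open>For a linear subspace \<open>W\<close> this is the superspace generated by the forms of
  lines in \<open>W\<close>, realised inside the ambient one. Building elements by left
  multiplication with one generator at a time gives an induction on which all operator identities
  below can be checked.\<close>

inductive_set subalgebra :: "(complex ^ 'n::{finite,linorder}) set \<Rightarrow> ('n::{finite,linorder}) superspace set" for W where
  one: "1 \<in> subalgebra W"
| add: "f \<in> subalgebra W \<Longrightarrow> g \<in> subalgebra W \<Longrightarrow> f + g \<in> subalgebra W"
| scale: "f \<in> subalgebra W \<Longrightarrow> sscale c f \<in> subalgebra W"
| lform: "l \<in> W \<Longrightarrow> f \<in> subalgebra W \<Longrightarrow> lform l * f \<in> subalgebra W"
| dform: "l \<in> W \<Longrightarrow> f \<in> subalgebra W \<Longrightarrow> dform l * f \<in> subalgebra W"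

lemma subalgebra_zero [simp]: "0 \<in> subalgebra W"
  using subalgebra.scale[OF subalgebra.one, of 0] by simp

lemma subalgebra_diff: "f \<in> subalgebra W \<Longrightarrow> g \<in> subalgebra W \<Longrightarrow> f - g \<in> subalgebra W"
  using subalgebra.add[of f W "sscale (- 1) g"] subalgebra.scale[of g W "- 1"]
  by (simp add: sscale_minus_one)

lemma subalgebra_sum: "(\<And>i. i \<in> A \<Longrightarrow> f i \<in> subalgebra W) \<Longrightarrow> (\<Sum>i\<in>A. f i) \<in> subalgebra W"
  by (induction A rule: infinite_finite_induct) (auto intro: subalgebra.add)

lemma subalgebra_lform_power: "l \<in> W \<Longrightarrow> f \<in> subalgebra W \<Longrightarrow> lform l ^ k * f \<in> subalgebra W"
  by (induction k) (auto simp: mult.assoc intro: subalgebra.lform)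

lemma subalgebra_mono: "f \<in> subalgebra V \<Longrightarrow> V \<subseteq> W \<Longrightarrow> f \<in> subalgebra W"
  by (induction f rule: subalgebra.induct) (auto intro: subalgebra.intros)

text \<open>Polynomial multiples of the theta words span superspace, and each word grows by one
  \<open>theta i\<close> on the left. As a result, induction over \<open>subalgebra UNIV\<close> is
  induction over all of superspace.\<close>

lemma subalgebra_UNIV: "f \<in> subalgebra UNIV"
proof -
  have bos: "bosonic p * g \<in> subalgebra UNIV" if g: "g \<in> subalgebra UNIV" for p g
  proof (induction p rule: cpoly_induct)
    case (add p q)
    then show ?case by (auto simp: bosonic_add distrib_right intro: subalgebra.add)
  next
    case (var i p)
    then show ?case
      using subalgebra.lform[of "axis i 1" UNIV "bosonic p * g"]
      by (simp add: lform_axis bosonic_mult bvar_def mult.assoc)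
  next
    case (const c)
    then show ?case
      using subalgebra.scale[OF g, of c] by (simp add: sscale_def superspace_const_def)
  qed
  define w where "w S = Superspace (\<lambda>U. if U = S then 1 else 0)" for S :: "'a set"
  have w: "w S \<in> subalgebra UNIV" for S
  proof (induction S rule: finite_induct[OF finite])
    case 1
    have "w {} = 1" by (rule superspace_eqI) (simp add: w_def)
    then show ?case by (simp add: subalgebra.one)
  next
    case (2 i S)
    \<comment> \<open>Sorting the word \<open>theta i * w S\<close> produces the sign
      \<open>theta_sign {i} S\<close>, which is its own inverse and can be moved to the other
      side.\<close>
    have "w (insert i S) = bosonic (theta_sign {i} S) * (theta i * w S)"
    proof (rule superspace_eqI)
      fix U
      have "theta_sign {i} S * theta_sign {i} S = 1"
        by (simp add: theta_sign_def power_mult_distrib[symmetric])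
      moreover have "i \<in> U \<Longrightarrow> U - {i} = S \<longleftrightarrow> U = insert i S" using 2 by auto
      ultimately show "theta_coeff (w (insert i S)) U =
          theta_coeff (bosonic (theta_sign {i} S) * (theta i * w S)) U"
        by (auto simp: w_def theta_coeff_theta_times)
    qed
    moreover have "theta i * w S \<in> subalgebra UNIV"
      using subalgebra.dform[OF UNIV_I "2.IH", of "axis i 1"] by (simp add: dform_axis)
    ultimately show ?case using bos by simp
  qed
  have "f = (\<Sum>S\<in>UNIV. bosonic (theta_coeff f S) * w S)"
    by (rule superspace_eqI) (simp add: theta_coeff_sum w_def if_distrib sum.delta cong: if_cong)
  moreover have "(\<Sum>S\<in>UNIV. bosonic (theta_coeff f S) * w S) \<in> subalgebra UNIV"
    by (intro subalgebra_sum bos w)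
  ultimately show ?thesis by simp
qed

section \<open>Derivations, contractions and the bigrading\<close>

text \<open>A form \<open>a\<close> acts as a constant-coefficient differential operator: by
  \<open>dir_deriv_lform\<close> it sends \<open>lform l\<close> to the scalar
  \<open>dot a l\<close>. The theta variables count as constants.\<close>

definition dir_deriv :: "complex ^ 'n::{finite,linorder} \<Rightarrow> ('n::{finite,linorder}) superspace \<Rightarrow> 'n superspace" where
  "dir_deriv a f = Superspace (\<lambda>S. \<Sum>i\<in>UNIV. cpoly_const (a $ i) * cpoly_deriv i (theta_coeff f S))"

text \<open>The interior product with \<open>a\<close>, an odd counterpart of
  \<open>dir_deriv\<close>. The sign moves \<open>theta i\<close> to the front of its word before it
  is removed.\<close>

definition contraction :: "complex ^ 'n::{finite,linorder} \<Rightarrow> ('n::{finite,linorder}) superspace \<Rightarrow> 'n superspace" where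
  "contraction a f = Superspace (\<lambda>S. \<Sum>i\<in>UNIV.
     if i \<in> S then 0 else cpoly_const (a $ i) * (theta_sign {i} S * theta_coeff f (insert i S)))"

definition bidegree_part :: "int \<Rightarrow> int \<Rightarrow> ('n::{finite,linorder}) superspace \<Rightarrow> 'n superspace" where
  "bidegree_part i j f = Superspace (\<lambda>S. if int (card S) =
     j then cpoly_component i (theta_coeff f S) else 0)"

lemma dir_deriv_add: "dir_deriv a (f + g) = dir_deriv a f + dir_deriv a g"
  by (rule superspace_eqI) (simp add: dir_deriv_def cpoly_deriv_add distrib_left sum.distrib)

lemma contraction_add: "contraction a (f + g) = contraction a f + contraction a g"
  by (rule superspace_eqI)
    (auto simp: contraction_def distrib_left sum.distrib[symmetric] intro!: sum.cong)

lemma bidegree_part_add: "bidegree_part i j (f + g) = bidegree_part i j f + bidegree_part i j g"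
  by (rule superspace_eqI) (simp add: bidegree_part_def cpoly_component_add)

lemma dir_deriv_scale: "dir_deriv a (sscale c f) = sscale c (dir_deriv a f)"
  by (rule superspace_eqI) (simp add: dir_deriv_def cpoly_deriv_const_times sum_distrib_left ac_simps)

lemma contraction_scale: "contraction a (sscale c f) = sscale c (contraction a f)"
  by (rule superspace_eqI) (auto simp: contraction_def sum_distrib_left ac_simps intro!: sum.cong)

lemma bidegree_part_scale: "bidegree_part i j (sscale c f) = sscale c (bidegree_part i j f)"
  by (rule superspace_eqI) (simp add: bidegree_part_def cpoly_component_const_times)

lemma dir_deriv_one [simp]: "dir_deriv a 1 = 0"
  by (rule superspace_eqI) (simp add: dir_deriv_def)

lemma contraction_one [simp]: "contraction a 1 = 0"
  by (rule superspace_eqI) (auto simp: contraction_def intro!: sum.neutral)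

lemma bidegree_part_one: "bidegree_part i j 1 = (if i = 0 \<and> j = 0 then 1 else 0)"
  by (rule superspace_eqI) (auto simp: bidegree_part_def cpoly_component_one)

lemma dir_deriv_zero [simp]: "dir_deriv a 0 = 0"
  using dir_deriv_add[of a 0 0] by simp

lemma contraction_zero [simp]: "contraction a 0 = 0"
  using contraction_add[of a 0 0] by simp

lemma bidegree_part_zero [simp]: "bidegree_part i j 0 = 0"
  using bidegree_part_add[of i j 0 0] by simp

lemma dir_deriv_diff: "dir_deriv a (f - g) = dir_deriv a f - dir_deriv a g"
  using dir_deriv_add[of a "f - g" g] by simp

lemma contraction_diff: "contraction a (f - g) = contraction a f - contraction a g"
  using contraction_add[of a "f - g" g] by simp

lemma bidegree_part_diff: "bidegree_part i j (f - g) = bidegree_part i j f - bidegree_part i j g"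
  using bidegree_part_add[of i j "f - g" g] by simp

lemma dir_deriv_sum: "dir_deriv a (\<Sum>i\<in>A. f i) = (\<Sum>i\<in>A. dir_deriv a (f i))"
  by (induction A rule: infinite_finite_induct) (auto simp: dir_deriv_add)

lemma contraction_sum: "contraction a (\<Sum>i\<in>A. f i) = (\<Sum>i\<in>A. contraction a (f i))"
  by (induction A rule: infinite_finite_induct) (auto simp: contraction_add)

lemma bidegree_part_sum: "bidegree_part i j (\<Sum>k\<in>A. f k) = (\<Sum>k\<in>A. bidegree_part i j (f k))"
  by (induction A rule: infinite_finite_induct) (auto simp: bidegree_part_add)

lemma sum_sscale_delta:
  "(\<Sum>i\<in>UNIV. sscale (c i) (sscale (d i) f + g i)) =
   sscale (\<Sum>i\<in>UNIV. d i * c i) f + (\<Sum>i\<in>(UNIV::'a::finite set). sscale (c i) (g i))"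
  by (simp add: sscale_add_right sum.distrib sscale_sum_left mult.commute)

lemma dir_deriv_bvar_times: "dir_deriv a (bvar i * f) = sscale (a $ i) f + bvar i * dir_deriv a f"
proof (rule superspace_eqI)
  fix S
  have "(\<Sum>k\<in>UNIV. cpoly_const (a $ k) * cpoly_deriv k (cpoly_var i * theta_coeff f S)) =
    (\<Sum>k\<in>UNIV. (if k = i then cpoly_const (a $ i) * theta_coeff f S else 0)) +
    (\<Sum>k\<in>UNIV. cpoly_var i * (cpoly_const (a $ k) * cpoly_deriv k (theta_coeff f S)))"
    unfolding sum.distrib[symmetric]
    by (intro sum.cong refl) (auto simp: cpoly_deriv_var_times distrib_left ac_simps)
  then show "theta_coeff (dir_deriv a (bvar i * f)) S =
      theta_coeff (sscale (a $ i) f + bvar i * dir_deriv a f) S"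
    by (simp add: dir_deriv_def sum_distrib_left)
qed

lemma cpoly_deriv_theta_sign_times:
  "cpoly_deriv k (theta_sign S T * p) = theta_sign S T * cpoly_deriv k p"
  using cpoly_deriv_const_times[of k "(-1) ^ card {(s, t). s \<in> S \<and> t \<in> T \<and> t < s}" p]
  by (cases "even (card {(s, t). s \<in> S \<and> t \<in> T \<and> t < s})")
    (auto simp: theta_sign_def cpoly_const_def single_uminus)

lemma dir_deriv_theta_times: "dir_deriv a (theta i * f) = theta i * dir_deriv a f"
  by (rule superspace_eqI)
    (simp add: dir_deriv_def theta_coeff_theta_times cpoly_deriv_theta_sign_times
      sum_distrib_left mult.left_commute)

lemma contraction_bvar_times: "contraction a (bvar i * f) = bvar i * contraction a f"
  by (rule superspace_eqI) (auto simp: contraction_def sum_distrib_left ac_simps intro!: sum.cong)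

lemma theta_sign_swap: "i \<noteq> j \<Longrightarrow> theta_sign {i} {j} = - theta_sign {j} {i}"
proof -
  assume "i \<noteq> j"
  have "{(s, t). s \<in> {i} \<and> t \<in> {j} \<and> t < s} = (if j < i then {(i, j)} else {})" for i j :: 'a
    by auto
  then show ?thesis using \<open>i \<noteq> j\<close> by (auto simp: theta_sign_def)
qed

lemma theta_sign_square: "theta_sign S T * theta_sign S T = 1"
  by (simp add: theta_sign_def power_mult_distrib[symmetric])

text \<open>Contraction is an antiderivation, so passing \<open>theta i\<close> costs a sign. If
  \<open>i\<close> is not in \<open>S\<close>, only the index \<open>i\<close> survives on the left;
  if \<open>i\<close> is in \<open>S\<close>, the scalar term cancels against one term of the
  contraction of \<open>f\<close>.\<close>

lemma contraction_theta_times: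
  "contraction a (theta i * f) = sscale (a $ i) f - theta i * contraction a f"
proof (rule superspace_eqI)
  fix S
  define F where "F = theta_coeff f"
  define t where "t k = cpoly_const (a $ k) * (theta_sign {k} S *
     (if i \<in> insert k S then theta_sign {i} (insert k S - {i}) * F (insert k S - {i}) else 0))" for k
  define s where "s k = cpoly_const (a $ k) * (theta_sign {i} (S - {i}) *
     (theta_sign {k} (S - {i}) * F (insert k (S - {i}))))" for k
  have L: "theta_coeff (contraction a (theta i * f)) S = (\<Sum>k\<in>UNIV. if k \<in> S then 0 else t k)"
    by (auto simp: contraction_def theta_coeff_theta_times t_def F_def intro!: sum.cong)
  have *: "theta_sign {i} (S - {i}) * (\<Sum>k\<in>UNIV. if k \<in> S - {i} then 0 else
      cpoly_const (a $ k) * (theta_sign {k} (S - {i}) * F (insert k (S - {i})))) =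
      (\<Sum>k\<in>UNIV. if k \<in> S - {i} then 0 else s k)"
    unfolding sum_distrib_left s_def by (intro sum.cong refl) (simp add: mult.left_commute)
  have R: "theta_coeff (sscale (a $ i) f - theta i * contraction a f) S =
     cpoly_const (a $ i) * F S -
      (if i \<in> S then (\<Sum>k\<in>UNIV. if k \<in> S - {i} then 0 else s k) else 0)"
    unfolding *[symmetric] F_def
      by (simp add: contraction_def theta_coeff_theta_times del: Diff_iff)
  show "theta_coeff (contraction a (theta i * f)) S =
      theta_coeff (sscale (a $ i) f - theta i * contraction a f) S"
  proof (cases "i \<in> S")
    case False
    have "t k = (if k = i then cpoly_const (a $ i) * F S else 0)" if "k \<notin> S" for k
      using that False theta_sign_square[of "{i}" S]
      by (auto simp: t_def mult.assoc[symmetric])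
    then have "(\<Sum>k\<in>UNIV. if k \<in> S then 0 else t k) =
        (\<Sum>k\<in>UNIV. if k = i then cpoly_const (a $ i) * F S else 0)"
      using False by (intro sum.cong) auto
    then show ?thesis unfolding L R using False by simp
  next
    case True
    \<comment> \<open>The minus sign is the single transposition of \<open>theta i\<close> and
      \<open>theta k\<close>.\<close>
    have "t k = - s k" if "k \<notin> S" for k
    proof -
      have ki: "k \<noteq> i" using that True by auto
      have 1: "theta_sign {k} S = theta_sign {k} (S - {i}) * theta_sign {k} {i}"
        using theta_sign_Un_right[of "S - {i}" "{i}" "{k}"] True by (simp add: insert_absorb)
      have 2: "insert k S - {i} = insert k (S - {i})" using ki by auto
      have 3: "theta_sign {i} (insert k (S - {i})) = theta_sign {i} {k} * theta_sign {i} (S - {i})"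
        using theta_sign_Un_right[of "{k}" "S - {i}" "{i}"] that by simp
      have 4: "theta_sign {k} {i} * theta_sign {i} {k} = - 1"
        using theta_sign_swap[OF ki] theta_sign_square[of "{i}" "{k}"] by simp
      have "t k = (theta_sign {k} {i} * theta_sign {i} {k}) * s k"
        using True by (simp add: t_def s_def 1 2 3 ac_simps)
      then show ?thesis using 4 by simp
    qed
    then have "(\<Sum>k\<in>UNIV. if k \<in> S then 0 else t k) = (\<Sum>k\<in>UNIV. - (if k \<in> S then 0 else s k))"
      by (intro sum.cong) auto
    \<comment> \<open>Removing \<open>i\<close> from \<open>S\<close> admits one extra index,
      \<open>i\<close> itself; its term \<open>s i\<close> is the one that cancels
      \<open>sscale (a $ i) f\<close>.\<close>
    moreover have "(\<Sum>k\<in>UNIV. if k \<in> S - {i} then 0 else s k) =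
        (\<Sum>k\<in>UNIV. (if k \<in> S then 0 else s k) + (if k = i then s i else 0))"
      using True by (intro sum.cong) auto
    moreover have "s i = cpoly_const (a $ i) * F S"
      using theta_sign_square[of "{i}" "S - {i}"] True
      by (simp add: s_def insert_absorb mult.assoc[symmetric])
    ultimately show ?thesis unfolding L R using True
      by (simp add: sum.distrib sum_negf)
  qed
qed

lemma bidegree_part_bvar_times:
  "bidegree_part i j (bvar k * f) = bvar k * bidegree_part (i - 1) j f"
  by (rule superspace_eqI) (auto simp: bidegree_part_def cpoly_component_var_times)

lemma cpoly_component_theta_sign_times:
  "cpoly_component d (theta_sign S T * p) = theta_sign S T * cpoly_component d p"
  unfolding theta_sign_def by (rule cpoly_component_sign)

lemma bidegree_part_theta_times:
  "bidegree_part i j (theta k * f) = theta k * bidegree_part i (j - 1) f"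
proof (rule superspace_eqI)
  fix S
  show "theta_coeff (bidegree_part i j (theta k * f)) S =
     theta_coeff (theta k * bidegree_part i (j - 1) f) S"
  proof (cases "k \<in> S")
    case True
    then have "int (card S) = j \<longleftrightarrow> int (card (S - {k})) = j - 1"
      using card_Suc_Diff1[OF finite True] by arith
    then show ?thesis
      using True
      by (simp add: bidegree_part_def theta_coeff_theta_times cpoly_component_theta_sign_times del: card_Diff_insert)
  next
    case False
    then show ?thesis by (simp add: bidegree_part_def theta_coeff_theta_times)
  qed
qed

lemma dir_deriv_lform: "dir_deriv a (lform l * f) = sscale (dot a l) f + lform l * dir_deriv a f"
  unfolding lform_times dir_deriv_sum dir_deriv_scale dir_deriv_bvar_times
  by (simp add: sum_sscale_delta dot_def)

lemma dir_deriv_dform: "dir_deriv a (dform l * f) = dform l * dir_deriv a f"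
  by (simp add: dform_times dir_deriv_sum dir_deriv_scale dir_deriv_theta_times)

lemma contraction_lform: "contraction a (lform l * f) = lform l * contraction a f"
  by (simp add: lform_times contraction_sum contraction_scale contraction_bvar_times)

lemma contraction_dform:
  "contraction a (dform l * f) = sscale (dot a l) f - dform l * contraction a f"
  unfolding dform_times contraction_sum contraction_scale contraction_theta_times
  by (simp add: sscale_diff_right sum_subtractf dot_def sscale_sum_left mult.commute)

lemma bidegree_part_lform: "bidegree_part i j (lform l * f) = lform l * bidegree_part (i - 1) j f"
  by (simp add: lform_times bidegree_part_sum bidegree_part_scale bidegree_part_bvar_times)

lemma bidegree_part_dform: "bidegree_part i j (dform l * f) = dform l * bidegree_part i (j - 1) f"
  by (simp add: dform_times bidegree_part_sum bidegree_part_scale bidegree_part_theta_times)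

lemma bidegree_part_idem [simp]: "bidegree_part i j (bidegree_part i j f) = bidegree_part i j f"
  by (rule superspace_eqI) (simp add: bidegree_part_def)

lemma bidegree_part_dir_deriv:
  "bidegree_part i j (dir_deriv a f) = dir_deriv a (bidegree_part (i + 1) j f)"
  using subalgebra_UNIV[of f]
proof (induction f arbitrary: i j rule: subalgebra.induct)
  case one
  then show ?case by (simp add: bidegree_part_one)
next
  case (lform l f)
  then show ?case
    using lform.IH[of "i - 1" j]
      by (simp add: dir_deriv_lform bidegree_part_lform bidegree_part_add bidegree_part_scale)
qed (simp_all add: bidegree_part_add dir_deriv_add bidegree_part_scale dir_deriv_scale bidegree_part_dform dir_deriv_dform)

lemma subalgebra_dir_deriv: "f \<in> subalgebra W \<Longrightarrow> dir_deriv a f \<in> subalgebra W"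
  by (induction f rule: subalgebra.induct)
    (auto simp: dir_deriv_add dir_deriv_scale dir_deriv_lform dir_deriv_dform intro: subalgebra.intros)

lemma subalgebra_contraction: "f \<in> subalgebra W \<Longrightarrow> contraction a f \<in> subalgebra W"
  by (induction f rule: subalgebra.induct)
    (auto simp: contraction_add contraction_scale contraction_lform contraction_dform intro: subalgebra.intros subalgebra_diff)

lemma subalgebra_bidegree_part: "f \<in> subalgebra W \<Longrightarrow> bidegree_part i j f \<in> subalgebra W"
  by (induction f arbitrary: i j rule: subalgebra.induct)
    (auto simp: bidegree_part_one bidegree_part_add bidegree_part_scale bidegree_part_lform bidegree_part_dform intro: subalgebra.intros)

lemma dir_deriv_subalgebra_kernel:
  "f \<in> subalgebra W \<Longrightarrow> (\<And>l. l \<in> W \<Longrightarrow> dot a l = 0) \<Longrightarrow> dir_deriv a f = 0"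
  by (induction f rule: subalgebra.induct) (auto simp: dir_deriv_add dir_deriv_scale dir_deriv_lform dir_deriv_dform)

lemma contraction_subalgebra_kernel:
  "f \<in> subalgebra W \<Longrightarrow> (\<And>l. l \<in> W \<Longrightarrow> dot a l = 0) \<Longrightarrow> contraction a f = 0"
  by (induction f rule: subalgebra.induct) (auto simp: contraction_add contraction_scale contraction_lform contraction_dform)

text \<open>For \<open>k = 0\<close> the truncated exponent \<open>k - 1\<close> does no harm,
  because its scalar is zero.\<close>

lemma dir_deriv_lform_power:
  "dir_deriv a (lform l ^ k * f) =
     sscale (of_nat k * dot a l) (lform l ^ (k - 1) * f) + lform l ^ k * dir_deriv a f"
proof (induction k)
  case 0
  then show ?case by simp
next
  case (Suc k)
  have "dir_deriv a (lform l ^ Suc k * f) =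
     sscale (dot a l) (lform l ^ k * f) + lform l * dir_deriv a (lform l ^ k * f)"
    by (simp add: mult.assoc dir_deriv_lform)
  also have "lform l * dir_deriv a (lform l ^ k * f) =
      sscale (of_nat k * dot a l) (lform l ^ k * f) + lform l ^ Suc k * dir_deriv a f"
    unfolding Suc.IH by (cases k) (simp_all add: distrib_left sscale_mult_right mult.assoc)
  finally show ?case
    by (simp add: sscale_add_left[symmetric] add.assoc[symmetric] distrib_right)
qed

lemma contraction_lform_power: "contraction a (lform l ^ k * f) = lform l ^ k * contraction a f"
  by (induction k) (simp_all add: mult.assoc contraction_lform)

lemma bidegree_part_lform_power:
  "bidegree_part i j (lform l ^ k * f) = lform l ^ k * bidegree_part (i - int k) j f"
  by (induction k arbitrary: i) (simp_all add: mult.assoc bidegree_part_lform algebra_simps)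

section \<open>Antiderivatives and the kernel of a directional derivative\<close>

text \<open>Each derivative lowers the bosonic degree. Local nilpotence is what lets the integration
  by parts and the kernel computation below terminate.\<close>

lemma dir_deriv_nilpotent: "\<exists>N. (dir_deriv a ^^ N) f = 0"
  using subalgebra_UNIV[of f]
proof (induction f rule: subalgebra.induct)
  case one
  then show ?case by (intro exI[of _ 1]) simp
next
  case (add f g)
  then obtain M N where MN: "(dir_deriv a ^^ M) f = 0" "(dir_deriv a ^^ N) g = 0" by blast
  have add: "(dir_deriv a ^^ k) (f + g) = (dir_deriv a ^^ k) f + (dir_deriv a ^^ k) g" for k f g
    by (induction k) (simp_all add: dir_deriv_add)
  have zero: "(dir_deriv a ^^ k) 0 = 0" for k
    by (induction k) simp_all
  have "(dir_deriv a ^^ (N + M)) f = 0" "(dir_deriv a ^^ (M + N)) g = 0"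
    unfolding funpow_add using MN zero by simp_all
  then have "(dir_deriv a ^^ (M + N)) (f + g) = 0"
    by (simp add: add add.commute[of M N])
  then show ?case by blast
next
  case (scale f c)
  have "(dir_deriv a ^^ k) (sscale c f) = sscale c ((dir_deriv a ^^ k) f)" for k
    by (induction k) (simp_all add: dir_deriv_scale)
  then show ?case using scale by (metis sscale_zero_right)
next
  case (lform l f)
  have add: "(dir_deriv a ^^ k) (f + g) = (dir_deriv a ^^ k) f + (dir_deriv a ^^ k) g" for k f g
    by (induction k) (simp_all add: dir_deriv_add)
  have scale: "(dir_deriv a ^^ k) (sscale c f) = sscale c ((dir_deriv a ^^ k) f)" for k c f
    by (induction k) (simp_all add: dir_deriv_scale)
  \<comment> \<open>Every additional linear factor needs only one more derivative, by the product
    rule and induction on \<open>N\<close>.\<close>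
  have "(dir_deriv a ^^ Suc N) (lform l * f) = 0" if "(dir_deriv a ^^ N) f = 0" for N f
    using that
  proof (induction N arbitrary: f)
    case 0
    then show ?case by simp
  next
    case (Suc N)
    have "(dir_deriv a ^^ Suc (Suc N)) (lform l * f) =
       (dir_deriv a ^^ Suc N) (dir_deriv a (lform l * f))"
      by (simp add: funpow_swap1)
    also have "\<dots> =
       sscale (dot a l) ((dir_deriv a ^^ Suc N) f) + (dir_deriv a ^^ Suc N) (lform l * dir_deriv a f)"
      unfolding dir_deriv_lform add scale ..
    finally show ?case
      using Suc.prems Suc.IH[of "dir_deriv a f"] by (simp add: funpow_swap1)
  qed
  then show ?case using lform by blast
next
  case (dform l f)
  have "(dir_deriv a ^^ k) (dform l * f) = dform l * (dir_deriv a ^^ k) f" for k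
    by (induction k) (simp_all add: dir_deriv_dform)
  then show ?case using dform by (metis mult_zero_right)
qed

text \<open>Repeated integration by parts: a multiple of \<open>lform l ^ Suc e * f\<close> has the
  right derivative up to a remainder that involves \<open>dir_deriv a f\<close>, and this dies after
  finitely many rounds. The gain of one power of \<open>lform l\<close> matches the larger exponent
  in the ideal of \<open>a # A\<close>.\<close>

lemma dir_deriv_antiderivative:
  assumes "l \<in> W" "dot a l \<noteq> 0" "f \<in> subalgebra W"
  shows "\<exists>F\<in>subalgebra W. dir_deriv a (lform l ^ Suc e * F) = lform l ^ e * f"
proof -
  obtain N where "(dir_deriv a ^^ N) f = 0" using dir_deriv_nilpotent by blast
  then show ?thesis using assms(3)
  proof (induction N arbitrary: f e)
    case 0
    then show ?case by (intro bexI[of _ 0]) auto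
  next
    case (Suc N)
    define \<kappa> where "\<kappa> = 1 / (of_nat (Suc e) * dot a l)"
    have \<kappa>: "\<kappa> * (of_nat (Suc e) * dot a l) = 1"
      using assms(2) by (simp add: \<kappa>_def del: of_nat_Suc)
    have "(dir_deriv a ^^ N) (dir_deriv a f) = 0"
      using Suc.prems(1) by (simp add: funpow_swap1)
    then obtain G where G: "G \<in> subalgebra W"
        "dir_deriv a (lform l ^ Suc (Suc e) * G) = lform l ^ Suc e * dir_deriv a f"
      using Suc.IH[of "dir_deriv a f" "Suc e"] subalgebra_dir_deriv[OF Suc.prems(2)] by blast
    have "dir_deriv a (lform l ^ Suc e * sscale \<kappa> f) =
        sscale (\<kappa> * (of_nat (Suc e) * dot a l)) (lform l ^ e * f) + sscale \<kappa> (lform l ^ Suc e * dir_deriv a f)"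
      by (simp add: sscale_mult_right dir_deriv_scale dir_deriv_lform_power sscale_add_right del: power_Suc of_nat_Suc)
    \<comment> \<open>\<open>G\<close> integrates the remainder with yet another power of
      \<open>lform l\<close>, so one power can be moved into the coefficient and the correction
      keeps the required shape.\<close>
    moreover have "lform l ^ Suc e * (lform l * sscale \<kappa> G) = sscale \<kappa> (lform l ^ Suc (Suc e) * G)"
      by (simp only: sscale_mult_right power_Suc2 mult.assoc)
    ultimately have "dir_deriv a (lform l ^ Suc e * (sscale \<kappa> f - lform l * sscale \<kappa> G)) =
       lform l ^ e * f"
      unfolding right_diff_distrib dir_deriv_diff \<kappa>
        by (simp add: dir_deriv_scale G(2) del: power_Suc)
    moreover have "sscale \<kappa> f - lform l * sscale \<kappa> G \<in> subalgebra W"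
      using Suc.prems(2) G(1) assms(1) by (intro subalgebra_diff subalgebra.intros)
    ultimately show ?case by blast
  qed
qed

text \<open>\<open>W\<close> is the direct sum of \<open>H\<close> and the line of \<open>u\<close>,
  so each generator splits into a generator from \<open>H\<close> and a multiple of the one from
  \<open>u\<close>. Since \<open>dform u\<close> squares to zero, modulo \<open>lform u\<close> it
  enters at most linearly.\<close>

lemma subalgebra_decompose:
  assumes W: "vec.subspace W" and u: "u \<in> W" "dot a u = 1" and f: "f \<in> subalgebra W"
  defines "H \<equiv> {l \<in> W. dot a l = 0}"
  shows "\<exists>b\<in>subalgebra H. \<exists>c\<in>subalgebra H. \<exists>g\<in>subalgebra W. f = b + dform u * c + lform u * g"
  using f
proof (induction f rule: subalgebra.induct)
  case one
  show ?case
    by (rule bexI[OF _ subalgebra.one], rule bexI[OF _ subalgebra_zero], rule bexI[OF _ subalgebra_zero])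
      simp
next
  case (add f f')
  then obtain b c g b' c' g' where "b \<in> subalgebra H" "c \<in> subalgebra H" "g \<in> subalgebra W"
    "f = b + dform u * c + lform u * g" "b' \<in> subalgebra H" "c' \<in> subalgebra H" "g' \<in> subalgebra W"
    "f' = b' + dform u * c' + lform u * g'"
    by blast
  then have "b + b' \<in> subalgebra H" "c + c' \<in> subalgebra H" "g + g' \<in> subalgebra W"
    "f + f' = (b + b') + dform u * (c + c') + lform u * (g + g')"
    by (auto intro: subalgebra.add simp: distrib_left)
  then show ?case by blast
next
  case (scale f k)
  then obtain b c g where "b \<in> subalgebra H" "c \<in> subalgebra H" "g \<in> subalgebra W"
    "f = b + dform u * c + lform u * g" by blast
  then have "sscale k b \<in> subalgebra H" "sscale k c \<in> subalgebra H" "sscale k g \<in> subalgebra W"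
    "sscale k f = sscale k b + dform u * sscale k c + lform u * sscale k g"
    by (auto intro: subalgebra.scale simp: sscale_add_right sscale_mult_right)
  then show ?case by blast
next
  case (lform l f)
  then obtain b c g where bcg: "b \<in> subalgebra H" "c \<in> subalgebra H" "g \<in> subalgebra W"
    "f = b + dform u * c + lform u * g" by blast
  define k where "k = dot a l"
  \<comment> \<open>The projection of \<open>l\<close> to \<open>H\<close> along
    \<open>u\<close>.\<close>
  define h where "h = l - k *s u"
  have h: "h \<in> H"
    using lform.hyps u W by (auto simp: H_def h_def k_def dot_diff_right dot_scale_right
        intro: vec.subspace_diff vec.subspace_scale)
  have l: "lform l * y = lform h * y + sscale k (lform u * y)" for y
    using lform_linear[of h k u] by (simp add: h_def distrib_right sscale_mult_left)
  have HW: "b \<in> subalgebra W" "c \<in> subalgebra W"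
    using bcg subalgebra_mono[of _ H W] by (auto simp: H_def)
  have "lform l * f =
     lform h * b + dform u * (lform h * c) + lform u * (sscale k b + sscale k (dform u * c) + lform l * g)"
  proof -
    have "lform l * (dform u * c) = dform u * (lform h * c) + lform u * sscale k (dform u * c)"
      unfolding l
        by (simp add: mult.assoc[symmetric] lform_commute[of "dform u"] sscale_mult_right sscale_mult_left)
    moreover have "lform l * (lform u * g) = lform u * (lform l * g)"
      by (simp add: mult.assoc[symmetric] lform_commute[of "lform l"])
    moreover have "lform l * b = lform h * b + lform u * sscale k b"
      unfolding l by (simp add: sscale_mult_right)
    ultimately show ?thesis by (simp add: bcg(4) distrib_left add_ac)
  qed
  moreover have "lform h * b \<in> subalgebra H" "lform h * c \<in> subalgebra H"
    using h bcg by (auto intro: subalgebra.lform)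
  moreover have "sscale k b + sscale k (dform u * c) + lform l * g \<in> subalgebra W"
    using HW bcg lform.hyps u by (auto intro!: subalgebra.intros)
  ultimately show ?case by blast
next
  case (dform l f)
  then obtain b c g where bcg: "b \<in> subalgebra H" "c \<in> subalgebra H" "g \<in> subalgebra W"
    "f = b + dform u * c + lform u * g" by blast
  define k where "k = dot a l"
  define h where "h = l - k *s u"
  have h: "h \<in> H"
    using dform.hyps u W by (auto simp: H_def h_def k_def dot_diff_right dot_scale_right
        intro: vec.subspace_diff vec.subspace_scale)
  have l: "dform l * y = dform h * y + sscale k (dform u * y)" for y
    using dform_linear[of h k u] by (simp add: h_def distrib_right sscale_mult_left)
  have "dform l * f = dform h * b + dform u * (sscale k b - dform h * c) + lform u * (dform l * g)"
  proof -
    have "dform l * (dform u * c) = - (dform u * (dform h * c))"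
      unfolding l by (simp add: mult.assoc[symmetric] dform_anticommute[of h u])
    moreover have "dform l * (lform u * g) = lform u * (dform l * g)"
      by (simp add: mult.assoc[symmetric] lform_commute[of "dform l"])
    moreover have "dform l * b = dform h * b + dform u * sscale k b"
      unfolding l by (simp add: sscale_mult_right)
    ultimately show ?thesis by (simp add: bcg(4) distrib_left right_diff_distrib)
  qed
  moreover have "dform h * b \<in> subalgebra H" "sscale k b - dform h * c \<in> subalgebra H"
    using h bcg by (auto intro: subalgebra.intros subalgebra_diff)
  moreover have "dform l * g \<in> subalgebra W"
    using bcg dform.hyps by (auto intro!: subalgebra.intros)
  ultimately show ?case by blast
qed

text \<open>In the decomposition only \<open>lform u * g\<close> can have a nonzero derivative. That
  derivative is \<open>g + lform u * dir_deriv a g\<close>, and this operator is injective because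
  the derivation is locally nilpotent.\<close>

lemma dir_deriv_kernel:
  assumes W: "vec.subspace W" and u: "u \<in> W" "dot a u =
     1" and f: "f \<in> subalgebra W" "dir_deriv a f = 0"
  defines "H \<equiv> {l \<in> W. dot a l = 0}"
  shows "\<exists>b\<in>subalgebra H. \<exists>c\<in>subalgebra H. f = b + dform u * c"
proof -
  obtain b c g where bcg: "b \<in> subalgebra H" "c \<in> subalgebra H" "f = b + dform u * c + lform u * g"
    using subalgebra_decompose[OF W u f(1)] unfolding H_def by meson
  have "dir_deriv a y = 0" if "y \<in> subalgebra H" for y
    using that by (rule dir_deriv_subalgebra_kernel) (simp add: H_def)
  then have "dir_deriv a b = 0" "dir_deriv a c = 0"
    using bcg(1,2) by blast+
  moreover have "dir_deriv a f =
     dir_deriv a b + dform u * dir_deriv a c + (sscale (dot a u) g + lform u * dir_deriv a g)"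
    unfolding bcg(3) dir_deriv_add dir_deriv_dform dir_deriv_lform ..
  ultimately have eq: "sscale 1 g + lform u * dir_deriv a g = 0"
    unfolding f(2) u(2) by simp
  obtain N where "(dir_deriv a ^^ N) g = 0" using dir_deriv_nilpotent[of a g] by auto
  \<comment> \<open>The scalar is generalised because differentiating the equation for
    \<open>g\<close> gives the same equation for \<open>dir_deriv a g\<close> with \<open>k\<close>
    raised by one. Once that derivative is known to vanish, only a nonzero multiple of
    \<open>g\<close> remains.\<close>
  then have "g = 0" if "sscale (of_nat (Suc k)) g + lform u * dir_deriv a g = 0" for k
    using that
  proof (induction N arbitrary: g k)
    case 0
    then show ?case by simp
  next
    case (Suc N)
    have "sscale (of_nat (Suc (Suc k))) (dir_deriv a g) + lform u * dir_deriv a (dir_deriv a g) =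
        sscale (of_nat (Suc k)) (dir_deriv a g) + (sscale (dot a u) (dir_deriv a g) + lform u * dir_deriv a (dir_deriv a g))"
      unfolding u(2) of_nat_Suc[of "Suc k"] sscale_add_left by (simp only: ac_simps)
    also have "\<dots> = dir_deriv a (sscale (of_nat (Suc k)) g + lform u * dir_deriv a g)"
      by (simp only: dir_deriv_add dir_deriv_scale dir_deriv_lform)
    also have "\<dots> = 0"
      unfolding Suc.prems(2) by simp
    finally have "sscale (of_nat (Suc (Suc k))) (dir_deriv a g) + lform u * dir_deriv a (dir_deriv a g) = 0" .
    then have "dir_deriv a g = 0"
      using Suc.IH[of "dir_deriv a g" "Suc k"] Suc.prems(1) by (simp add: funpow_swap1)
    then have "sscale (1 / of_nat (Suc k)) (sscale (of_nat (Suc k)) g) = 0"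
      using Suc.prems(2) by (simp del: of_nat_Suc sscale_sscale)
    then show ?case by (simp del: of_nat_Suc)
  qed
  from this[of 0] have "g = 0" using eq by simp
  then show ?thesis using bcg by auto
qed

section \<open>The ideal restricted to a subspace\<close>

definition num_nonzero :: "(complex ^ 'n) list \<Rightarrow> complex ^ 'n::finite \<Rightarrow> nat" where
  "num_nonzero A l = length (filter (\<lambda>a. dot a l \<noteq> 0) A)"

lemma num_nonzero_Nil [simp]: "num_nonzero [] l = 0"
  by (simp add: num_nonzero_def)

lemma num_nonzero_Cons:
  "num_nonzero (a # A) l = (if dot a l = 0 then num_nonzero A l else Suc (num_nonzero A l))"
  by (simp add: num_nonzero_def)

text \<open>The ideal of the arrangement \<open>A\<close> restricted to the subspace \<open>W\<close>, inside the subalgebra generated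
  by the forms of lines in \<open>W\<close>. The factor \<open>dform l\<close> comes from \<open>d (l ^ (k + 1)) =
     (k + 1) * l ^ k * dl\<close>.\<close>

inductive_set line_ideal :: "(complex ^ 'n::{finite,linorder}) list \<Rightarrow> (complex ^ 'n::{finite,linorder}) set \<Rightarrow> ('n::{finite,linorder}) superspace set"
  for A W where
  zero: "0 \<in> line_ideal A W"
| lform: "l \<in> W \<Longrightarrow> f \<in> subalgebra W \<Longrightarrow> g \<in> line_ideal A W \<Longrightarrow>
   lform l ^ Suc (num_nonzero A l) * f + g \<in> line_ideal A W"
| dform: "l \<in> W \<Longrightarrow> f \<in> subalgebra W \<Longrightarrow> g \<in> line_ideal A W \<Longrightarrow>
   lform l ^ num_nonzero A l * (dform l * f) + g \<in> line_ideal A W"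

lemma line_ideal_add: "f \<in> line_ideal A W \<Longrightarrow> g \<in> line_ideal A W \<Longrightarrow> f + g \<in> line_ideal A W"
  by (induction f rule: line_ideal.induct) (auto simp: add.assoc simp del: power_Suc intro: line_ideal.intros)

text \<open>Surplus powers go into the coefficient. This flexibility absorbs the change of exponent
  by at most one between \<open>A\<close> and \<open>a # A\<close>.\<close>

lemma line_ideal_lform_power:
  assumes "l \<in> W" "f \<in> subalgebra W" "k > num_nonzero A l"
  shows "lform l ^ k * f \<in> line_ideal A W"
proof -
  have "lform l ^ k = lform l ^ Suc (num_nonzero A l) * lform l ^ (k - Suc (num_nonzero A l))"
    unfolding power_add[symmetric] using assms(3) by simp
  then show ?thesis
    using line_ideal.lform[OF assms(1) subalgebra_lform_power[OF assms(1,2)] line_ideal.zero]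
    by (simp add: mult.assoc del: power_Suc)
qed

lemma line_ideal_dform_lform_power:
  assumes "l \<in> W" "f \<in> subalgebra W" "k \<ge> num_nonzero A l"
  shows "lform l ^ k * (dform l * f) \<in> line_ideal A W"
proof -
  have "lform l ^ k = lform l ^ num_nonzero A l * lform l ^ (k - num_nonzero A l)"
    unfolding power_add[symmetric] using assms(3) by simp
  moreover have "lform l ^ n * (dform l * f) = dform l * (lform l ^ n * f)" for n
    by (simp add: mult.assoc[symmetric] lform_power_commute)
  ultimately show ?thesis
    using line_ideal.dform[OF assms(1) subalgebra_lform_power[OF assms(1,2)] line_ideal.zero, of A "k - num_nonzero A l"]
    by (simp add: mult.assoc)
qed

lemma line_ideal_scale: "f \<in> line_ideal A W \<Longrightarrow> sscale c f \<in> line_ideal A W"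
proof (induction f rule: line_ideal.induct)
  case (lform l f g)
  then show ?case
    using line_ideal.lform[of l W "sscale c f" "sscale c g" A]
    by (simp add: sscale_add_right sscale_mult_right subalgebra.scale del: power_Suc)
next
  case (dform l f g)
  then show ?case
    using line_ideal.dform[of l W "sscale c f" "sscale c g" A]
    by (simp add: sscale_add_right sscale_mult_right subalgebra.scale)
qed (simp add: line_ideal.zero)

lemma line_ideal_diff: "f \<in> line_ideal A W \<Longrightarrow> g \<in> line_ideal A W \<Longrightarrow> f - g \<in> line_ideal A W"
  using line_ideal_add[of f A W "sscale (- 1) g"] line_ideal_scale[of g A W "- 1"]
  by (simp add: sscale_minus_one)

lemma line_ideal_times_lform: "f \<in> line_ideal A W \<Longrightarrow> v \<in> W \<Longrightarrow> lform v * f \<in> line_ideal A W"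
proof (induction f rule: line_ideal.induct)
  case (lform l f g)
  then show ?case
    using line_ideal.lform[of l W "lform v * f" "lform v * g" A]
    by (simp add: distrib_left mult.assoc[symmetric] lform_power_commute subalgebra.lform del: power_Suc)
next
  case (dform l f g)
  then show ?case
    using line_ideal.dform[of l W "lform v * f" "lform v * g" A]
    by (simp add: distrib_left mult.assoc[symmetric] lform_power_commute lform_commute[of "dform l"] subalgebra.lform)
qed (simp add: line_ideal.zero)

lemma line_ideal_times_dform: "f \<in> line_ideal A W \<Longrightarrow> v \<in> W \<Longrightarrow> dform v * f \<in> line_ideal A W"
proof (induction f rule: line_ideal.induct)
  case (lform l f g)
  then show ?case
    using line_ideal.lform[of l W "dform v * f" "dform v * g" A]
    by (simp add: distrib_left mult.assoc[symmetric] lform_power_commute subalgebra.dform del: power_Suc)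
next
  case (dform l f g)
  \<comment> \<open>Exchanging the two differentials costs a sign, which is stored in the
    coefficient so that \<open>dform l\<close> stays in front.\<close>
  have "dform v * (lform l ^ k * (dform l * f)) =
     lform l ^ k * (dform l * sscale (- 1) (dform v * f))" for k
  proof -
    have "dform v * (lform l ^ k * (dform l * f)) = lform l ^ k * (dform v * dform l * f)"
      by (simp add: mult.assoc[symmetric] lform_power_commute)
    then show ?thesis
      by (subst (asm) dform_anticommute) (simp add: sscale_minus_one mult.assoc)
  qed
  then show ?case
    using line_ideal.dform[of l W "sscale (- 1) (dform v * f)" "dform v * g" A] dform
    by (simp add: distrib_left subalgebra.dform subalgebra.scale)
qed (simp add: line_ideal.zero)

lemma line_ideal_subset_subalgebra: "f \<in> line_ideal A W \<Longrightarrow> f \<in> subalgebra W"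
  by (induction f rule: line_ideal.induct)
    (auto intro!: subalgebra.add subalgebra_lform_power subalgebra.dform simp del: power_Suc)

lemma line_ideal_bidegree_part: "f \<in> line_ideal A W \<Longrightarrow> bidegree_part i j f \<in> line_ideal A W"
  by (induction f rule: line_ideal.induct)
    (auto simp: bidegree_part_add bidegree_part_lform_power bidegree_part_dform simp del: power_Suc intro!: line_ideal.intros subalgebra_bidegree_part)

text \<open>If \<open>a\<close> does not vanish at \<open>l\<close>, the exponent for
  \<open>a # A\<close> is one larger and the derivative loses at most that one power. Otherwise the
  exponents agree and the term with the lower power carries the scalar zero.\<close>

lemma line_ideal_dir_deriv: "f \<in> line_ideal (a # A) W \<Longrightarrow> dir_deriv a f \<in> line_ideal A W"
proof (induction f rule: line_ideal.induct)
  case (lform l f g)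
  have "lform l ^ Suc (num_nonzero (a # A) l) * dir_deriv a f \<in> line_ideal A W"
    by (rule line_ideal_lform_power) (use lform.hyps in \<open>auto simp: num_nonzero_Cons intro: subalgebra_dir_deriv\<close>)
  moreover have "sscale (of_nat (Suc (num_nonzero (a # A) l)) * dot a l) (lform l ^ num_nonzero (a # A) l * f) \<in> line_ideal A W"
  proof (cases "dot a l = 0")
    case False
    then show ?thesis
      by (intro line_ideal_scale line_ideal_lform_power) (use lform.hyps in \<open>auto simp: num_nonzero_Cons\<close>)
  qed (simp add: line_ideal.zero)
  ultimately show ?case
    using lform.IH
      by (simp add: dir_deriv_add dir_deriv_lform_power line_ideal_add del: power_Suc of_nat_Suc)
next
  case (dform l f g)
  have "lform l ^ num_nonzero (a # A) l * (dform l * dir_deriv a f) \<in> line_ideal A W"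
    by (rule line_ideal_dform_lform_power) (use dform.hyps in \<open>auto simp: num_nonzero_Cons intro: subalgebra_dir_deriv\<close>)
  moreover have "sscale (of_nat (num_nonzero (a # A) l) * dot a l) (lform l ^ (num_nonzero (a # A) l - 1) * (dform l * f)) \<in> line_ideal A W"
  proof (cases "dot a l = 0")
    case False
    then show ?thesis
      by (intro line_ideal_scale line_ideal_dform_lform_power) (use dform.hyps in \<open>auto simp: num_nonzero_Cons\<close>)
  qed (simp add: line_ideal.zero)
  ultimately show ?case
    using dform.IH by (simp add: dir_deriv_add dir_deriv_lform_power dir_deriv_dform line_ideal_add)
qed (simp add: line_ideal.zero)

text \<open>Contraction may replace \<open>dform l\<close> by the scalar \<open>dot a l\<close>.
  When this is nonzero, the exponent for \<open>a # A\<close> is large enough for the purely bosonic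
  generator of the ideal of \<open>A\<close>.\<close>

lemma line_ideal_contraction: "f \<in> line_ideal (a # A) W \<Longrightarrow> contraction a f \<in> line_ideal A W"
proof (induction f rule: line_ideal.induct)
  case (lform l f g)
  have "lform l ^ Suc (num_nonzero (a # A) l) * contraction a f \<in> line_ideal A W"
    by (rule line_ideal_lform_power) (use lform.hyps in \<open>auto simp: num_nonzero_Cons intro: subalgebra_contraction\<close>)
  then show ?case
    using lform.IH
      by (simp add: contraction_add contraction_lform_power line_ideal_add del: power_Suc)
next
  case (dform l f g)
  have "lform l ^ num_nonzero (a # A) l * (dform l * contraction a f) \<in> line_ideal A W"
    by (rule line_ideal_dform_lform_power) (use dform.hyps in \<open>auto simp: num_nonzero_Cons intro: subalgebra_contraction\<close>)
  moreover have "sscale (dot a l) (lform l ^ num_nonzero (a # A) l * f) \<in> line_ideal A W"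
  proof (cases "dot a l = 0")
    case False
    then show ?thesis
      by (intro line_ideal_scale line_ideal_lform_power) (use dform.hyps in \<open>auto simp: num_nonzero_Cons\<close>)
  qed (simp add: line_ideal.zero)
  ultimately show ?case
    using dform.IH
    by (simp add: contraction_add contraction_lform_power contraction_dform right_diff_distrib sscale_mult_right line_ideal_add line_ideal_diff)
qed (simp add: line_ideal.zero)

text \<open>At points of \<open>H\<close> the form \<open>a\<close> vanishes, so adding it to the
  list leaves the exponents unchanged. This is the map from the restriction into the larger
  arrangement.\<close>

lemma line_ideal_mono_subspace:
  assumes "f \<in> line_ideal A H" "H \<subseteq> W" "\<And>l. l \<in> H \<Longrightarrow> dot a l = 0"
  shows "f \<in> line_ideal (a # A) W"
  using assms(1)
proof (induction f rule: line_ideal.induct)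
  case (lform l f g)
  then show ?case
    using line_ideal.lform[of l W f g "a # A"] assms(2,3) subalgebra_mono[of f H W]
    by (auto simp: num_nonzero_Cons simp del: power_Suc)
next
  case (dform l f g)
  then show ?case
    using line_ideal.dform[of l W f g "a # A"] assms(2,3) subalgebra_mono[of f H W]
    by (auto simp: num_nonzero_Cons)
qed (rule line_ideal.zero)

lemma line_ideal_Cons_loop:
  assumes "\<And>l. l \<in> W \<Longrightarrow> dot a l = 0"
  shows "line_ideal (a # A) W = line_ideal A W"
proof (intro equalityI subsetI)
  fix f assume "f \<in> line_ideal (a # A) W"
  then show "f \<in> line_ideal A W"
  proof (induction f rule: line_ideal.induct)
    case (lform l f g)
    then show ?case using line_ideal.lform[of l W f g A] assms[of l]
      by (simp add: num_nonzero_Cons del: power_Suc)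
  next
    case (dform l f g)
    then show ?case using line_ideal.dform[of l W f g A] assms[of l] by (simp add: num_nonzero_Cons)
  qed (rule line_ideal.zero)
qed (use line_ideal_mono_subspace[of _ A W W a] assms in auto)

text \<open>Generators are integrated separately. If \<open>a\<close> is nonzero at
  \<open>l\<close>, integrating along \<open>l\<close> supplies the missing power; if it is zero,
  the exponent already fits and the coefficient is integrated along \<open>u\<close>.\<close>

lemma line_ideal_dir_deriv_surj:
  assumes "h \<in> line_ideal A W" and u: "u \<in> W" "dot a u = 1"
  shows "\<exists>g\<in>line_ideal (a # A) W. dir_deriv a g = h"
  using assms(1)
proof (induction h rule: line_ideal.induct)
  case zero
  then show ?case using line_ideal.zero by force
next
  case (lform l f g)
  then obtain g' where g': "g' \<in> line_ideal (a # A) W" "dir_deriv a g' = g" by blast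
  have "\<exists>G\<in>line_ideal (a # A) W. dir_deriv a G = lform l ^ Suc (num_nonzero A l) * f"
  proof (cases "dot a l = 0")
    case True
    obtain F where F: "F \<in> subalgebra W" "dir_deriv a (lform u * F) = f"
      using dir_deriv_antiderivative[of u W a f 0] u lform.hyps by auto
    have "lform l ^ Suc (num_nonzero A l) * (lform u * F) \<in> line_ideal (a # A) W"
      by (rule line_ideal_lform_power)
        (use lform.hyps u F True in \<open>auto simp: num_nonzero_Cons intro: subalgebra.lform\<close>)
    moreover have "dir_deriv a (lform l ^ Suc (num_nonzero A l) * (lform u * F)) =
       lform l ^ Suc (num_nonzero A l) * f"
      unfolding dir_deriv_lform_power F True by simp
    ultimately show ?thesis by blast
  next
    case False
    obtain F where F: "F \<in> subalgebra W" "dir_deriv a (lform l ^ Suc (Suc (num_nonzero A l)) * F) = lform l ^ Suc (num_nonzero A l) * f"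
      using dir_deriv_antiderivative[of l W a f "Suc (num_nonzero A l)"] lform.hyps False by blast
    have "lform l ^ Suc (Suc (num_nonzero A l)) * F \<in> line_ideal (a # A) W"
      by (rule line_ideal_lform_power) (use lform.hyps F False in \<open>auto simp: num_nonzero_Cons\<close>)
    then show ?thesis using F(2) by blast
  qed
  then obtain G where "G \<in> line_ideal (a # A) W" "dir_deriv a G =
     lform l ^ Suc (num_nonzero A l) * f" by blast
  then show ?case
    using g' by (intro bexI[of _ "G + g'"]) (auto simp: dir_deriv_add intro: line_ideal_add)
next
  case (dform l f g)
  then obtain g' where g': "g' \<in> line_ideal (a # A) W" "dir_deriv a g' = g" by blast
  have "\<exists>G\<in>line_ideal (a # A) W. dir_deriv a G = lform l ^ num_nonzero A l * (dform l * f)"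
  proof (cases "dot a l = 0")
    case True
    obtain F where F: "F \<in> subalgebra W" "dir_deriv a (lform u * F) = f"
      using dir_deriv_antiderivative[of u W a f 0] u dform.hyps by auto
    have "lform l ^ num_nonzero A l * (dform l * (lform u * F)) \<in> line_ideal (a # A) W"
      by (rule line_ideal_dform_lform_power)
        (use dform.hyps u F True in \<open>auto simp: num_nonzero_Cons intro: subalgebra.lform\<close>)
    moreover have "dir_deriv a (lform l ^ num_nonzero A l * (dform l * (lform u * F))) =
       lform l ^ num_nonzero A l * (dform l * f)"
      unfolding dir_deriv_lform_power dir_deriv_dform F True by simp
    ultimately show ?thesis by blast
  next
    case False
    have sw: "lform l ^ k * (dform l * y) = dform l * (lform l ^ k * y)" for k y
      by (simp add: mult.assoc[symmetric] lform_power_commute)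
    obtain F where F: "F \<in> subalgebra W" "dir_deriv a (lform l ^ Suc (num_nonzero A l) * F) =
       lform l ^ num_nonzero A l * f"
      using dir_deriv_antiderivative[of l W a f "num_nonzero A l"] dform.hyps False by blast
    have "lform l ^ Suc (num_nonzero A l) * (dform l * F) \<in> line_ideal (a # A) W"
      by (rule line_ideal_dform_lform_power) (use dform.hyps F False in \<open>auto simp: num_nonzero_Cons\<close>)
    moreover have "dir_deriv a (lform l ^ Suc (num_nonzero A l) * (dform l * F)) =
       lform l ^ num_nonzero A l * (dform l * f)"
      unfolding sw dir_deriv_dform F ..
    ultimately show ?thesis by blast
  qed
  then obtain G where "G \<in> line_ideal (a # A) W" "dir_deriv a G =
     lform l ^ num_nonzero A l * (dform l * f)" by blast
  then show ?case
    using g' by (intro bexI[of _ "G + g'"]) (auto simp: dir_deriv_add intro: line_ideal_add)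
qed

text \<open>An element \<open>g\<close> of the ideal with the same derivative is subtracted, and the
  difference is in the kernel described by \<open>dir_deriv_kernel\<close>. Taking bihomogeneous
  parts gives \<open>c\<close> fermionic degree \<open>j - 1\<close>, since \<open>dform u\<close>
  accounts for one.\<close>

lemma line_ideal_split:
  assumes W: "vec.subspace W" and u: "u \<in> W" "dot a u = 1"
    and f: "f \<in> subalgebra W" "bidegree_part i j f = f" "dir_deriv a f \<in> line_ideal A W"
  defines "H \<equiv> {l \<in> W. dot a l = 0}"
  shows "\<exists>g b c. g \<in> line_ideal (a # A) W \<and> b \<in> subalgebra H \<and> bidegree_part i j b = b \<and>
           c \<in> subalgebra H \<and> bidegree_part i (j - 1) c = c \<and> f = g + b + dform u * c"
proof -
  obtain g where g: "g \<in> line_ideal (a # A) W" "dir_deriv a g = dir_deriv a f"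
    using line_ideal_dir_deriv_surj[OF f(3) u] by blast
  have "f - g \<in> subalgebra W" "dir_deriv a (f - g) = 0"
    using f(1) g line_ideal_subset_subalgebra by (auto simp: dir_deriv_diff intro: subalgebra_diff)
  then obtain b c where bc: "b \<in> subalgebra H" "c \<in> subalgebra H" "f - g = b + dform u * c"
    using dir_deriv_kernel[OF W u] unfolding H_def by blast
  have "f = bidegree_part i j (g + (f - g))" using f(2) by simp
  also have "\<dots> = bidegree_part i j g + bidegree_part i j b + dform u * bidegree_part i (j - 1) c"
    unfolding bc(3) by (simp add: bidegree_part_add bidegree_part_dform add.assoc)
  finally show ?thesis
    using bc g(1)
      by (intro exI[of _ "bidegree_part i j g"] exI[of _ "bidegree_part i j b"] exI[of _ "bidegree_part i (j - 1) c"])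
      (auto intro: line_ideal_bidegree_part subalgebra_bidegree_part)
qed

text \<open>Without forms all counts are zero, so every \<open>lform l\<close> and every
  \<open>dform l\<close> lies in the ideal and only scalars survive.\<close>

lemma subalgebra_mod_line_ideal_Nil:
  "f \<in> subalgebra W \<Longrightarrow> \<exists>c. f - sscale c 1 \<in> line_ideal [] W"
proof (induction f rule: subalgebra.induct)
  case one
  then show ?case by (intro exI[of _ 1]) (simp add: line_ideal.zero)
next
  case (add f g)
  then obtain c d where "f - sscale c 1 \<in> line_ideal [] W" "g - sscale d 1 \<in> line_ideal [] W"
    by blast
  then have "(f - sscale c 1) + (g - sscale d 1) \<in> line_ideal [] W" by (rule line_ideal_add)
  then show ?case by (intro exI[of _ "c + d"]) (simp add: sscale_add_left algebra_simps)
next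
  case (scale f k)
  then obtain c where "f - sscale c 1 \<in> line_ideal [] W" by blast
  then have "sscale k (f - sscale c 1) \<in> line_ideal [] W" by (rule line_ideal_scale)
  then show ?case by (intro exI[of _ "k * c"]) (simp add: sscale_diff_right)
next
  case (lform l f)
  then show ?case
    using line_ideal_lform_power[of l W f "[]" 1] by (intro exI[of _ 0]) simp
next
  case (dform l f)
  then show ?case
    using line_ideal_dform_lform_power[of l W f "[]" 0] by (intro exI[of _ 0]) simp
qed

section \<open>Vanishing above the top degree and apolarity in it\<close>

definition nonzero_on :: "(complex ^ 'n) set \<Rightarrow> complex ^ 'n::finite \<Rightarrow> bool" where
  "nonzero_on W a \<longleftrightarrow> (\<exists>l\<in>W. dot a l \<noteq> 0)"

lemma subspace_kernel: "vec.subspace W \<Longrightarrow> vec.subspace {l \<in> W. dot a l = 0}"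
  by (auto simp: vec.subspace_def dot_add_right dot_scale_right)

lemma nonzero_on_unit:
  assumes "vec.subspace W" "nonzero_on W a"
  obtains u where "u \<in> W" "dot a u = 1"
proof -
  obtain l where "l \<in> W" "dot a l \<noteq> 0" using assms by (auto simp: nonzero_on_def)
  then show ?thesis
    using assms(1)
      by (intro that[of "(1 / dot a l) *s l"]) (auto simp: dot_scale_right intro: vec.subspace_scale)
qed

text \<open>A non-loop \<open>a\<close> lowers the bound by one, and so does the derivative;
  \<open>b\<close> and \<open>c\<close> are handled on the hyperplane of \<open>a\<close>. Counting
  only the forms that are nonzero on \<open>W\<close> gives a bound below \<open>length A\<close> in
  the presence of loops, which is how loops are treated later.\<close>

lemma line_ideal_above_top:
  assumes "vec.subspace W" "f \<in> subalgebra W" "bidegree_part i j f = f"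
    "i + j > int (length (filter (nonzero_on W) A))"
  shows "f \<in> line_ideal A W"
  using assms
proof (induction A arbitrary: W f i j)
  case Nil
  obtain c where c: "f - sscale c 1 \<in> line_ideal [] W"
    using subalgebra_mod_line_ideal_Nil Nil by blast
  have "\<not> (i = 0 \<and> j = 0)" using Nil by auto
  then have "bidegree_part i j (f - sscale c 1) = f"
    using Nil.prems by (auto simp: bidegree_part_diff bidegree_part_scale bidegree_part_one)
  then show ?case using line_ideal_bidegree_part[OF c, of i j] by simp
next
  case (Cons a A)
  show ?case
  proof (cases "nonzero_on W a")
    case False
    then show ?thesis
      using Cons.IH[OF Cons.prems(1-3)] Cons.prems(4) line_ideal_Cons_loop[of W a A]
      by (auto simp: nonzero_on_def)
  next
    case True
    then obtain u where u: "u \<in> W" "dot a u = 1" using nonzero_on_unit Cons.prems(1) by blast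
    define H where "H = {l \<in> W. dot a l = 0}"
    have H: "vec.subspace H" "H \<subseteq> W" "\<And>l. l \<in> H \<Longrightarrow> dot a l = 0"
      using subspace_kernel Cons.prems(1) by (auto simp: H_def)
    have len: "int (length (filter (nonzero_on W) A)) + 1 < i + j"
      using Cons.prems(4) True by simp
    \<comment> \<open>Restriction to a smaller space can create loops but never remove them.\<close>
    have "filter (nonzero_on H) A = filter (nonzero_on H) (filter (nonzero_on W) A)"
      using H(2) by (induction A) (auto simp: nonzero_on_def)
    then have lenH: "length (filter (nonzero_on H) A) \<le> length (filter (nonzero_on W) A)"
      by (metis length_filter_le)
    have "bidegree_part (i - 1) j (dir_deriv a f) = dir_deriv a f"
      using Cons.prems(3) by (simp add: bidegree_part_dir_deriv)
    then have "dir_deriv a f \<in> line_ideal A W"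
      using Cons.IH[of W "dir_deriv a f" "i - 1" j] Cons.prems len
        by (auto intro: subalgebra_dir_deriv)
    then obtain g b c where gbc: "g \<in> line_ideal (a # A) W" "b \<in> subalgebra H" "bidegree_part i j b = b"
      "c \<in> subalgebra H" "bidegree_part i (j - 1) c = c" "f = g + b + dform u * c"
      using line_ideal_split[OF Cons.prems(1) u Cons.prems(2,3)] unfolding H_def by blast
    \<comment> \<open>\<open>b\<close> keeps the total degree and \<open>c\<close> loses one. Both
      still exceed the count on \<open>H\<close>, because \<open>a\<close> is no longer
      counted.\<close>
    have "b \<in> line_ideal A H" "c \<in> line_ideal A H"
      using Cons.IH[OF H(1) gbc(2,3)] Cons.IH[OF H(1) gbc(4,5)] len lenH by auto
    then have "b \<in> line_ideal (a # A) W" "c \<in> line_ideal (a # A) W"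
      using line_ideal_mono_subspace H by blast+
    then show ?thesis
      using gbc u by (auto intro: line_ideal_add line_ideal_times_dform)
  qed
qed

text \<open>In total degree \<open>length A\<close> the ideal is cut out
  by the functionals that differentiate along some
  of the forms in \<open>A\<close>, contract with the others, and take the constant term.\<close>

fun apolar :: "(complex ^ 'n::{finite,linorder}) list \<Rightarrow> 'n superspace \<Rightarrow> bool" where
  "apolar [] f \<longleftrightarrow> Poly_Mapping.lookup (theta_coeff f {}) 0 = 0"
| "apolar (a # A) f \<longleftrightarrow> apolar A (dir_deriv a f) \<and> apolar A (contraction a f)"

lemma apolar_add: "apolar A f \<Longrightarrow> apolar A g \<Longrightarrow> apolar A (f + g)"
  by (induction A arbitrary: f g) (auto simp: lookup_add dir_deriv_add contraction_add)

lemma apolar_diff: "apolar A f \<Longrightarrow> apolar A g \<Longrightarrow> apolar A (f - g)"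
  by (induction A arbitrary: f g) (auto simp: lookup_minus dir_deriv_diff contraction_diff)

text \<open>Derivative and contraction each remove \<open>a\<close> from the list, and the ideal of
  the empty list contains nothing with a constant term. The conclusion does not depend on
  \<open>W\<close>.\<close>

lemma line_ideal_apolar: "f \<in> line_ideal A W \<Longrightarrow> apolar A f"
proof (induction A arbitrary: f)
  case Nil
  then show ?case
  proof (induction f rule: line_ideal.induct)
    case (lform l f g)
    have "lform l ^ Suc (num_nonzero [] l) * f = (\<Sum>i\<in>UNIV. sscale (l $ i) (bvar i * f))"
      by (simp add: lform_times)
    then show ?case
      using lform
        by (simp add: theta_coeff_sum lookup_sum lookup_add lookup_cpoly_var_times del: power_Suc)
  next
    case (dform l f g)
    have "lform l ^ num_nonzero [] l * (dform l * f) = (\<Sum>i\<in>UNIV. sscale (l $ i) (theta i * f))"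
      by (simp add: dform_times)
    then show ?case
      using dform by (simp add: theta_coeff_sum lookup_sum lookup_add theta_coeff_theta_times)
  qed simp
qed (auto intro: line_ideal_dir_deriv line_ideal_contraction)

text \<open>The derivative condition reduces \<open>f\<close> to \<open>b + dform u * c\<close>
  modulo the ideal, degree reasons dispose of \<open>b\<close>, and the contraction condition is the
  apolarity of \<open>c\<close>, to which the induction applies on \<open>H\<close>.\<close>

lemma apolar_top:
  assumes "vec.subspace W" "f \<in> subalgebra W" "bidegree_part i j f = f" "i + j =
     int (length A)" "apolar A f"
  shows "f \<in> line_ideal A W"
  using assms
proof (induction A arbitrary: W f i j)
  case Nil
  obtain c where c: "f - sscale c 1 \<in> line_ideal [] W"
    using subalgebra_mod_line_ideal_Nil Nil by blast
  then have "apolar [] (f - sscale c 1)" by (rule line_ideal_apolar)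
  then have "c = 0" using Nil.prems(5) by (simp add: lookup_minus cpoly_const_def)
  then show ?case using c by simp
next
  case (Cons a A)
  have ij: "i + j = int (length A) + 1" using Cons.prems(4) by simp
  show ?case
  proof (cases "nonzero_on W a")
    case False
    \<comment> \<open>The loop \<open>a\<close> adds to the degree but not to the count, so the
      degree is already above the top.\<close>
    then have "int (length (filter (nonzero_on W) (a # A))) =
       int (length (filter (nonzero_on W) A))"
      by simp
    also have "\<dots> < i + j"
      using ij length_filter_le[of "nonzero_on W" A] by linarith
    finally show ?thesis by (rule line_ideal_above_top[OF Cons.prems(1-3)])
  next
    case True
    then obtain u where u: "u \<in> W" "dot a u = 1" using nonzero_on_unit Cons.prems(1) by blast
    define H where "H = {l \<in> W. dot a l = 0}"
    have H: "vec.subspace H" "H \<subseteq> W" "\<And>l. l \<in> H \<Longrightarrow> dot a l = 0"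
      using subspace_kernel Cons.prems(1) by (auto simp: H_def)
    have "bidegree_part (i - 1) j (dir_deriv a f) = dir_deriv a f"
      using Cons.prems(3) by (simp add: bidegree_part_dir_deriv)
    then have "dir_deriv a f \<in> line_ideal A W"
      using Cons.IH[of W "dir_deriv a f" "i - 1" j] Cons.prems by (auto intro: subalgebra_dir_deriv)
    then obtain g b c where gbc: "g \<in> line_ideal (a # A) W" "b \<in> subalgebra H" "bidegree_part i j b = b"
      "c \<in> subalgebra H" "bidegree_part i (j - 1) c = c" "f = g + b + dform u * c"
      using line_ideal_split[OF Cons.prems(1) u Cons.prems(2,3)] unfolding H_def by blast
    have "int (length (filter (nonzero_on H) A)) < i + j"
      using ij length_filter_le[of "nonzero_on H" A] by linarith
    then have "b \<in> line_ideal A H"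
      by (rule line_ideal_above_top[OF H(1) gbc(2,3)])
    then have b: "b \<in> line_ideal (a # A) W" using line_ideal_mono_subspace H by blast
    \<comment> \<open>Both \<open>g\<close> and \<open>b\<close> lie in the ideal and are
      annihilated, so the condition on \<open>f\<close> becomes one on
      \<open>dform u * c\<close>.\<close>
    have "apolar (a # A) (f - (g + b))"
      using Cons.prems(5) line_ideal_apolar[OF gbc(1)] line_ideal_apolar[OF b]
      by (intro apolar_diff apolar_add)
    then have "apolar A (contraction a (dform u * c))" using gbc(6) by simp
    moreover have "contraction a (dform u * c) = c"
      using contraction_subalgebra_kernel[OF gbc(4) H(3)] u by (simp add: contraction_dform)
    ultimately have "c \<in> line_ideal A H"
      using Cons.IH[OF H(1) gbc(4,5)] Cons.prems(4) by simp
    then have "c \<in> line_ideal (a # A) W" using line_ideal_mono_subspace H by blast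
    then show ?thesis
      using gbc b u by (auto intro: line_ideal_add line_ideal_times_dform)
  qed
qed

section \<open>Linear algebra modulo an ideal\<close>

lemma sum_lessThan_add:
  fixes g :: "nat \<Rightarrow> 'a::comm_monoid_add"
  shows "(\<Sum>k<m + n. g k) = (\<Sum>k<m. g k) + (\<Sum>k<n. g (m + k))"
  by (induction n) (simp_all add: add.assoc)

text \<open>Gaussian elimination: an unknown with nonzero coefficient in the last equation serves as
  pivot. This bounds the size of independent sets in \<open>quotient_dim_eq\<close>.\<close>

lemma homogeneous_system_nontrivial:
  fixes m :: "'b \<Rightarrow> nat \<Rightarrow> complex"
  assumes "finite C" "card C > n"
  shows "\<exists>c. (\<exists>x\<in>C. c x \<noteq> 0) \<and> (\<forall>k<n. (\<Sum>x\<in>C. c x * m x k) = 0)"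
  using assms
proof (induction n arbitrary: C m)
  case 0
  then obtain x where "x \<in> C" by fastforce
  then show ?case by (intro exI[of _ "\<lambda>_. 1"]) auto
next
  case (Suc n)
  show ?case
  proof (cases "\<forall>x\<in>C. m x n = 0")
    case True
    obtain c where "\<exists>x\<in>C. c x \<noteq> 0" "\<forall>k<n. (\<Sum>x\<in>C. c x * m x k) = 0"
      using Suc.IH[of C m] Suc.prems by auto
    then show ?thesis using True by (intro exI[of _ c]) (auto simp: less_Suc_eq)
  next
    case False
    then obtain y where y: "y \<in> C" "m y n \<noteq> 0" by blast
    define m' where "m' x k = m x k - m x n / m y n * m y k" for x k
    have "card (C - {y}) > n" using Suc.prems y by simp
    then obtain c where c: "\<exists>x\<in>C - {y}. c x \<noteq> 0" "\<forall>k<n. (\<Sum>x\<in>C - {y}. c x * m' x k) = 0"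
      using Suc.IH[of "C - {y}" m'] Suc.prems(1) by blast
    \<comment> \<open>The value at the pivot \<open>y\<close> is obtained by solving the equation
      numbered \<open>n\<close>.\<close>
    define d where "d x = (if x = y then - (\<Sum>z\<in>C - {y}. c z * m z n) / m y n else c x)" for x
    have d: "(\<Sum>x\<in>C. d x * m x k) = (\<Sum>x\<in>C - {y}. c x * m' x k)" for k
    proof -
      have "(\<Sum>x\<in>C. d x * m x k) = d y * m y k + (\<Sum>x\<in>C - {y}. d x * m x k)"
        using sum.remove[OF Suc.prems(1) y(1)] by blast
      also have "(\<Sum>x\<in>C - {y}. d x * m x k) = (\<Sum>x\<in>C - {y}. c x * m x k)"
        by (rule sum.cong) (auto simp: d_def)
      also have "d y * m y k = - (\<Sum>x\<in>C - {y}. c x * (m x n / m y n * m y k))"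
        by (simp add: d_def sum_divide_distrib sum_distrib_right mult.assoc)
      finally show ?thesis
        by (simp add: m'_def right_diff_distrib sum_subtractf)
    qed
    have "(\<Sum>x\<in>C. d x * m x k) = 0" if "k < Suc n" for k
    proof (cases "k = n")
      case True
      have "m' x n = 0" for x using y by (simp add: m'_def)
      then show ?thesis unfolding d True by simp
    next
      case False
      then show ?thesis unfolding d using c(2) that by simp
    qed
    moreover have "\<exists>x\<in>C. d x \<noteq> 0" using c(1) by (auto simp: d_def)
    ultimately show ?thesis by blast
  qed
qed

definition lin_closed :: "('n::{finite,linorder}) superspace set \<Rightarrow> bool" where
  "lin_closed I \<longleftrightarrow> 0 \<in> I \<and> (\<forall>f\<in>I. \<forall>g\<in>I. f + g \<in> I) \<and> (\<forall>c. \<forall>f\<in>I. sscale c f \<in> I)"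

lemma lin_closed_sum: "lin_closed I \<Longrightarrow> (\<And>i. i \<in> S \<Longrightarrow> f i \<in> I) \<Longrightarrow> (\<Sum>i\<in>S. f i) \<in> I"
  by (induction S rule: infinite_finite_induct) (auto simp: lin_closed_def)

lemma lin_closed_line_ideal: "lin_closed (line_ideal A W)"
  by (auto simp: lin_closed_def intro: line_ideal_add line_ideal_scale line_ideal.zero)

text \<open>An indexed family rather than a set, so that the families for the deletion and the
  restriction can be concatenated.\<close>

definition mod_basis ::
    "(nat \<Rightarrow> ('n::{finite,linorder}) superspace) \<Rightarrow> nat \<Rightarrow> 'n superspace set \<Rightarrow> 'n superspace set \<Rightarrow> bool" where
  "mod_basis e n V I \<longleftrightarrow> (\<forall>k<n. e k \<in> V) \<and>
     (\<forall>c. (\<Sum>k<n. sscale (c k) (e k)) \<in> I \<longrightarrow> (\<forall>k<n. c k = 0)) \<and>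
     (\<forall>f\<in>V. \<exists>c. f - (\<Sum>k<n. sscale (c k) (e k)) \<in> I)"

text \<open>The family itself attains the value \<open>n\<close>. Any larger set, expanded in the
  family modulo \<open>I\<close>, yields more unknowns than equations and hence a nontrivial
  relation.\<close>

lemma quotient_dim_eq:
  assumes I: "lin_closed I" and e: "mod_basis e n V I"
  shows "quotient_dim superspace_const I V = n"
  unfolding quotient_dim_def superspace_const_times
proof (rule cSup_eq_maximum)
  have indep: "\<forall>k<n. c k = 0" if "(\<Sum>k<n. sscale (c k) (e k)) \<in> I" for c
    using e that by (auto simp: mod_basis_def)
  have inj: "inj_on e {..<n}"
  proof (rule inj_onI, rule ccontr)
    fix k l assume kl: "k \<in> {..<n}" "l \<in> {..<n}" "e k = e l" "k \<noteq> l"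
    \<comment> \<open>The coefficients of \<open>e k - e l\<close>: a repeated member of the family
      would be a relation.\<close>
    define c :: "nat \<Rightarrow> complex" where "c = (\<lambda>p. if p = k then 1 else if p = l then - 1 else 0)"
    have "(\<Sum>p<n. sscale (c p) (e p)) =
        (\<Sum>p<n. (if p = k then e k else 0) + (if p = l then - e l else 0))"
      using kl(4) by (intro sum.cong) (auto simp: c_def sscale_minus_one)
    also have "\<dots> = 0" using kl by (simp add: sum.distrib)
    finally have "c k = 0" using indep[of c] I kl(1) by (simp add: lin_closed_def)
    then show False by (simp add: c_def)
  qed
  have "(\<forall>b\<in>e ` {..<n}. c b = 0)" if "(\<Sum>b\<in>e ` {..<n}. sscale (c b) b) \<in> I" for c
    using that indep[of "\<lambda>k. c (e k)"] by (auto simp: sum.reindex[OF inj])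
  moreover have "card (e ` {..<n}) = n" using card_image[OF inj] by simp
  moreover have "e ` {..<n} \<subseteq> V" using e by (auto simp: mod_basis_def)
  ultimately show "n \<in> {card B |B. finite B \<and> B \<subseteq> V \<and>
      (\<forall>c. (\<Sum>b\<in>B. sscale (c b) b) \<in> I \<longrightarrow> (\<forall>b\<in>B. c b = 0))}"
    by (intro CollectI exI[of _ "e ` {..<n}"]) auto
next
  fix x
  assume "x \<in> {card B |B. finite B \<and> B \<subseteq> V \<and>
      (\<forall>c. (\<Sum>b\<in>B. sscale (c b) b) \<in> I \<longrightarrow> (\<forall>b\<in>B. c b = 0))}"
  then obtain B where B: "x = card B" "finite B" "B \<subseteq> V"
    "\<And>c. (\<Sum>b\<in>B. sscale (c b) b) \<in> I \<Longrightarrow> \<forall>b\<in>B. c b = 0" by blast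
  have "\<forall>b\<in>B. \<exists>c. b - (\<Sum>k<n. sscale (c k) (e k)) \<in> I"
    using e B(3) by (auto simp: mod_basis_def)
  then obtain m where m: "\<And>b. b \<in> B \<Longrightarrow> b - (\<Sum>k<n. sscale (m b k) (e k)) \<in> I" by metis
  show "x \<le> n"
  proof (rule ccontr)
    assume "\<not> x \<le> n"
    then obtain c where c: "\<exists>b\<in>B. c b \<noteq> 0" "\<forall>k<n. (\<Sum>b\<in>B. c b * m b k) = 0"
      using homogeneous_system_nontrivial[OF B(2), of n m] B(1) by auto
    have "(\<Sum>b\<in>B. sscale (c b) (b - (\<Sum>k<n. sscale (m b k) (e k)))) \<in> I"
      using m I by (intro lin_closed_sum) (auto simp: lin_closed_def)
    moreover have "(\<Sum>b\<in>B. sscale (c b) (\<Sum>k<n. sscale (m b k) (e k))) =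
        (\<Sum>k<n. sscale (\<Sum>b\<in>B. c b * m b k) (e k))"
      unfolding sscale_sum sscale_sscale sscale_sum_left by (rule sum.swap)
    ultimately have "(\<Sum>b\<in>B. sscale (c b) b) \<in> I"
      using c(2) by (simp add: sscale_diff_right sum_subtractf)
    then show False using B(4) c(1) by blast
  qed
qed

section \<open>Flats of the arrangement and the matroid recursion\<close>

text \<open>The flat reached after restricting to the forms in \<open>K\<close>. Keeping the forms
  as well as the subspace makes ranks available on the matroid side.\<close>

definition common_kernel :: "(complex ^ 'n::finite) list \<Rightarrow> (complex ^ 'n) set" where
  "common_kernel K = {v. \<forall>b\<in>set K. dot b v = 0}"

lemma common_kernel_Nil [simp]: "common_kernel [] = UNIV"
  by (simp add: common_kernel_def)

lemma common_kernel_Cons: "common_kernel (a # K) = {l \<in> common_kernel K. dot a l = 0}"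
  by (auto simp: common_kernel_def)

lemma subspace_common_kernel: "vec.subspace (common_kernel K)"
  by (auto simp: vec.subspace_def common_kernel_def dot_add_right dot_scale_right)

text \<open>The double annihilator argument: when \<open>b\<close> is not zero on the kernel of
  \<open>K\<close>, subtracting a multiple of \<open>b\<close> from \<open>a\<close> gives a form
  that vanishes on that whole kernel.\<close>

lemma span_of_common_kernel: "(\<And>v. v \<in> common_kernel K \<Longrightarrow> dot a v = 0) \<Longrightarrow> a \<in> vec.span (set K)"
proof (induction K arbitrary: a)
  case Nil
  have "a $ i = 0" for i
  proof -
    have "dot a (axis i 1) = (\<Sum>j\<in>UNIV. if j = i then a $ i else 0)"
      unfolding dot_def by (rule sum.cong) (auto simp: axis_def)
    then show ?thesis using Nil[of "axis i 1"] by simp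
  qed
  then have "a = 0" by (simp add: vec_eq_iff)
  then show ?case by (simp add: vec.span_zero)
next
  case (Cons b K)
  show ?case
  proof (cases "\<forall>v\<in>common_kernel K. dot b v = 0")
    case True
    then have "common_kernel (b # K) = common_kernel K" by (auto simp: common_kernel_Cons)
    then have "a \<in> vec.span (set K)" using Cons by simp
    then show ?thesis using vec.span_mono[of "set K" "set (b # K)"] by auto
  next
    case False
    then obtain u where u: "u \<in> common_kernel K" "dot b u = 1"
      using nonzero_on_unit[OF subspace_common_kernel, of K b] by (auto simp: nonzero_on_def)
    define a' where "a' = a - dot a u *s b"
    have "dot a' v = 0" if v: "v \<in> common_kernel K" for v
    proof -
      \<comment> \<open>The projection of \<open>v\<close> along \<open>u\<close> lands in the
        kernel of \<open>b\<close>, where \<open>a\<close> is zero.\<close>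
      have "v - dot b v *s u \<in> common_kernel (b # K)"
        using v u by (auto simp: common_kernel_Cons dot_diff_right dot_scale_right
            intro!: vec.subspace_diff vec.subspace_scale subspace_common_kernel)
      then have "dot a (v - dot b v *s u) = 0" by (rule Cons.prems)
      then show ?thesis
        by (simp add: a'_def dot_diff_left dot_diff_right dot_scale_left dot_scale_right mult.commute)
    qed
    then have "a' \<in> vec.span (set K)" by (rule Cons.IH)
    then have "a' \<in> vec.span (set (b # K))"
      using vec.span_mono[of "set K" "set (b # K)"] by auto
    then have "a' + dot a u *s b \<in> vec.span (set (b # K))"
      by (intro vec.span_add vec.span_scale) (auto intro: vec.span_base)
    then show ?thesis by (simp add: a'_def)
  qed
qed

text \<open>Translates the geometric case distinction of the deletion-restriction step into the
  matroid condition that \<open>a\<close> is not a loop after contracting \<open>K\<close>.\<close>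

lemma nonzero_on_common_kernel_iff: "nonzero_on (common_kernel K) a \<longleftrightarrow> a \<notin> vec.span (set K)"
proof
  assume "a \<notin> vec.span (set K)"
  then show "nonzero_on (common_kernel K) a"
    using span_of_common_kernel[of K a] by (auto simp: nonzero_on_def)
next
  assume n: "nonzero_on (common_kernel K) a"
  show "a \<notin> vec.span (set K)"
  proof
    assume "a \<in> vec.span (set K)"
    then have "\<forall>v\<in>common_kernel K. dot a v = 0"
    proof (induction a rule: vec.span_induct_alt)
      case base
      then show ?case by simp
    next
      case (step c x y)
      then show ?case by (simp add: dot_add_left dot_scale_left) (simp add: common_kernel_def)
    qed
    then show False using n by (auto simp: nonzero_on_def)
  qed
qed

text \<open>The exponent of \<open>- 1\<close> agrees modulo 2 with the nullity of \<open>S\<close> in the contraction of the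
  matroid of \<open>A\<close> by \<open>K\<close>.\<close>

definition whitney :: "(complex ^ 'n::finite) list \<Rightarrow> (complex ^ 'n) list \<Rightarrow> int \<Rightarrow> int" where
  "whitney K A j = (\<Sum>S\<in>Pow {..<length A}.
     if int (vec.dim (nth A ` S \<union> set K)) = j + int (vec.dim (set K))
     then (- 1) ^ (card S + vec.dim (nth A ` S \<union> set K) + vec.dim (set K)) else 0)"

lemma whitney_Nil: "whitney K [] j = (if j = 0 then 1 else 0)"
  by (simp add: whitney_def power_add[symmetric] mult_2[symmetric])

lemma sum_Pow_lessThan_Suc:
  fixes f :: "nat set \<Rightarrow> 'b::comm_monoid_add"
  shows "(\<Sum>S\<in>Pow {..<Suc n}. f S) = (\<Sum>S\<in>Pow {..<n}. f (Suc ` S) + f (insert 0 (Suc ` S)))"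
proof -
  have P: "Pow (Suc ` {..<n}) = image Suc ` Pow {..<n}"
    by (rule image_Pow_surj[symmetric]) simp
  have inj: "inj_on (image Suc) (Pow {..<n})"
    by (intro inj_on_image_Pow) simp
  have inj': "inj_on (insert 0) (image Suc ` Pow {..<n})"
    by (rule inj_onI) blast
  have "(\<Sum>S\<in>Pow {..<Suc n}. f S) =
      (\<Sum>S\<in>image Suc ` Pow {..<n}. f S) + (\<Sum>S\<in>insert 0 ` image Suc ` Pow {..<n}. f S)"
    unfolding lessThan_Suc_eq_insert_0 Pow_insert P by (rule sum.union_disjoint) auto
  then show ?thesis
    by (simp add: sum.reindex[OF inj] sum.reindex[OF inj'] sum.distrib)
qed

text \<open>Subsets are split by whether they contain the head. Choosing it raises the cardinality
  by one and, for the rank, amounts to adding \<open>a\<close> to \<open>K\<close>.\<close>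

lemma whitney_Cons_sum:
  "whitney K (a # A) j = whitney K A j + (\<Sum>S\<in>Pow {..<length A}.
     if int (vec.dim (nth A ` S \<union> set (a # K))) = j + int (vec.dim (set K))
     then (- 1) ^ (Suc (card S) + vec.dim (nth A ` S \<union> set (a # K)) + vec.dim (set K)) else 0)"
proof -
  have "nth (a # A) ` Suc ` S = nth A ` S" for S
    by (simp add: image_image)
  moreover have "card (Suc ` S) = card S" for S
    by (simp add: card_image)
  moreover have "card (insert 0 (Suc ` S)) = Suc (card S)" if "S \<in> Pow {..<length A}" for S
    using that finite_subset[of S] by (subst card_insert_disjoint) (auto simp: card_image)
  ultimately show ?thesis
    unfolding whitney_def length_Cons sum_Pow_lessThan_Suc sum.distrib
    by (intro arg_cong2[of _ _ _ _ "(+)"] sum.cong) auto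
qed

text \<open>Adding or omitting a loop changes the cardinality but no rank, so the subsets cancel in
  pairs.\<close>

lemma whitney_Cons_loop:
  assumes "a \<in> vec.span (set K)"
  shows "whitney K (a # A) j = 0"
proof -
  have "vec.dim (nth A ` S \<union> set (a # K)) = vec.dim (nth A ` S \<union> set K)" for S
  proof -
    have "a \<in> vec.span (nth A ` S \<union> set K)"
      using assms vec.span_mono[of "set K" "nth A ` S \<union> set K"] by auto
    then have "vec.span (nth A ` S \<union> set (a # K)) = vec.span (nth A ` S \<union> set K)"
      by (simp add: vec.span_redundant)
    then show ?thesis by (metis vec.dim_span)
  qed
  then show ?thesis
    unfolding whitney_Cons_sum unfolding whitney_def sum.distrib[symmetric]
    by (intro sum.neutral) simp
qed

text \<open>The rank of \<open>a # K\<close> exceeds that of \<open>K\<close> by one. This shifts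
  \<open>j\<close> and also compensates the sign of the additional element, so no minus
  appears.\<close>

lemma whitney_Cons:
  assumes "a \<notin> vec.span (set K)"
  shows "whitney K (a # A) j = whitney K A j + whitney (a # K) A (j - 1)"
proof -
  have "vec.dim (set (a # K)) = Suc (vec.dim (set K))"
    using assms by (simp add: vec.dim_insert)
  then show ?thesis
    unfolding whitney_Cons_sum by (simp add: whitney_def add.commute add.left_commute cong: if_cong)
qed

section \<open>Bases in the top total degree\<close>

lemma mod_basis_zero:
  assumes "\<And>f. f \<in> V \<Longrightarrow> f \<in> I"
  shows "mod_basis e 0 V I"
  using assms by (simp add: mod_basis_def)

lemma bidegree_part_negative: "i < 0 \<or> j < 0 \<Longrightarrow> bidegree_part i j f = 0"
  by (rule superspace_eqI) (auto simp: bidegree_part_def cpoly_component_neg)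

definition graded_part :: "(complex ^ 'n::{finite,linorder}) set \<Rightarrow> int \<Rightarrow> int \<Rightarrow> ('n::{finite,linorder}) superspace set" where
  "graded_part W i j = {f \<in> subalgebra W. bidegree_part i j f = f}"

lemma graded_part_sum:
  "(\<And>k. k \<in> S \<Longrightarrow> f k \<in> graded_part W i j) \<Longrightarrow> (\<Sum>k\<in>S. sscale (c k) (f k)) \<in> graded_part W i j"
  by (auto simp: graded_part_def bidegree_part_sum bidegree_part_scale intro!: subalgebra_sum subalgebra.scale sum.cong)

text \<open>Degrees and flat are left free because deletion lowers \<open>i\<close> while
  restriction lowers \<open>j\<close> and extends \<open>K\<close>. The sizes of the two bases add
  up exactly as in \<open>whitney_Cons\<close>.\<close>

lemma mod_basis_top:
  "i + j = int (length A) \<Longrightarrow>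
   \<exists>e n. mod_basis e n (graded_part (common_kernel K) i j) (line_ideal A (common_kernel K)) \<and> int n = whitney K A j"
proof (induction A arbitrary: i j K)
  case Nil
  show ?case
  proof (cases "j = 0")
    case False
    \<comment> \<open>The degrees sum to zero and \<open>j\<close> is nonzero, so one of them is
      negative.\<close>
    then have "i < 0 \<or> j < 0" using Nil by auto
    then have "bidegree_part i j f = 0" for f :: "'a superspace" by (rule bidegree_part_negative)
    then have "mod_basis (\<lambda>_. 0) 0 (graded_part (common_kernel K) i j) (line_ideal [] (common_kernel K))"
      by (intro mod_basis_zero) (auto simp: graded_part_def line_ideal.zero)
    then show ?thesis using False by (intro exI) (auto simp: whitney_Nil)
  next
    case True
    have "mod_basis (\<lambda>_. 1) 1 (graded_part (common_kernel K) 0 0) (line_ideal [] (common_kernel K))"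
    proof -
      have "c = 0" if "sscale c 1 \<in> line_ideal [] (common_kernel K)" for c
        using line_ideal_apolar[OF that] by (simp add: cpoly_const_def)
      moreover have "\<exists>c :: nat \<Rightarrow> complex. f - sscale (c 0) 1 \<in> line_ideal [] (common_kernel K)"
        if "f \<in> subalgebra (common_kernel K)" for f
      proof -
        obtain c where "f - sscale c 1 \<in> line_ideal [] (common_kernel K)"
          using subalgebra_mod_line_ideal_Nil \<open>f \<in> subalgebra (common_kernel K)\<close> by blast
        then show ?thesis by (intro exI[of _ "\<lambda>_. c"])
      qed
      ultimately show ?thesis
        by (auto simp: mod_basis_def graded_part_def bidegree_part_one subalgebra.one)
    qed
    then show ?thesis using True Nil
      by (intro exI[of _ "\<lambda>_. 1"] exI[of _ 1]) (auto simp: whitney_Nil)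
  qed
next
  case (Cons a A)
  have ij: "i + j = int (length A) + 1" using Cons.prems by simp
  let ?W = "common_kernel K" and ?H = "common_kernel (a # K)"
  show ?case
  proof (cases "a \<in> vec.span (set K)")
    case True
    then have "\<not> nonzero_on ?W a" by (simp add: nonzero_on_common_kernel_iff)
    then have "int (length (filter (nonzero_on ?W) (a # A))) =
       int (length (filter (nonzero_on ?W) A))"
      by simp
    also have "\<dots> < i + j"
      using ij length_filter_le[of "nonzero_on ?W" A] by linarith
    finally have lt: "int (length (filter (nonzero_on ?W) (a # A))) < i + j" .
    have "f \<in> line_ideal (a # A) ?W" if "f \<in> graded_part ?W i j" for f
      using that line_ideal_above_top[OF subspace_common_kernel _ _ lt]
      by (simp only: graded_part_def mem_Collect_eq)
    then have "mod_basis (\<lambda>_. 0) 0 (graded_part ?W i j) (line_ideal (a # A) ?W)"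
      by (rule mod_basis_zero)
    then show ?thesis using whitney_Cons_loop[OF True] by (metis of_nat_0)
  next
    case False
    then obtain u where u: "u \<in> ?W" "dot a u = 1"
      using nonzero_on_unit[OF subspace_common_kernel] nonzero_on_common_kernel_iff by metis
    have H: "?H = {l \<in> ?W. dot a l = 0}" by (rule common_kernel_Cons)
    obtain e2 n2 where e2: "mod_basis e2 n2 (graded_part ?W (i - 1) j) (line_ideal A ?W)"
        "int n2 = whitney K A j"
      using Cons.IH[of "i - 1" j K] ij by auto
    obtain e1 n1 where e1: "mod_basis e1 n1 (graded_part ?H i (j - 1)) (line_ideal A ?H)"
        "int n1 = whitney (a # K) A (j - 1)"
      using Cons.IH[of i "j - 1" "a # K"] ij by auto
    \<comment> \<open>Basis elements of the deletion are lifted through the derivative; passing to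
      the bihomogeneous part keeps the lift in the required degree.\<close>
    have "\<exists>F. F \<in> graded_part ?W i j \<and> dir_deriv a F = e2 k" if "k < n2" for k
    proof -
      have k: "e2 k \<in> subalgebra ?W" "bidegree_part (i - 1) j (e2 k) = e2 k"
        using e2(1) that by (auto simp: mod_basis_def graded_part_def)
      obtain F where F: "F \<in> subalgebra ?W" "dir_deriv a (lform u * F) = e2 k"
        using dir_deriv_antiderivative[of u ?W a "e2 k" 0] u k by auto
      have "dir_deriv a (bidegree_part i j (lform u * F)) = e2 k"
        using bidegree_part_dir_deriv[of "i - 1" j a "lform u * F"] k F by simp
      moreover have "bidegree_part i j (lform u * F) \<in> graded_part ?W i j"
        using F(1) u
          by (auto simp: graded_part_def intro: subalgebra_bidegree_part subalgebra.lform)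
      ultimately show ?thesis by blast
    qed
    then obtain F where F: "\<And>k. k < n2 \<Longrightarrow> F k \<in> graded_part ?W i j"
        "\<And>k. k < n2 \<Longrightarrow> dir_deriv a (F k) = e2 k"
      by metis
    have e1H: "e1 k \<in> subalgebra ?H" "bidegree_part i (j - 1) (e1 k) = e1 k" if "k < n1" for k
      using e1(1) that by (auto simp: mod_basis_def graded_part_def)
    have HW: "?H \<subseteq> ?W" by (auto simp: H)
    \<comment> \<open>Lifts from the deletion, followed by images of the restriction under
      multiplication with \<open>dform u\<close>.\<close>
    define e where "e k = (if k < n2 then F k else dform u * e1 (k - n2))" for k
    have split: "(\<Sum>k<n2 + n1. sscale (c k) (e k)) =
        (\<Sum>k<n2. sscale (c k) (F k)) + dform u * (\<Sum>k<n1. sscale (c (n2 + k)) (e1 k))" for c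
      unfolding sum_lessThan_add by (simp add: e_def sum_distrib_left sscale_mult_right)
    have DF: "dir_deriv a (\<Sum>k<n2. sscale (c k) (F k)) = (\<Sum>k<n2. sscale (c k) (e2 k))" for c
      using F(2) by (simp add: dir_deriv_sum dir_deriv_scale)
    have zeroH: "dir_deriv a y = 0" "contraction a y = 0" if "y \<in> subalgebra ?H" for y
      using that dir_deriv_subalgebra_kernel[OF that, of a] contraction_subalgebra_kernel[OF that, of a]
      by (auto simp: H)
    have mem: "e k \<in> graded_part ?W i j" if "k < n2 + n1" for k
    proof (cases "k < n2")
      case True
      then show ?thesis using F(1) by (simp add: e_def)
    next
      case False
      then have "e1 (k - n2) \<in> subalgebra ?W" "bidegree_part i (j - 1) (e1 (k - n2)) = e1 (k - n2)"
        using e1H[of "k - n2"] that subalgebra_mono[OF _ HW] by auto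
      then show ?thesis
        using False u
          by (auto simp: e_def graded_part_def bidegree_part_dform intro: subalgebra.dform)
    qed
    have indep: "\<forall>k<n2 + n1. c k = 0" if c: "(\<Sum>k<n2 + n1. sscale (c k) (e k)) \<in> line_ideal (a # A) ?W" for c
    proof -
      define y where "y = (\<Sum>k<n1. sscale (c (n2 + k)) (e1 k))"
      have y: "y \<in> graded_part ?H i (j - 1)"
        unfolding y_def using e1(1) by (intro graded_part_sum) (auto simp: mod_basis_def)
      \<comment> \<open>The derivative kills the second block, so independence in the deletion makes
        the first block of coefficients vanish.\<close>
      have "dir_deriv a (\<Sum>k<n2 + n1. sscale (c k) (e k)) \<in> line_ideal A ?W"
        using c by (rule line_ideal_dir_deriv)
      moreover have "dir_deriv a (\<Sum>k<n2 + n1. sscale (c k) (e k)) = (\<Sum>k<n2. sscale (c k) (e2 k))"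
        unfolding split dir_deriv_add DF y_def[symmetric] dir_deriv_dform
        using zeroH(1)[of y] y by (simp add: graded_part_def)
      ultimately have c2: "c k = 0" if "k < n2" for k
        using e2(1) that by (auto simp: mod_basis_def)
      then have "dform u * y \<in> line_ideal (a # A) ?W"
        using c unfolding split y_def[symmetric] by simp
      \<comment> \<open>Passing through \<open>apolar\<close> forgets the flat, which allows the
        return to the ideal over the smaller one.\<close>
      then have "apolar A (contraction a (dform u * y))" using line_ideal_apolar by fastforce
      moreover have "contraction a (dform u * y) = y"
        using zeroH(2)[of y] y u by (simp add: contraction_dform graded_part_def)
      ultimately have "y \<in> line_ideal A ?H"
        using apolar_top[OF subspace_common_kernel, of y "a # K" i "j - 1" A] y ij
        by (auto simp: graded_part_def)
      then have c1: "c (n2 + k) = 0" if "k < n1" for k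
        using e1(1) that unfolding y_def mod_basis_def by (metis (mono_tags))
      show ?thesis
      proof (intro allI impI)
        fix k assume "k < n2 + n1"
        then show "c k = 0" using c2[of k] c1[of "k - n2"] by (cases "k < n2") auto
      qed
    qed
    have spanning: "\<exists>c. f - (\<Sum>k<n2 + n1. sscale (c k) (e k)) \<in> line_ideal (a # A) ?W"
      if f: "f \<in> graded_part ?W i j" for f
    proof -
      have "dir_deriv a f \<in> graded_part ?W (i - 1) j"
        using f by (auto simp: graded_part_def bidegree_part_dir_deriv intro: subalgebra_dir_deriv)
      then obtain c2 where c2: "dir_deriv a f - (\<Sum>k<n2. sscale (c2 k) (e2 k)) \<in> line_ideal A ?W"
        using e2(1) unfolding mod_basis_def by blast
      define f' where "f' = f - (\<Sum>k<n2. sscale (c2 k) (F k))"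
      have FW: "(\<Sum>k<n2. sscale (c2 k) (F k)) \<in> graded_part ?W i j"
        using F(1) by (intro graded_part_sum) auto
      have f': "f' \<in> subalgebra ?W" "bidegree_part i j f' = f'" "dir_deriv a f' \<in> line_ideal A ?W"
        using f FW c2
          by (auto simp: f'_def graded_part_def bidegree_part_diff dir_deriv_diff DF intro: subalgebra_diff)
      obtain g b c where gbc: "g \<in> line_ideal (a # A) ?W" "b \<in> subalgebra ?H" "bidegree_part i j b = b"
          "c \<in> subalgebra ?H" "bidegree_part i (j - 1) c = c" "f' = g + b + dform u * c"
        using line_ideal_split[OF subspace_common_kernel u f'] unfolding H by blast
      \<comment> \<open>\<open>b\<close> has total degree one more than \<open>length A\<close>,
        hence it is already in the ideal of the restriction.\<close>
      have "int (length (filter (nonzero_on ?H) A)) < i + j"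
        using ij length_filter_le[of "nonzero_on ?H" A] by linarith
      then have "b \<in> line_ideal A ?H"
        by (rule line_ideal_above_top[OF subspace_common_kernel gbc(2,3)])
      then have b: "b \<in> line_ideal (a # A) ?W"
        by (rule line_ideal_mono_subspace) (auto simp: H)
      have "c \<in> graded_part ?H i (j - 1)" using gbc(4,5) by (simp add: graded_part_def)
      then obtain c1 where "c - (\<Sum>k<n1. sscale (c1 k) (e1 k)) \<in> line_ideal A ?H"
        using e1(1) unfolding mod_basis_def by blast
      then have "c - (\<Sum>k<n1. sscale (c1 k) (e1 k)) \<in> line_ideal (a # A) ?W"
        by (rule line_ideal_mono_subspace) (auto simp: H)
      then have c1: "dform u * (c - (\<Sum>k<n1. sscale (c1 k) (e1 k))) \<in> line_ideal (a # A) ?W"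
        using u(1) by (rule line_ideal_times_dform)
      define d where "d k = (if k < n2 then c2 k else c1 (k - n2))" for k
      have "(\<Sum>k<n2 + n1. sscale (d k) (e k)) =
          (\<Sum>k<n2. sscale (c2 k) (F k)) + dform u * (\<Sum>k<n1. sscale (c1 k) (e1 k))"
        unfolding split by (simp add: d_def)
      then have "f - (\<Sum>k<n2 + n1. sscale (d k) (e k)) =
          g + b + dform u * (c - (\<Sum>k<n1. sscale (c1 k) (e1 k)))"
        using gbc(6) by (simp add: f'_def right_diff_distrib algebra_simps)
      then show ?thesis using gbc(1) b c1 line_ideal_add by metis
    qed
    have "mod_basis e (n2 + n1) (graded_part ?W i j) (line_ideal (a # A) ?W)"
      unfolding mod_basis_def using mem indep spanning by blast
    moreover have "int (n2 + n1) = whitney K (a # A) j"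
      using e2(2) e1(2) whitney_Cons[OF False] by simp
    ultimately show ?thesis by blast
  qed
qed

section \<open>From hyperplanes to linear forms\<close>

text \<open>Any choice of normal form will do, because only the zero sets and the spans of the forms
  enter below.\<close>

definition form_list :: "(complex ^ 'n::finite) set list \<Rightarrow> (complex ^ 'n) list" where
  "form_list \<A> = map (\<lambda>H. SOME a. a \<in> normal_forms H) \<A>"

lemma length_form_list [simp]: "length (form_list \<A>) = length \<A>"
  by (simp add: form_list_def)

lemma dot_commute: "dot a b = dot b a"
  by (simp add: dot_def mult.commute)

lemma normal_forms_dot: "normal_forms H = {a. H = {v. dot a v = 0}}"
  by (simp add: normal_forms_def dot_def)

text \<open>The annihilator argument is applied with forms and vectors exchanged: a vector
  \<open>b\<close> outside \<open>H\<close> is detected by some \<open>u\<close> that pairs to zero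
  with a basis of \<open>H\<close>, and this \<open>u\<close> is the normal.\<close>

lemma linear_hyperplane_normal_form:
  fixes H :: "(complex ^ 'n::finite) set"
  assumes "linear_hyperplane H"
  shows "\<exists>a. a \<in> normal_forms H"
proof -
  have sub: "vec.subspace H" and dim: "vec.dim H + 1 = CARD('n)"
    using assms by (auto simp: linear_hyperplane_def)
  obtain B where B: "B \<subseteq> H" "vec.independent B" "H \<subseteq> vec.span B" "card B = vec.dim H"
    using vec.basis_exists[of H] by blast
  have "finite B" using B(2) by (rule vec.finiteI_independent)
  then obtain K where K: "set K = B" using finite_list by blast
  have HK: "H = vec.span (set K)"
    using B(1,3) sub K by (simp add: vec.span_minimal subset_antisym)
  have span: "vec.span H = H" using sub by (simp add: vec.span_eq_iff)
  have "H \<noteq> UNIV" using dim vec_dim_card[where 'a = complex and 'n = 'n] by auto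
  then obtain b where b: "b \<notin> vec.span (set K)" using HK by auto
  then obtain u where u: "u \<in> common_kernel K" "dot b u \<noteq> 0"
    using span_of_common_kernel[of K b] by blast
  have "dot u v = 0" if "v \<in> H" for v
    using that unfolding HK
  proof (induction v rule: vec.span_induct_alt)
    case base
    then show ?case by simp
  next
    case (step c x y)
    then have "dot u x = 0" using u(1) by (simp add: common_kernel_def dot_commute[of u])
    then show ?case using step by (simp add: dot_add_right dot_scale_right)
  qed
  moreover have "v \<in> H" if v: "dot u v = 0" for v
  proof (rule ccontr)
    assume "v \<notin> H"
    \<comment> \<open>Together with \<open>H\<close> such a \<open>v\<close> would span everything,
      including \<open>b\<close>, at which \<open>u\<close> is nonzero.\<close>
    then have "vec.dim (insert v H) = CARD('n)"
      using dim vec.dim_insert[of v H] span by simp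
    then have "b \<in> vec.span (insert v H)"
      using vec.dim_eq_span[of "insert v H" UNIV] vec_dim_card[where 'a = complex and 'n = 'n]
      by simp
    then obtain c where "b - c *s v \<in> vec.span H"
      by (auto simp: vec.span_breakdown_eq)
    then have "b - c *s v \<in> H" using span by simp
    then have "dot u (b - c *s v) = 0" using calculation by blast
    then show False using u(2) v by (simp add: dot_diff_right dot_scale_right dot_commute)
  qed
  ultimately show ?thesis by (auto simp: normal_forms_dot)
qed

lemma form_list_nth:
  assumes "multiarrangement \<A>" "i < length \<A>"
  shows "\<A> ! i = {v. dot (form_list \<A> ! i) v = 0}" "form_list \<A> ! i \<in> normal_forms (\<A> ! i)"
    "form_list \<A> ! i \<noteq> 0"
proof -
  have lin: "linear_hyperplane (\<A> ! i)"
    using assms by (simp add: multiarrangement_def)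
  have "(SOME a. a \<in> normal_forms (\<A> ! i)) \<in> normal_forms (\<A> ! i)"
    using linear_hyperplane_normal_form[OF lin] by (rule someI_ex)
  then show nf: "form_list \<A> ! i \<in> normal_forms (\<A> ! i)"
    using assms(2) by (simp add: form_list_def)
  then show eq: "\<A> ! i = {v. dot (form_list \<A> ! i) v = 0}"
    by (simp add: normal_forms_dot)
  show "form_list \<A> ! i \<noteq> 0"
  proof
    assume "form_list \<A> ! i = 0"
    then have "\<A> ! i = UNIV" using eq by simp
    then show False using lin vec_dim_card[where 'a = complex and 'n = 'a]
      by (simp add: linear_hyperplane_def)
  qed
qed

lemma rho_eq_num_nonzero:
  assumes "multiarrangement \<A>"
  shows "rho \<A> (vec.span {l}) = num_nonzero (form_list \<A>) l"
proof -
  have "vec.span {l} \<subseteq> \<A> ! i \<longleftrightarrow> dot (form_list \<A> ! i) l = 0" if "i < length \<A>" for i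
  proof
    assume "vec.span {l} \<subseteq> \<A> ! i"
    then have "l \<in> \<A> ! i" using vec.span_base[of l "{l}"] by auto
    then show "dot (form_list \<A> ! i) l = 0" using form_list_nth(1)[OF assms that] by auto
  next
    assume "dot (form_list \<A> ! i) l = 0"
    then have "k *s l \<in> \<A> ! i" for k
      using form_list_nth(1)[OF assms that] by (simp add: dot_scale_right)
    then show "vec.span {l} \<subseteq> \<A> ! i" by (auto simp: vec.span_singleton)
  qed
  then show ?thesis
    unfolding rho_def num_nonzero_def length_filter_conv_card length_form_list
    by (intro arg_cong[of _ _ card]) auto
qed

text \<open>Forms with the same kernel are proportional, so one chosen normal per hyperplane spans
  the same space as all of them.\<close>

lemma arr_rank_eq:
  assumes "multiarrangement \<A>" "S \<subseteq> {..<length \<A>}"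
  shows "arr_rank \<A> S = vec.dim (nth (form_list \<A>) ` S)"
proof -
  have "vec.span (\<Union>i\<in>S. normal_forms (\<A> ! i)) = vec.span (nth (form_list \<A>) ` S)"
  proof (intro subset_antisym vec.span_minimal vec.subspace_span subsetI)
    fix a assume "a \<in> (\<Union>i\<in>S. normal_forms (\<A> ! i))"
    then obtain i where i: "i \<in> S" "a \<in> normal_forms (\<A> ! i)" by blast
    then have "{v. dot a v = 0} = {v. dot (form_list \<A> ! i) v = 0}"
      using assms form_list_nth(1)[OF assms(1), of i] by (auto simp: normal_forms_dot)
    then have "a \<in> vec.span (set [form_list \<A> ! i])"
      by (intro span_of_common_kernel) (auto simp: common_kernel_def)
    then show "a \<in> vec.span (nth (form_list \<A>) ` S)"
      using i(1) vec.span_mono[of "{form_list \<A> ! i}" "nth (form_list \<A>) ` S"] by auto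
  next
    fix a assume "a \<in> nth (form_list \<A>) ` S"
    then show "a \<in> vec.span (\<Union>i\<in>S. normal_forms (\<A> ! i))"
      using form_list_nth(2)[OF assms(1)] assms(2) by (auto intro!: vec.span_base)
  qed
  then show ?thesis by (simp add: arr_rank_def)
qed

section \<open>Comparison of the ideals\<close>

lemma two_sided_ideal_generated: "two_sided_ideal (ideal_generated G)"
  by (auto simp: ideal_generated_def two_sided_ideal_def)

lemma ideal_generated_base: "g \<in> G \<Longrightarrow> g \<in> ideal_generated G"
  by (auto simp: ideal_generated_def)

lemma ideal_generated_minimal: "two_sided_ideal I \<Longrightarrow> G \<subseteq> I \<Longrightarrow> ideal_generated G \<subseteq> I"
  by (auto simp: ideal_generated_def)

text \<open>Each partial derivative is \<open>dir_deriv\<close> along a coordinate form, so the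
  power rule gives coefficients \<open>l $ i\<close> that reassemble to
  \<open>dform l\<close>.\<close>

lemma euler_lform_power: "euler (lform l ^ Suc k) = sscale (of_nat (Suc k)) (lform l ^ k * dform l)"
proof -
  have deriv: "superspace_deriv i f = dir_deriv (axis i 1) f" for i :: 'a and f
  proof (rule superspace_eqI)
    fix S
    have "(\<Sum>k\<in>UNIV. cpoly_const (axis i 1 $ k) * cpoly_deriv k (theta_coeff f S)) =
        (\<Sum>k\<in>UNIV. if k = i then cpoly_deriv i (theta_coeff f S) else 0)"
      by (rule sum.cong) (auto simp: axis_def)
    then show "theta_coeff (superspace_deriv i f) S = theta_coeff (dir_deriv (axis i 1) f) S"
      by (simp add: superspace_deriv_def dir_deriv_def)
  qed
  have dot: "dot (axis i 1) l = l $ i" for i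
  proof -
    have "dot (axis i 1) l = (\<Sum>k\<in>UNIV. if k = i then l $ i else 0)"
      unfolding dot_def by (rule sum.cong) (auto simp: axis_def)
    then show ?thesis by simp
  qed
  have "dir_deriv (axis i 1) (lform l ^ Suc k) =
     sscale (of_nat (Suc k) * l $ i) (lform l ^ k)" for i
    using dir_deriv_lform_power[of "axis i 1" l "Suc k" 1]
      by (simp add: dot del: power_Suc of_nat_Suc)
  then have "euler (lform l ^ Suc k) =
     (\<Sum>i\<in>UNIV. sscale (of_nat (Suc k) * l $ i) (lform l ^ k * theta i))"
    by (simp add: euler_def deriv sscale_mult_left del: power_Suc of_nat_Suc)
  then show ?thesis
    by (simp add: times_dform sscale_sum del: of_nat_Suc)
qed

text \<open>Left multiplication is checked on generators of superspace. On the right there is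
  nothing to move, since each generator of the ideal stands to the left of its coefficient.\<close>

lemma two_sided_ideal_line_ideal: "two_sided_ideal (line_ideal A UNIV)"
proof -
  have "a * f \<in> line_ideal A UNIV" if f: "f \<in> line_ideal A UNIV" for a f
    using subalgebra_UNIV[of a]
    by (induction a rule: subalgebra.induct)
      (auto simp: f distrib_right sscale_mult_left mult.assoc
        intro: line_ideal_add line_ideal_scale line_ideal_times_lform line_ideal_times_dform)
  moreover have "f * a \<in> line_ideal A UNIV" if "f \<in> line_ideal A UNIV" for a f
    using that
    by (induction f rule: line_ideal.induct)
      (auto simp: distrib_right mult.assoc subalgebra_UNIV simp del: power_Suc intro: line_ideal.intros)
  ultimately show ?thesis
    by (auto simp: two_sided_ideal_def intro: line_ideal.zero line_ideal_add)
qed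

lemma ideal_I_eq_line_ideal:
  assumes "multiarrangement \<A>"
  shows "ideal_I \<A> = line_ideal (form_list \<A>) UNIV"
proof
  let ?A = "form_list \<A>"
  note defs =
     ideal_I_def rho_eq_num_nonzero[OF assms] lform_eq_bosonic[symmetric] Suc_eq_plus1[symmetric] euler_lform_power
  show "ideal_I \<A> \<subseteq> line_ideal ?A UNIV"
    unfolding defs
  proof (rule ideal_generated_minimal[OF two_sided_ideal_line_ideal], intro Un_least subsetI)
    fix g assume "g \<in> {lform l ^ Suc (num_nonzero ?A l) |l. l \<noteq> 0}"
    then show "g \<in> line_ideal ?A UNIV"
      using line_ideal_lform_power[of _ UNIV 1 ?A "Suc (num_nonzero ?A _)"]
      by (auto simp: subalgebra_UNIV simp del: power_Suc)
  next
    fix g assume "g \<in> {sscale (of_nat (Suc (num_nonzero ?A l))) (lform l ^ num_nonzero ?A l * dform l) |l. l \<noteq> 0}"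
    then obtain l where g: "g =
       sscale (of_nat (Suc (num_nonzero ?A l))) (lform l ^ num_nonzero ?A l * dform l)" by blast
    show "g \<in> line_ideal ?A UNIV"
      using line_ideal_dform_lform_power[of l UNIV 1 ?A "num_nonzero ?A l"] unfolding g
      by (intro line_ideal_scale) (simp add: subalgebra_UNIV)
  qed
  show "line_ideal ?A UNIV \<subseteq> ideal_I \<A>"
  proof
    let ?G = "{lform l ^ Suc (num_nonzero ?A l) |l. l \<noteq> 0} \<union>
       {sscale (of_nat (Suc (num_nonzero ?A l))) (lform l ^ num_nonzero ?A l * dform l) |l. l \<noteq> 0}"
    have I: "two_sided_ideal (ideal_generated ?G)" by (rule two_sided_ideal_generated)
    fix f assume "f \<in> line_ideal ?A UNIV"
    then have "f \<in> ideal_generated ?G"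
    proof (induction f rule: line_ideal.induct)
      case zero
      then show ?case using I by (simp add: two_sided_ideal_def)
    next
      case (lform l f g)
      have "lform l ^ Suc (num_nonzero ?A l) \<in> ideal_generated ?G"
      \<comment> \<open>\<open>line_ideal\<close> also admits \<open>l = 0\<close>, which is not a
        line; the corresponding generator is zero.\<close>
      proof (cases "l = 0")
        case True
        then show ?thesis using I by (simp add: two_sided_ideal_def)
      next
        case False
        then show ?thesis by (intro ideal_generated_base) blast
      qed
      then show ?case using I lform.IH unfolding two_sided_ideal_def by blast
    next
      case (dform l f g)
      have "lform l ^ num_nonzero ?A l * dform l \<in> ideal_generated ?G"
      proof (cases "l = 0")
        case True
        then show ?thesis using I by (simp add: two_sided_ideal_def)
      next
        case False
        then have "sscale (of_nat (Suc (num_nonzero ?A l))) (lform l ^ num_nonzero ?A l * dform l) \<in> ideal_generated ?G"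
          by (intro ideal_generated_base) blast
        \<comment> \<open>The factor from differentiating the power is invertible in characteristic
          zero.\<close>
        then have "sscale (1 / of_nat (Suc (num_nonzero ?A l)))
            (sscale (of_nat (Suc (num_nonzero ?A l))) (lform l ^ num_nonzero ?A l * dform l)) \<in> ideal_generated ?G"
          using I unfolding two_sided_ideal_def sscale_def[of "1 / _"] by blast
        then show ?thesis by (simp del: of_nat_Suc)
      qed
      then have "lform l ^ num_nonzero ?A l * dform l * f \<in> ideal_generated ?G"
        using I unfolding two_sided_ideal_def by blast
      then show ?case
        using I dform.IH unfolding two_sided_ideal_def by (simp add: mult.assoc)
    qed
    then show "f \<in> ideal_I \<A>" unfolding defs .
  qed
qed

text \<open>An injective linear map that reflects the ideals carries independent sets to independent
  sets of the same size. It is used for the two extreme fermionic degrees.\<close>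

lemma quotient_dim_image:
  assumes inj: "inj \<phi>" and zero: "\<phi> 0 = 0" and add: "\<And>p q. \<phi> (p + q) = \<phi> p + \<phi> q"
    and scale: "\<And>c p. \<phi> (\<kappa> c * p) = \<kappa>' c * \<phi> p" and iff: "\<And>p. \<phi> p \<in> I' \<longleftrightarrow> p \<in> I"
  shows "quotient_dim \<kappa>' I' (\<phi> ` W) = quotient_dim \<kappa> I W"
proof -
  have sum: "\<phi> (\<Sum>b\<in>B. f b) = (\<Sum>b\<in>B. \<phi> (f b))" for B and f :: "'a \<Rightarrow> 'a"
    by (induction B rule: infinite_finite_induct) (auto simp: zero add)
  let ?P = "\<lambda>B. \<forall>c. (\<Sum>b\<in>B. \<kappa> (c b) * b) \<in> I \<longrightarrow> (\<forall>b\<in>B. c b = 0)"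
  let ?P' = "\<lambda>B. \<forall>c. (\<Sum>b\<in>B. \<kappa>' (c b) * b) \<in> I' \<longrightarrow> (\<forall>b\<in>B. c b = 0)"
  have P: "?P' (\<phi> ` B) \<longleftrightarrow> ?P B" for B
  proof -
    have "(\<Sum>b\<in>\<phi> ` B. \<kappa>' (c b) * b) = \<phi> (\<Sum>b\<in>B. \<kappa> (c (\<phi> b)) * b)" for c
      unfolding sum scale using inj by (subst sum.reindex) (auto simp: inj_on_def)
    then have *: "?P' (\<phi> ` B) \<longleftrightarrow> (\<forall>c. (\<Sum>b\<in>B. \<kappa> (c (\<phi> b)) * b) \<in> I \<longrightarrow> (\<forall>b\<in>B. c (\<phi> b) = 0))"
      by (simp add: iff)
    show ?thesis
    proof
      assume l: "?P' (\<phi> ` B)"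
      show "?P B"
      proof (intro allI impI)
        fix c assume "(\<Sum>b\<in>B. \<kappa> (c b) * b) \<in> I"
        then show "\<forall>b\<in>B. c b = 0"
          \<comment> \<open>Coefficients indexed by \<open>B\<close> are transferred to its image
            through the inverse of the injection.\<close>
          using l[unfolded *, rule_format, of "\<lambda>y. c (inv \<phi> y)"] inj by (simp add: inv_f_f)
      qed
    next
      assume P: "?P B"
      show "?P' (\<phi> ` B)" unfolding *
      proof
        fix c
        show "(\<Sum>b\<in>B. \<kappa> (c (\<phi> b)) * b) \<in> I \<longrightarrow> (\<forall>b\<in>B. c (\<phi> b) = 0)"
          using P[rule_format, of "\<lambda>b. c (\<phi> b)"] by blast
      qed
    qed
  qed
  have "{card B | B. finite B \<and> B \<subseteq> \<phi> ` W \<and> ?P' B} = {card B | B. finite B \<and> B \<subseteq> W \<and> ?P B}"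
  proof (intro equalityI subsetI)
    fix n assume "n \<in> {card B | B. finite B \<and> B \<subseteq> \<phi> ` W \<and> ?P' B}"
    then obtain B where B: "n = card B" "finite B" "B \<subseteq> \<phi> ` W" "?P' B" by blast
    obtain C where C: "C \<subseteq> W" "B = \<phi> ` C"
      using B(3) by (auto simp: subset_image_iff)
    have "finite C" using B(2) C(2) inj finite_imageD inj_on_subset by blast
    moreover have "n = card C" using B(1) C(2) card_image[of \<phi> C] inj inj_on_subset
      by (metis subset_UNIV)
    moreover have "?P C" using B(4) P C(2) by simp
    ultimately show "n \<in> {card B | B. finite B \<and> B \<subseteq> W \<and> ?P B}" using C(1) by blast
  next
    fix n assume "n \<in> {card B | B. finite B \<and> B \<subseteq> W \<and> ?P B}"
    then obtain B where B: "n = card B" "finite B" "B \<subseteq> W" "?P B" by blast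
    have "n = card (\<phi> ` B)" using B(1) card_image[of \<phi> B] inj inj_on_subset by (metis subset_UNIV)
    moreover have "?P' (\<phi> ` B)" using B(4) P by simp
    ultimately show "n \<in> {card B | B. finite B \<and> B \<subseteq> \<phi> ` W \<and> ?P' B}"
      using B(2,3) by blast
  qed
  then show ?thesis by (simp add: quotient_dim_def)
qed

lemma theta_coeff_lform_power_times:
  "theta_coeff (lform l ^ k * f) S = line_form l ^ k * theta_coeff f S"
  by (simp add: lform_eq_bosonic bosonic_power[symmetric])

text \<open>Multiples of \<open>dform l\<close> have no coefficient at the empty word, so only the
  generators with exponent raised by one are visible there.\<close>

lemma bosonic_in_line_ideal_iff:
  fixes \<A> :: "(complex ^ 'n::{finite,linorder}) set list"
  assumes "multiarrangement \<A>"
  shows "bosonic p \<in> line_ideal (form_list \<A>) UNIV \<longleftrightarrow> p \<in> ideal_J \<A> 1"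
proof
  let ?I = "line_ideal (form_list \<A>) UNIV"
  let ?G = "{line_form l ^ (num_nonzero (form_list \<A>) l + 1) |l. l \<noteq> 0}"
  have J: "ideal_J \<A> 1 = ideal_generated ?G"
    by (simp add: ideal_J_def rho_eq_num_nonzero[OF assms])
  have JI: "two_sided_ideal (ideal_J \<A> 1)" unfolding J by (rule two_sided_ideal_generated)
  assume "bosonic p \<in> ?I"
  moreover have "theta_coeff f {} \<in> ideal_J \<A> 1" if "f \<in> ?I" for f
    using that
  proof (induction f rule: line_ideal.induct)
    case zero
    then show ?case using JI by (simp add: two_sided_ideal_def)
  next
    case (lform l f g)
    have "line_form l ^ Suc (num_nonzero (form_list \<A>) l) \<in> ideal_J \<A> 1"
    proof (cases "l = 0")
      case True
      then show ?thesis using JI by (simp add: two_sided_ideal_def line_form_def)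
    next
      case False
      then show ?thesis unfolding J by (intro ideal_generated_base) auto
    qed
    then show ?case
      using JI lform.IH unfolding two_sided_ideal_def
      by (simp add: theta_coeff_lform_power_times del: power_Suc)
  next
    case (dform l f g)
    have "theta_coeff (dform l * f) {} = 0"
      by (simp add: dform_times theta_coeff_sum theta_coeff_theta_times)
    then show ?case using dform.IH by (simp add: theta_coeff_lform_power_times)
  qed
  ultimately have "theta_coeff (bosonic p) {} \<in> ideal_J \<A> 1" by blast
  then show "p \<in> ideal_J \<A> 1" by (simp add: theta_coeff_bosonic)
next
  let ?I = "line_ideal (form_list \<A>) UNIV"
  let ?G = "{line_form l ^ (num_nonzero (form_list \<A>) l + 1) |l. l \<noteq> 0}"
  have J: "ideal_J \<A> 1 = ideal_generated ?G"
    by (simp add: ideal_J_def rho_eq_num_nonzero[OF assms])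
  have "two_sided_ideal {p. bosonic p \<in> ?I}"
    using two_sided_ideal_line_ideal[of "form_list \<A>"]
    by (auto simp: two_sided_ideal_def bosonic_add bosonic_mult)
  moreover have "?G \<subseteq> {p. bosonic p \<in> ?I}"
    using line_ideal_lform_power[of _ UNIV 1 "form_list \<A>" "num_nonzero (form_list \<A>) _ + 1"]
    by (auto simp: bosonic_power lform_eq_bosonic subalgebra_UNIV simp del: power_Suc)
  ultimately have "ideal_J \<A> 1 \<subseteq> {p. bosonic p \<in> ?I}"
    unfolding J by (rule ideal_generated_minimal)
  then show "p \<in> ideal_J \<A> 1 \<Longrightarrow> bosonic p \<in> ?I" by blast
qed

definition top_form :: "'n cpoly \<Rightarrow> ('n::{finite,linorder}) superspace" where
  "top_form p = Superspace (\<lambda>S. if S = UNIV then p else 0)"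

lemma theta_coeff_top_form: "theta_coeff (top_form p) S = (if S = UNIV then p else 0)"
  by (simp add: top_form_def)

lemma top_form_times: "top_form (p * q) = bosonic p * top_form q"
  by (rule superspace_eqI) (simp add: theta_coeff_top_form)

text \<open>All coefficients of the ideal lie in \<open>ideal_J \<A> 0\<close>. Conversely, the
  differential of a nonzero \<open>l\<close> divides the product of all theta variables, so the
  generator with the smaller exponent reaches the top word.\<close>

lemma top_form_in_line_ideal_iff:
  fixes \<A> :: "(complex ^ 'n::{finite,linorder}) set list"
  assumes "multiarrangement \<A>"
  shows "top_form p \<in> line_ideal (form_list \<A>) UNIV \<longleftrightarrow> p \<in> ideal_J \<A> 0"
proof
  let ?I = "line_ideal (form_list \<A>) UNIV"
  let ?G = "{line_form l ^ num_nonzero (form_list \<A>) l |l. l \<noteq> 0}"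
  have J: "ideal_J \<A> 0 = ideal_generated ?G"
    by (simp add: ideal_J_def rho_eq_num_nonzero[OF assms])
  have JI: "two_sided_ideal (ideal_J \<A> 0)" unfolding J by (rule two_sided_ideal_generated)
  have gen: "line_form l ^ num_nonzero (form_list \<A>) l \<in> ideal_J \<A> 0" if "l \<noteq> 0" for l
    using that unfolding J by (intro ideal_generated_base) auto
  assume "top_form p \<in> ?I"
  moreover have "\<forall>S. theta_coeff f S \<in> ideal_J \<A> 0" if "f \<in> ?I" for f
    using that
  proof (induction f rule: line_ideal.induct)
    case zero
    then show ?case using JI by (simp add: two_sided_ideal_def)
  next
    case (lform l f g)
    have "line_form l ^ Suc (num_nonzero (form_list \<A>) l) \<in> ideal_J \<A> 0"
    proof (cases "l = 0")
      case True
      then show ?thesis using JI by (simp add: two_sided_ideal_def line_form_def)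
    next
      case False
      then show ?thesis using gen JI by (simp add: two_sided_ideal_def)
    qed
    then show ?case
      using JI lform.IH unfolding two_sided_ideal_def
      by (simp add: theta_coeff_lform_power_times del: power_Suc)
  next
    case (dform l f g)
    have "line_form l ^ num_nonzero (form_list \<A>) l * theta_coeff (dform l * f) S \<in> ideal_J \<A> 0" for S
    proof (cases "l = 0")
      case True
      then show ?thesis using JI by (simp add: two_sided_ideal_def)
    next
      case False
      then show ?thesis using gen JI by (simp add: two_sided_ideal_def)
    qed
    then show ?case
      using JI dform.IH unfolding two_sided_ideal_def
      by (simp add: theta_coeff_lform_power_times)
  qed
  ultimately have "theta_coeff (top_form p) UNIV \<in> ideal_J \<A> 0" by blast
  then show "p \<in> ideal_J \<A> 0" by (simp add: theta_coeff_top_form)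
next
  let ?I = "line_ideal (form_list \<A>) UNIV"
  let ?G = "{line_form l ^ num_nonzero (form_list \<A>) l |l. l \<noteq> 0}"
  have J: "ideal_J \<A> 0 = ideal_generated ?G"
    by (simp add: ideal_J_def rho_eq_num_nonzero[OF assms])
  have I: "two_sided_ideal ?I" by (rule two_sided_ideal_line_ideal)
  have zero: "top_form 0 = (0 :: 'n superspace)"
    by (rule superspace_eqI) (simp add: theta_coeff_top_form)
  have add: "top_form (p + q) = top_form p + top_form q" for p q :: "'n cpoly"
    by (rule superspace_eqI) (simp add: theta_coeff_top_form)
  have "two_sided_ideal {p. top_form p \<in> ?I}"
    using I
      by (auto simp: two_sided_ideal_def zero add top_form_times mult.commute[of "_ :: 'n cpoly"])
  moreover have "top_form (line_form l ^ num_nonzero (form_list \<A>) l) \<in> ?I" if l: "l \<noteq> 0" for l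
  proof -
    obtain i where i: "l $ i \<noteq> 0" using l vec_eq_iff[of l 0] by auto
    \<comment> \<open>The word lacking \<open>theta i\<close>, divided by the nonzero coordinate
      \<open>l $ i\<close>; the sign undoes the sorting, and the other summands of
      \<open>dform l\<close> repeat a variable.\<close>
    define f where "f = Superspace (\<lambda>S. if S = UNIV - {i}
        then cpoly_const (1 / l $ i) * theta_sign {i} (UNIV - {i}) else 0)"
    have "dform l * f = top_form 1"
    proof (rule superspace_eqI)
      fix S
      have "theta_coeff (dform l * f) S = (\<Sum>k\<in>UNIV. cpoly_const (l $ k) *
          (if k \<in> S then theta_sign {k} (S - {k}) * theta_coeff f (S - {k}) else 0))"
        by (simp add: dform_times theta_coeff_sum theta_coeff_theta_times)
      also have "\<dots> = (\<Sum>k\<in>UNIV. if k = i then if S = UNIV then 1 else 0 else 0)"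
      proof (rule sum.cong[OF refl])
        fix k
        have "k \<in> S \<and> S - {k} = UNIV - {i} \<longleftrightarrow> k = i \<and> S = UNIV" by auto
        moreover have "cpoly_const (l $ i) * (theta_sign {i} (UNIV - {i}) *
            (cpoly_const (1 / l $ i) * theta_sign {i} (UNIV - {i}))) = 1"
        proof -
          have "cpoly_const (l $ i) * (theta_sign {i} (UNIV - {i}) *
              (cpoly_const (1 / l $ i) * theta_sign {i} (UNIV - {i}))) =
              cpoly_const (l $ i * (1 / l $ i)) *
              (theta_sign {i} (UNIV - {i}) * theta_sign {i} (UNIV - {i}))"
            by (simp only: cpoly_const_mult ac_simps)
          then show ?thesis using i by (simp add: theta_sign_square)
        qed
        ultimately show "cpoly_const (l $ k) *
            (if k \<in> S then theta_sign {k} (S - {k}) * theta_coeff f (S - {k}) else 0) =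
            (if k = i then if S = UNIV then 1 else 0 else 0)"
          by (auto simp: f_def)
      qed
      finally show "theta_coeff (dform l * f) S = theta_coeff (top_form 1) S"
        by (simp add: theta_coeff_top_form)
    qed
    moreover have "lform l ^ num_nonzero (form_list \<A>) l * (dform l * f) \<in> ?I"
      by (rule line_ideal_dform_lform_power) (auto simp: subalgebra_UNIV)
    ultimately show ?thesis
      using top_form_times[of "line_form l ^ num_nonzero (form_list \<A>) l" 1]
      by (simp add: lform_eq_bosonic bosonic_power)
  qed
  ultimately have "ideal_J \<A> 0 \<subseteq> {p. top_form p \<in> ?I}"
    unfolding J by (intro ideal_generated_minimal) auto
  then show "p \<in> ideal_J \<A> 0 \<Longrightarrow> top_form p \<in> ?I" by blast
qed

section \<open>Hilbert series in the lowest and highest fermionic degree\<close>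

lemma superspace_homogeneous_eq: "superspace_homogeneous i j = graded_part UNIV (int i) (int j)"
proof -
  have "f \<in> superspace_homogeneous i j \<longleftrightarrow> bidegree_part (int i) (int j) f =
     f" for f :: "'a superspace"
  proof -
    have "bidegree_part (int i) (int j) f = f \<longleftrightarrow>
       (\<forall>S. theta_coeff (bidegree_part (int i) (int j) f) S = theta_coeff f S)"
      using superspace_eqI by metis
    also have "\<dots> \<longleftrightarrow> (\<forall>S. theta_coeff f S \<in> cpoly_homogeneous i \<and> (card S \<noteq> j \<longrightarrow> theta_coeff f S = 0))"
    proof (intro iff_allI)
      fix S
      have "0 \<in> cpoly_homogeneous i" by (simp add: cpoly_homogeneous_def)
      then show "theta_coeff (bidegree_part (int i) (int j) f) S = theta_coeff f S \<longleftrightarrow>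
          theta_coeff f S \<in> cpoly_homogeneous i \<and> (card S \<noteq> j \<longrightarrow> theta_coeff f S = 0)"
        by (auto simp: bidegree_part_def cpoly_component_eq_iff)
    qed
    finally show ?thesis by (simp add: superspace_homogeneous_def)
  qed
  then show ?thesis by (auto simp: graded_part_def subalgebra_UNIV)
qed

lemma homogeneous_fermionic_degree_0: "superspace_homogeneous i 0 = bosonic ` cpoly_homogeneous i"
proof (intro equalityI subsetI)
  fix f :: "'a superspace" assume f: "f \<in> superspace_homogeneous i 0"
  then have "f = bosonic (theta_coeff f {})"
    by (intro superspace_eqI) (auto simp: superspace_homogeneous_def theta_coeff_bosonic)
  then show "f \<in> bosonic ` cpoly_homogeneous i"
    using f by (auto simp: superspace_homogeneous_def)
next
  fix f :: "'a superspace" assume "f \<in> bosonic ` cpoly_homogeneous i"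
  then show "f \<in> superspace_homogeneous i 0"
    by (auto simp: superspace_homogeneous_def theta_coeff_bosonic cpoly_homogeneous_def split: if_splits)
qed

lemma homogeneous_fermionic_degree_top:
  "superspace_homogeneous i CARD('n) =
     (top_form :: 'n::{finite,linorder} cpoly \<Rightarrow> _) ` cpoly_homogeneous i"
proof (intro equalityI subsetI)
  fix f :: "'n superspace" assume f: "f \<in> superspace_homogeneous i CARD('n)"
  have "card S \<noteq> CARD('n)" if "S \<noteq> UNIV" for S :: "'n set"
    using that card_subset_eq[of UNIV S] by auto
  then have "f = top_form (theta_coeff f UNIV)"
    using f by (intro superspace_eqI) (auto simp: superspace_homogeneous_def theta_coeff_top_form)
  then show "f \<in> top_form ` cpoly_homogeneous i"
    using f by (auto simp: superspace_homogeneous_def)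
next
  fix f :: "'n superspace" assume "f \<in> top_form ` cpoly_homogeneous i"
  then show "f \<in> superspace_homogeneous i CARD('n)"
    by (auto simp: superspace_homogeneous_def theta_coeff_top_form cpoly_homogeneous_def split: if_splits)
qed

lemma hilb_fermionic_degree_0:
  assumes "multiarrangement \<A>"
  shows "fps_nth (hilb_superspace_quotient (ideal_I \<A>)) 0 = hilb_cpoly_quotient (ideal_J \<A> 1)"
proof -
  have "quotient_dim superspace_const (ideal_I \<A>) (bosonic ` cpoly_homogeneous i) =
      quotient_dim cpoly_const (ideal_J \<A> 1) (cpoly_homogeneous i)" for i
  proof (rule quotient_dim_image)
    show "inj (bosonic :: 'a cpoly \<Rightarrow> 'a superspace)"
      by (rule injI) (metis theta_coeff_bosonic)
  qed (simp_all add: bosonic_add bosonic_mult superspace_const_def ideal_I_eq_line_ideal[OF assms]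
      bosonic_in_line_ideal_iff[OF assms])
  then show ?thesis
    by (simp add: hilb_superspace_quotient_def hilb_cpoly_quotient_def homogeneous_fermionic_degree_0)
qed

text \<open>This gives the second assertion for full rank. For smaller rank
  \<open>ideal_J \<A> 0\<close> is the unit ideal, yet the coefficient of \<open>t^r\<close> is not
  zero: for the empty arrangement the superspace quotient is the field of scalars.\<close>

lemma hilb_fermionic_degree_top:
  fixes \<A> :: "(complex ^ 'n::{finite,linorder}) set list"
  assumes "multiarrangement \<A>"
  shows "fps_nth (hilb_superspace_quotient (ideal_I \<A>)) CARD('n) =
     hilb_cpoly_quotient (ideal_J \<A> 0)"
proof -
  have "quotient_dim superspace_const (ideal_I \<A>) (top_form ` cpoly_homogeneous i) =
      quotient_dim cpoly_const (ideal_J \<A> 0) (cpoly_homogeneous i)" for i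
  proof (rule quotient_dim_image)
    show "inj (top_form :: 'n cpoly \<Rightarrow> 'n superspace)"
      by (rule injI) (metis theta_coeff_top_form)
    show "top_form 0 = (0 :: 'n superspace)"
      by (rule superspace_eqI) (simp add: theta_coeff_top_form)
    show "top_form (p + q) = top_form p + top_form q" for p q :: "'n cpoly"
      by (rule superspace_eqI) (simp add: theta_coeff_top_form)
  qed (simp_all add: top_form_times superspace_const_def ideal_I_eq_line_ideal[OF assms]
      top_form_in_line_ideal_iff[OF assms])
  then show ?thesis
    by (simp add: hilb_superspace_quotient_def hilb_cpoly_quotient_def homogeneous_fermionic_degree_top)
qed

section \<open>The part of maximal total degree\<close>

lemma graded_part_total_degree:
  assumes "multiarrangement \<A>" "i + j = length \<A>"
  shows "int (quotient_dim superspace_const (ideal_I \<A>) (superspace_homogeneous i j)) =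
    whitney [] (form_list \<A>) (int j)"
proof -
  obtain e n where e: "mod_basis e n (graded_part UNIV (int i) (int j)) (line_ideal (form_list \<A>) UNIV)"
    and n: "int n = whitney [] (form_list \<A>) (int j)"
    using mod_basis_top[of "int i" "int j" "form_list \<A>" "[]"] assms(2) by auto
  then show ?thesis
    using quotient_dim_eq[OF lin_closed_line_ideal e] n
    by (simp add: ideal_I_eq_line_ideal[OF assms(1)] superspace_homogeneous_eq)
qed

lemma graded_part_above_total_degree:
  assumes "multiarrangement \<A>" "i + j > length \<A>"
  shows "quotient_dim superspace_const (ideal_I \<A>) (superspace_homogeneous i j) = 0"
proof -
  have "length (filter (nonzero_on UNIV) (form_list \<A>)) \<le> length \<A>"
    using length_filter_le[of "nonzero_on UNIV" "form_list \<A>"] by simp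
  then have "int (length (filter (nonzero_on UNIV) (form_list \<A>))) < int i + int j"
    using assms(2) by linarith
  then have "f \<in> line_ideal (form_list \<A>) UNIV" if "f \<in> graded_part UNIV (int i) (int j)" for f
    using that line_ideal_above_top[OF vec.subspace_UNIV, of f "int i" "int j"]
    by (simp add: graded_part_def)
  then have "mod_basis (\<lambda>_. 0) 0 (graded_part UNIV (int i) (int j)) (line_ideal (form_list \<A>) UNIV)"
    by (rule mod_basis_zero)
  then show ?thesis
    using quotient_dim_eq[OF lin_closed_line_ideal]
    by (simp add: ideal_I_eq_line_ideal[OF assms(1)] superspace_homogeneous_eq)
qed

text \<open>Normals of hyperplanes are nonzero, so only the empty subset has rank zero. It follows
  that total degree \<open>length \<A>\<close> is actually attained.\<close>

lemma whitney_zero: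
  assumes "multiarrangement \<A>"
  shows "whitney [] (form_list \<A>) 0 = 1"
proof -
  have dim: "vec.dim (nth (form_list \<A>) ` S) = 0 \<longleftrightarrow> S = {}" if "S \<subseteq> {..<length \<A>}" for S
  proof
    assume "vec.dim (nth (form_list \<A>) ` S) = 0"
    then have "nth (form_list \<A>) ` S \<subseteq> {0}" by (simp add: vec.dim_eq_0)
    then show "S = {}" using form_list_nth(3)[OF assms] that by fastforce
  qed simp
  have "whitney [] (form_list \<A>) 0 = (\<Sum>S\<in>Pow {..<length \<A>}. if S = {} then 1 else 0)"
    unfolding whitney_def by (rule sum.cong) (auto simp: dim simp del: vec.dim_eq_0)
  then show ?thesis by simp
qed

lemma to_fract_power: "to_fract (x ^ k) = to_fract x ^ k"
  by (induction k) simp_all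

lemma to_fract_of_int: "to_fract (of_int c :: 'a::idom) = of_int c"
proof -
  have "to_fract (of_nat n :: 'a) = of_nat n" for n by (induction n) simp_all
  then show ?thesis by (cases c rule: int_diff_cases) (simp add: to_fract_diff)
qed

lemma to_fract_bivariate_monom:
  "to_fract (monom (monom c a) b) = of_int c * fract_q ^ a * fract_t ^ b"
proof -
  have "monom (monom c a) b = of_int c * [:[:0, 1:]:] ^ a * [:0, 1:] ^ b"
    by (simp add: monom_altdef of_int_poly poly_const_pow)
  then show ?thesis
    by (simp add: to_fract_power to_fract_of_int fract_q_def fract_t_def)
qed

lemma poly_map_poly_of_int_sum:
  fixes f :: "'b \<Rightarrow> int poly" and y :: "'a::comm_ring_1"
  shows "poly (map_poly of_int (\<Sum>i\<in>S. f i)) y = (\<Sum>i\<in>S. poly (map_poly of_int (f i)) y)"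
proof -
  have "map_poly of_int (p + q) = map_poly of_int p + (map_poly of_int q :: 'a poly)" for p q
    by (rule poly_eqI) (simp add: coeff_map_poly)
  then show ?thesis by (induction S rule: infinite_finite_induct) simp_all
qed

text \<open>Both sides are sums over subsets: with \<open>k\<close> the rank of \<open>S\<close>,
  each \<open>S\<close> contributes \<open>q^(m - k) * t^k\<close> with sign
  \<open>(- 1)^(card S + k)\<close>.\<close>

lemma char_poly_identity:
  assumes "multiarrangement \<A>"
  defines "r \<equiv> arr_rank \<A> {..<length \<A>}" and "m \<equiv> length \<A>"
  shows "to_fract (\<Sum>j\<le>m. monom (monom (whitney [] (form_list \<A>) (int j)) (m - j)) j) =
    (- 1) ^ r * fract_q ^ (m - r) * fract_t ^ r *
      poly (map_poly of_int (char_poly_arr \<A>)) (- fract_q / fract_t)"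
proof -
  let ?rk = "\<lambda>S. vec.dim (nth (form_list \<A>) ` S)"
  have t: "fract_t \<noteq> 0" by (simp add: fract_t_def)
  have rk: "arr_rank \<A> S = ?rk S" if "S \<subseteq> {..<m}" for S
    using arr_rank_eq[OF assms(1)] that by (simp add: m_def)
  have r: "r = ?rk {..<m}" using rk[of "{..<m}"] by (simp add: r_def m_def)
  have rm: "r \<le> m"
  proof -
    have "?rk {..<m} \<le> card (nth (form_list \<A>) ` {..<m})"
      by (rule vec.dim_le_card') simp
    also have "\<dots> \<le> m" using card_image_le[of "{..<m}" "nth (form_list \<A>)"] by simp
    finally show ?thesis using r by simp
  qed
  have rkr: "?rk S \<le> r" if "S \<subseteq> {..<m}" for S
    using vec.dim_subset[of "nth (form_list \<A>) ` S" "nth (form_list \<A>) ` {..<m}"] that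
    by (simp add: r image_mono)
  have "to_fract (\<Sum>j\<le>m. monom (monom (whitney [] (form_list \<A>) (int j)) (m - j)) j) =
      (\<Sum>j\<le>m. \<Sum>S\<in>Pow {..<m}. if ?rk S = j
         then (- 1) ^ (card S + ?rk S) * fract_q ^ (m - j) * fract_t ^ j else 0)"
    by (simp add: to_fract_bivariate_monom whitney_def m_def sum_distrib_right if_distrib
        cong: if_cong)
      (intro sum.cong refl, simp)
  also have "\<dots> =
     (\<Sum>S\<in>Pow {..<m}. (- 1) ^ (card S + ?rk S) * fract_q ^ (m - ?rk S) * fract_t ^ ?rk S)"
  \<comment> \<open>After the exchange each subset meets exactly one \<open>j\<close>, its rank,
    which is at most \<open>m\<close>.\<close>
  proof (subst sum.swap, rule sum.cong[OF refl])
    fix S assume "S \<in> Pow {..<m}"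
    then have "?rk S \<le> m" using rkr[of S] rm by auto
    then show "(\<Sum>j\<le>m. if ?rk S =
       j then (- 1) ^ (card S + ?rk S) * fract_q ^ (m - j) * fract_t ^ j else 0) =
        (- 1) ^ (card S + ?rk S) * fract_q ^ (m - ?rk S) * fract_t ^ ?rk S"
      by simp
  qed
  also have "\<dots> = (\<Sum>S\<in>Pow {..<m}. (- 1) ^ r * fract_q ^ (m - r) * fract_t ^ r *
      ((- 1) ^ card S * (- fract_q / fract_t) ^ (r - ?rk S)))"
  proof (rule sum.cong[OF refl])
    fix S assume "S \<in> Pow {..<m}"
    then obtain d where d: "r = ?rk S + d" using rkr[of S] le_Suc_ex by blast
    have mk: "m - ?rk S = (m - r) + d" using d rm by simp
    \<comment> \<open>The prefactor \<open>fract_t ^ r\<close> clears the denominator; here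
      \<open>d\<close> is the corank of \<open>S\<close>.\<close>
    have "(- fract_q / fract_t) ^ d * fract_t ^ d = (- 1) ^ d * fract_q ^ d"
      using t by (simp add: power_mult_distrib[symmetric])
    then have "(- 1) ^ d * ((- fract_q / fract_t) ^ d * fract_t ^ d) = fract_q ^ d"
      by (simp add: mult.assoc[symmetric] power_mult_distrib[symmetric])
    then have "(- 1) ^ (card S + ?rk S) * fract_q ^ (m - ?rk S) * fract_t ^ ?rk S =
        (- 1) ^ (card S + ?rk S) * fract_q ^ (m - r) *
        ((- 1) ^ d * ((- fract_q / fract_t) ^ d * fract_t ^ d)) * fract_t ^ ?rk S"
      by (simp only: mk power_add mult.assoc)
    also have "\<dots> = (- 1) ^ (?rk S + d) * fract_q ^ (m - r) * fract_t ^ (?rk S + d) *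
        ((- 1) ^ card S * (- fract_q / fract_t) ^ d)"
      by (simp only: power_add ac_simps)
    finally show "(- 1) ^ (card S + ?rk S) * fract_q ^ (m - ?rk S) * fract_t ^ ?rk S =
        (- 1) ^ r * fract_q ^ (m - r) * fract_t ^ r *
        ((- 1) ^ card S * (- fract_q / fract_t) ^ (r - ?rk S))"
      using d by simp
  qed
  also have "\<dots> = (- 1) ^ r * fract_q ^ (m - r) * fract_t ^ r *
      poly (map_poly of_int (char_poly_arr \<A>)) (- fract_q / fract_t)"
  proof -
    have "char_poly_arr \<A> = (\<Sum>S\<in>Pow {..<m}. monom ((- 1) ^ card S) (r - ?rk S))"
      unfolding char_poly_arr_def r_def[symmetric] m_def[symmetric]
        by (rule sum.cong) (auto simp: rk r)
    then show ?thesis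
      by (simp add: poly_map_poly_of_int_sum map_poly_monom poly_monom sum_distrib_left)
  qed
  finally show ?thesis .
qed

text \<open>Everything above total degree \<open>m\<close> vanishes, so a sum over exponents up to
  \<open>m\<close> captures the whole series as a polynomial.\<close>

lemma hilb_top_summand:
  assumes "multiarrangement \<A>"
  defines "m \<equiv> length \<A>"
  shows "\<exists>P. hilb_superspace_quotient (ideal_I \<A>) = fps_fps_of_poly_poly P \<and>
    top_summand P = (\<Sum>j\<le>m. monom (monom (whitney [] (form_list \<A>) (int j)) (m - j)) j)"
proof -
  define d where "d i j =
     int (quotient_dim superspace_const (ideal_I \<A>) (superspace_homogeneous i j))" for i j
  define P where "P = (\<Sum>j\<le>m. monom (\<Sum>i\<le>m. monom (d i j) i) j)"
  have top: "d i j = whitney [] (form_list \<A>) (int j)" if "i + j = m" for i j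
    using graded_part_total_degree[OF assms(1)] that by (simp add: d_def m_def)
  have above: "d i j = 0" if "i + j > m" for i j
    using graded_part_above_total_degree[OF assms(1)] that by (simp add: d_def m_def)
  have coeff: "coeff (coeff P j) i = d i j" for i j
  proof -
    have "coeff (\<Sum>i\<le>m. monom (d i j) i) i = (if i \<le> m then d i j else 0)" for i j
      by (simp add: coeff_sum)
    moreover have "coeff P j = (if j \<le> m then (\<Sum>i\<le>m. monom (d i j) i) else 0)"
      by (simp add: P_def coeff_sum)
    ultimately show ?thesis using above[of i j] by auto
  qed
  have "hilb_superspace_quotient (ideal_I \<A>) = fps_fps_of_poly_poly P"
    by (rule fps_ext, rule fps_ext)
      (simp add: hilb_superspace_quotient_def fps_fps_of_poly_poly_def coeff_map_poly coeff d_def)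
  moreover have "total_degree P = m"
    unfolding total_degree_def coeff
  proof (rule Max_eqI)
    have sub: "{i + j |i j. d i j \<noteq> 0} \<subseteq> {..m}" using above by (force simp: not_less[symmetric])
    then show "finite {i + j |i j. d i j \<noteq> 0}" by (rule finite_subset) simp
    show "k \<le> m" if "k \<in> {i + j |i j. d i j \<noteq> 0}" for k using that sub by auto
    \<comment> \<open>The coefficient of \<open>q^m\<close> is 1, which makes \<open>m\<close> the
      exact total degree.\<close>
    have "d m 0 \<noteq> 0" using top[of m 0] whitney_zero[OF assms(1)] by simp
    then show "m \<in> {i + j |i j. d i j \<noteq> 0}" by force
  qed
  then have "top_summand P = (\<Sum>j\<le>m. monom (monom (whitney [] (form_list \<A>) (int j)) (m - j)) j)"
    unfolding top_summand_def homogeneous_summand_def coeff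
    by (intro sum.cong) (auto simp: top)
  ultimately show ?thesis by blast
qed

theorem corollary4p5:
  fixes \<A> :: "(complex ^ 'n::{finite,linorder}) set list" and r m :: nat
  assumes "multiarrangement \<A>"
    and "r = arr_rank \<A> {..<length \<A>}"
    and "m = length \<A>"
  shows
    "fps_nth (hilb_superspace_quotient (ideal_I \<A>)) 0 = hilb_cpoly_quotient (ideal_J \<A> 1) \<and>
     (r = CARD('n) \<longrightarrow>
       fps_nth (hilb_superspace_quotient (ideal_I \<A>)) r = hilb_cpoly_quotient (ideal_J \<A> 0)) \<and>
     (\<exists>P. hilb_superspace_quotient (ideal_I \<A>) = fps_fps_of_poly_poly P \<and>
       to_fract (top_summand P) =
         (- 1) ^ r * fract_q ^ (m - r) * fract_t ^ r *
         poly (map_poly of_int (char_poly_arr \<A>)) (- fract_q / fract_t))"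
proof -
  obtain P where "hilb_superspace_quotient (ideal_I \<A>) = fps_fps_of_poly_poly P"
    "top_summand P = (\<Sum>j\<le>m. monom (monom (whitney [] (form_list \<A>) (int j)) (m - j)) j)"
    using hilb_top_summand[OF assms(1)] unfolding assms(3) by blast
  then show ?thesis
    using hilb_fermionic_degree_0[OF assms(1)] hilb_fermionic_degree_top[OF assms(1)]
      char_poly_identity[OF assms(1)] unfolding assms(2,3) by auto
qed

end
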